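(* Let $c\in\mathbb{C}$ and $n\geq 1$, and let $g=[g_{0}:\cdots:g_{n}]$ be a holomorphic curve of $\mathbb{C}$ into $\mathbb{P}^n(\mathbb{C})$ with hyper-order $\varsigma:=\varsigma(g)<1$, where $g_{0},\ldots,g_{n}$ are linearly independent over $\mathcal{P}_{c}^{1}$. Suppose $$f_{j}=\sum_{i=0}^{n}a_{ij}g_{i},\qquad j=0,\ldots,q,\quad q>n,$$ where $a_{ij}$ are $c$-periodic entire functions satisfying $T(r,a_{ij})=o(T_{g}(r))$, such that any $n+1$ of the $q+1$ functions $f_{0},\ldots,f_{q}$ are linearly independent over $\mathcal{P}_{c}^{1}$, and let $$L=\frac{f_{0}f_{1}\cdots f_{q}}{C(g_{0},g_{1},\ldots,g_{n})}.$$ Then $$(q-n)T_{g}(r)\leq N\left(r,\frac{1}{L}\right)-N(r,L)+o(T_{g}(r)),$$ where $r$ approaches infinity outside of an exceptional set $E$ of finite logarithmic measure.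
   Context: A holomorphic curve $g=[g_0:\cdots:g_n]:\mathbb{C}\to\mathbb{P}^n$ is given by a reduced representation, i.e. $g_0,\ldots,g_n$ are entire functions with no common zeros in $\mathbb{C}$. Its Cartan characteristic function is $$T_g(r)=\int_0^{2\pi}u(re^{i\theta})\frac{d\theta}{2\pi}-u(0),\qquad u(z)=\max_{0\le k\le n}\log|g_k(z)|,$$ and its hyper-order is $\varsigma(g)=\limsup_{r\to\infty}\frac{\log\log T_g(r)}{\log r}$. $\mathcal{P}_c^1$ is the field of meromorphic functions in $\mathbb{C}$ of period $c$ whose hyper-order (the same limsup with the Nevanlinna characteristic $T(r,f)$) is strictly less than one. The Casorati determinant is $C(g_0,\ldots,g_n)=\det\bigl(g_j(z+ic)\bigr)_{0\le i,j\le n}$ (row index $i$, column index $j$). $T(r,f)$ and $N(r,f)$ denote the usual Nevanlinna characteristic and (integrated, with multiplicity) counting function of poles. A set $E\subset(0,\infty)$ has finite logarithmic measure if $\int_{E\cap[1,\infty)}dt/t<\infty$. *)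

theory Defs
  imports
    "HOL-Complex_Analysis.Complex_Analysis"
    "HOL-Library.Landau_Symbols"
    "Jordan_Normal_Form.Determinant"
begin

definition log_plus :: "real \<Rightarrow> real" where
  "log_plus x = ln (max 1 x)"

text \<open>
  The Nevanlinna functions depend only on the germs of \<open>f\<close> at punctured neighbourhoods
  (up to a null set on circles), so they are insensitive to the values a meromorphic function is
  given at its poles and removable singularities; in particular \<open>1/L\<close> may be taken pointwise.
\<close>

definition pole_mult :: "(complex \<Rightarrow> complex) \<Rightarrow> complex \<Rightarrow> nat" where
  "pole_mult f z = (if is_pole f z then nat (- zorder f z) else 0)"

definition pole_count :: "real \<Rightarrow> (complex \<Rightarrow> complex) \<Rightarrow> real" where
  "pole_count t f = (\<Sum>z\<in>{z. norm z \<le> t \<and> is_pole f z}. real (pole_mult f z))"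

definition nevanlinna_N :: "real \<Rightarrow> (complex \<Rightarrow> complex) \<Rightarrow> real" where
  "nevanlinna_N r f =
     integral {0..r} (\<lambda>t. (pole_count t f - pole_count 0 f) / t) + pole_count 0 f * ln r"

definition nevanlinna_m :: "real \<Rightarrow> (complex \<Rightarrow> complex) \<Rightarrow> real" where
  "nevanlinna_m r f =
     integral {0..2*pi} (\<lambda>\<theta>. log_plus (norm (f (of_real r * cis \<theta>)))) / (2*pi)"

definition nevanlinna_T :: "real \<Rightarrow> (complex \<Rightarrow> complex) \<Rightarrow> real" where
  "nevanlinna_T r f = nevanlinna_m r f + nevanlinna_N r f"

text \<open>
  The positive part of the logarithm matters only for bounded \<open>T\<close> (constant functions and
  curves), where \<open>log (log T)\<close> may be undefined; these get hyper-order \<open>0\<close>.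
\<close>

definition hyper_order :: "(real \<Rightarrow> real) \<Rightarrow> ereal" where
  "hyper_order T = Limsup at_top (\<lambda>r. ereal (log_plus (log_plus (T r)) / ln r))"

definition reduced_representation :: "nat \<Rightarrow> (nat \<Rightarrow> complex \<Rightarrow> complex) \<Rightarrow> bool" where
  "reduced_representation n g \<longleftrightarrow>
     (\<forall>k\<le>n. g k holomorphic_on UNIV) \<and> (\<forall>z. \<exists>k\<le>n. g k z \<noteq> 0)"

text \<open>
  Vanishing components contribute \<open>log 0 = -\<infinity>\<close> to the maximum and are left out, since
  \<open>ln 0 = 0\<close> for the library's real logarithm. The remaining set of indices is nonempty for a
  reduced representation.
\<close>

definition cartan_u :: "nat \<Rightarrow> (nat \<Rightarrow> complex \<Rightarrow> complex) \<Rightarrow> complex \<Rightarrow> real" where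
  "cartan_u n g z = Max ((\<lambda>k. ln (norm (g k z))) ` {k. k \<le> n \<and> g k z \<noteq> 0})"

definition cartan_T :: "nat \<Rightarrow> (nat \<Rightarrow> complex \<Rightarrow> complex) \<Rightarrow> real \<Rightarrow> real" where
  "cartan_T n g r =
     integral {0..2*pi} (\<lambda>\<theta>. cartan_u n g (of_real r * cis \<theta>)) / (2*pi) - cartan_u n g 0"

text \<open>
  Each meromorphic function on the plane is represented by its unique nicely meromorphic
  version: continuous away from its poles, with value \<open>0\<close> at the poles.
\<close>

definition periodic_field :: "complex \<Rightarrow> (complex \<Rightarrow> complex) set" where
  "periodic_field c =
     {f. f nicely_meromorphic_on UNIV \<and> (\<forall>z. f (z + c) = f z) \<and>
         hyper_order (\<lambda>r. nevanlinna_T r f) < 1}"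

text \<open>
  A linear relation is an identity of meromorphic functions, so it is required off a discrete
  closed set only: the values of the coefficients at their poles play no role.
\<close>

definition lin_indep_over ::
  "(complex \<Rightarrow> complex) set \<Rightarrow> 'i set \<Rightarrow> ('i \<Rightarrow> complex \<Rightarrow> complex) \<Rightarrow> bool" where
  "lin_indep_over K J h \<longleftrightarrow>
     (\<forall>b. (\<forall>j\<in>J. b j \<in> K) \<longrightarrow>
          (\<forall>\<^sub>\<approx>z\<in>UNIV. (\<Sum>j\<in>J. b j z * h j z) = 0) \<longrightarrow>
          (\<forall>j\<in>J. \<forall>z. b j z = 0))"

definition casorati ::
  "complex \<Rightarrow> nat \<Rightarrow> (nat \<Rightarrow> complex \<Rightarrow> complex) \<Rightarrow> complex \<Rightarrow> complex" where
  "casorati c n g z =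
     Determinant.det (Matrix.mat (n + 1) (n + 1) (\<lambda>(i, j). g j (z + of_nat i * c)))"

definition finite_log_measure :: "real set \<Rightarrow> bool" where
  "finite_log_measure E \<longleftrightarrow> E \<subseteq> {0<..} \<and> E \<in> sets lebesgue \<and>
     (\<integral>\<^sup>+ t \<in> E \<inter> {1..}. ennreal (1 / t) \<partial>lebesgue) < \<infinity>"

end

theory Submission
  imports Defs "HOL-Real_Asymp.Real_Asymp"
begin

text \<open>
  At a point \<open>z\<close> of the circle of radius \<open>r\<close>, select the \<open>n + 1\<close> smallest of the numbers
  \<open>|f\<^sub>0(z)|, \<dots>, |f\<^sub>q(z)|\<close>. By Cramer's rule the remaining \<open>q - n\<close> satisfy \<open>log |f\<^sub>j| \<ge> u - E\<close>, where \<open>E\<close>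
  has a small mean because the coefficients are small functions. Since the coefficients have
  period \<open>c\<close>, the Casorati determinant of the selected forms is \<open>C(g)\<close> times their coefficient
  determinant, so the selected part of \<open>L\<close> is controlled by the determinant with the entries
  \<open>f\<^sub>j(z + ic) / f\<^sub>j(z)\<close>. Jensen's formula turns the mean of \<open>log |L|\<close> into \<open>N(r, 1/L) - N(r, L)\<close>.

  The shift quotients are compared with those of one linear combination \<open>G\<close> of the \<open>g\<^sub>k\<close> that does
  not vanish at \<open>0, c, \<dots>, nc\<close>. For \<open>h = f\<^sub>j / G\<close> the Poisson--Jensen formula and the inequality
  \<open>log (1 + t) \<le> 2 t\<^sup>\<delta> / \<delta>\<close> bound the mean of \<open>|log |h(z + ic) / h(z)||\<close> by a multiple of
  \<open>T(r + d) (1/d + 1 / (d r\<^bsup>\<delta>-1\<^esup>))\<close> with \<open>d = r\<^bsup>1-\<tau>\<^esup>\<close>, where the hyper-order is less than \<open>\<tau>\<close> and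
  \<open>\<tau> < \<delta> < 1\<close>; outside a set of finite logarithmic measure \<open>T(r + d) \<le> 2 T(r)\<close>. The countably many
  radii at which one of the finitely many functions involved has a zero on the circle also belong
  to the exceptional set, so that every mean is an integral of a continuous function.
\<close>

section \<open>Means over circles and the Poisson formula\<close>

text \<open>The comparison with \<open>G\<close> is forced by the freedom in the reduced
  representation. Multiplying all \<open>g k\<close> by \<open>exp h\<close>, \<open>h\<close>
  entire, adds \<open>Re h\<close> to \<open>u\<close> and leaves \<open>T\<close> unchanged,
  because \<open>Re h\<close> has mean \<open>Re (h 0)\<close>. So \<open>T\<close> controls neither
  the mean of \<open>\<bar>u\<bar>\<close> nor that of \<open>\<bar>ln (norm (f j z))\<bar>\<close>,
  but it does control the mean of \<open>\<bar>ln (norm (f j z)) - ln (norm (G z))\<bar>\<close>.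
  The quotient of \<open>G (z + i c)\<close> and \<open>G z\<close> is common to row
  \<open>i\<close> of the determinant; only the signed mean of its logarithm is needed, and that
  compares Jensen's formula at the centres \<open>i c\<close> and \<open>0\<close>, where
  \<open>G\<close> must not vanish. The exponents: between circles at distance
  \<open>r powr (1 - \<tau>)\<close> a zero count costs \<open>r powr \<tau> * T r\<close>, while
  one zero contributes only order \<open>r powr (- \<delta>)\<close>. Independence over the periodic
  functions enters through the nonvanishing of the Casorati determinant and of the coefficient
  determinants. Hyper-order there concerns all radii, without exceptional set, but is insensitive to
  linear factors and dilations, so bounds like \<open>C * r * T (4 * r)\<close> suffice.\<close>

definition cmean :: "complex \<Rightarrow> real \<Rightarrow> (complex \<Rightarrow> real) \<Rightarrow> real" where
  "cmean b r \<phi> = integral {0..2*pi} (\<lambda>t. \<phi> (b + of_real r * cis t)) / (2*pi)"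

lemma circle_in_sphere: "r \<ge> 0 \<Longrightarrow> b + of_real r * cis t \<in> sphere b r"
  by (simp add: dist_norm norm_mult)

lemma continuous_on_circle:
  assumes "continuous_on (sphere b r) \<phi>" "r \<ge> 0"
  shows "continuous_on A (\<lambda>t. \<phi> (b + of_real r * cis t))"
proof (rule continuous_on_compose2[OF assms(1)])
  show "continuous_on A (\<lambda>t. b + of_real r * cis t)" by (intro continuous_intros)
qed (use assms circle_in_sphere in auto)

lemma circle_integrable:
  assumes "continuous_on (sphere b r) (\<phi> :: complex \<Rightarrow> real)" "r \<ge> 0"
  shows "(\<lambda>t. \<phi> (b + of_real r * cis t)) integrable_on {x..y}"
  by (intro integrable_continuous_interval continuous_on_circle assms)

lemma cmean_cong:
  assumes "\<And>z. z \<in> sphere b r \<Longrightarrow> \<phi> z = \<psi> z" "r \<ge> 0"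
  shows "cmean b r \<phi> = cmean b r \<psi>"
  unfolding cmean_def using assms circle_in_sphere by (metis (mono_tags, lifting) integral_cong)

lemma cmean_add:
  assumes "continuous_on (sphere b r) \<phi>" "continuous_on (sphere b r) \<psi>" "r \<ge> 0"
  shows "cmean b r (\<lambda>z. \<phi> z + \<psi> z) = cmean b r \<phi> + cmean b r \<psi>"
  unfolding cmean_def
  by (simp add: Henstock_Kurzweil_Integration.integral_add circle_integrable assms add_divide_distrib)

lemma cmean_cmult: "cmean b r (\<lambda>z. k * \<phi> z) = k * cmean b r \<phi>"
  unfolding cmean_def by simp

lemma cmean_minus: "cmean b r (\<lambda>z. - \<phi> z) = - cmean b r \<phi>"
  unfolding cmean_def by simp

lemma cmean_diff:
  assumes "continuous_on (sphere b r) \<phi>" "continuous_on (sphere b r) \<psi>" "r \<ge> 0"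
  shows "cmean b r (\<lambda>z. \<phi> z - \<psi> z) = cmean b r \<phi> - cmean b r \<psi>"
  unfolding cmean_def
  by (simp add: Henstock_Kurzweil_Integration.integral_diff circle_integrable assms diff_divide_distrib)

lemma cmean_const [simp]: "cmean b r (\<lambda>_. k) = k"
  unfolding cmean_def by simp

lemma cmean_sum:
  assumes "finite A" "\<And>a. a \<in> A \<Longrightarrow> continuous_on (sphere b r) (\<phi> a)" "r \<ge> 0"
  shows "cmean b r (\<lambda>z. \<Sum>a\<in>A. \<phi> a z) = (\<Sum>a\<in>A. cmean b r (\<phi> a))"
  using assms
  by (induction A rule: finite_induct) (simp_all add: cmean_add continuous_on_sum)

lemma cmean_mono:
  assumes "continuous_on (sphere b r) \<phi>" "continuous_on (sphere b r) \<psi>" "r \<ge> 0"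
    and "\<And>z. z \<in> sphere b r \<Longrightarrow> \<phi> z \<le> \<psi> z"
  shows "cmean b r \<phi> \<le> cmean b r \<psi>"
  unfolding cmean_def
  by (intro divide_right_mono integral_le circle_integrable assms circle_in_sphere) auto

lemma cmean_nonneg:
  assumes "continuous_on (sphere b r) \<phi>" "r \<ge> 0" "\<And>z. z \<in> sphere b r \<Longrightarrow> 0 \<le> \<phi> z"
  shows "0 \<le> cmean b r \<phi>"
  using cmean_mono[of b r "\<lambda>_. 0" \<phi>] assms by simp

lemma cmean_shift: "cmean b r \<phi> = cmean 0 r (\<lambda>z. \<phi> (z + b))"
  unfolding cmean_def by (simp add: add.commute)

text \<open>The Poisson kernel of the disc of radius \<open>norm \<zeta>\<close>. Writing it as a
  real part shows that it is harmonic in \<open>z\<close> for fixed \<open>\<zeta>\<close>, which is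
  how \<open>cmean_poisson\<close> averages it; \<open>poisson_eq\<close> gives the usual
  quotient.\<close>

definition poisson :: "complex \<Rightarrow> complex \<Rightarrow> real" where
  "poisson z \<zeta> = Re ((\<zeta> + z) / (\<zeta> - z))"

lemma poisson_eq:
  assumes "z \<noteq> \<zeta>"
  shows "poisson z \<zeta> = ((norm \<zeta>)\<^sup>2 - (norm z)\<^sup>2) / (norm (\<zeta> - z))\<^sup>2"
proof -
  have "(\<zeta> + z) / (\<zeta> - z) = (\<zeta> + z) * cnj (\<zeta> - z) / of_real ((norm (\<zeta> - z))\<^sup>2)"
    by (rule complex_div_cnj[unfolded of_real_power[symmetric]])
  then have "poisson z \<zeta> = Re ((\<zeta> + z) * cnj (\<zeta> - z)) / (norm (\<zeta> - z))\<^sup>2"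
    unfolding poisson_def by simp
  also have "Re ((\<zeta> + z) * cnj (\<zeta> - z)) = (norm \<zeta>)\<^sup>2 - (norm z)\<^sup>2"
    unfolding cmod_power2 by (simp add: power2_eq_square algebra_simps)
  finally show ?thesis .
qed

lemma poisson_nonneg:
  assumes "norm z < norm \<zeta>"
  shows "0 \<le> poisson z \<zeta>"
proof -
  have "z \<noteq> \<zeta>" using assms by auto
  moreover have "(norm z)\<^sup>2 \<le> (norm \<zeta>)\<^sup>2" using assms by (simp add: power_mono)
  ultimately show ?thesis by (simp add: poisson_eq)
qed

lemma poisson_le:
  assumes "norm z < norm \<zeta>"
  shows "poisson z \<zeta> \<le> (norm \<zeta> + norm z) / (norm \<zeta> - norm z)"
proof -
  have ne: "z \<noteq> \<zeta>" using assms by auto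
  have "(norm \<zeta> - norm z)\<^sup>2 \<le> (norm (\<zeta> - z))\<^sup>2"
    using assms norm_triangle_ineq2[of \<zeta> z] by (intro power_mono) auto
  then have "poisson z \<zeta> \<le> ((norm \<zeta>)\<^sup>2 - (norm z)\<^sup>2) / (norm \<zeta> - norm z)\<^sup>2"
    unfolding poisson_eq[OF ne] using assms
    by (intro divide_left_mono mult_pos_pos) (auto simp: power_mono ne ne[symmetric])
  also have "\<dots> = (norm \<zeta> + norm z) / (norm \<zeta> - norm z)"
  proof -
    have "(norm \<zeta>)\<^sup>2 - (norm z)\<^sup>2 = (norm \<zeta> + norm z) * (norm \<zeta> - norm z)"
      by (simp add: power2_eq_square algebra_simps)
    then show ?thesis using assms by (simp add: power2_eq_square)
  qed
  finally show ?thesis .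
qed

lemma poisson_continuous:
  assumes "norm z < s"
  shows "continuous_on (sphere 0 s) (poisson z)"
  unfolding poisson_def using assms by (intro continuous_intros) auto

text \<open>Cauchy's formula for the point \<open>z\<close> and Cauchy's theorem for the reflected
  point \<open>s\<^sup>2 / cnj z\<close>, which lies outside the circle, are subtracted: on the
  circle the difference of the two kernels is the real Poisson kernel.\<close>

lemma Poisson_formula_Re:
  assumes hol: "H holomorphic_on ball 0 S" and s: "norm z < s" "s < S"
  shows "Re (H z) = cmean 0 s (\<lambda>\<zeta>. poisson z \<zeta> * Re (H \<zeta>))"
proof -
  have s0: "s > 0" using s by (meson norm_ge_zero order_le_less_trans)
  let ?\<zeta> = "\<lambda>t. of_real s * cis t"
  have n\<zeta>: "norm (?\<zeta> t) = s" for t using s0 by (simp add: norm_mult)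
  have i1: "((\<lambda>t. H (?\<zeta> t) / (?\<zeta> t - z) * s * \<i> * cis t) has_integral (2 * of_real pi * \<i> * H z)) {0..2*pi}"
  proof -
    have "((\<lambda>u. H u/(u-z)) has_contour_integral (2 * of_real pi * \<i> * H z)) (circlepath 0 s)"
      using s by (intro Cauchy_integral_circlepath_simple holomorphic_on_subset[OF hol]) auto
    then show ?thesis unfolding circlepath_def
      by (subst (asm) has_contour_integral_part_circlepath_iff) auto
  qed
  have i2: "((\<lambda>t. H (?\<zeta> t) * cnj z / (cnj z * ?\<zeta> t - (complex_of_real s)\<^sup>2) * s * \<i> * cis t) has_integral 0) {0..2*pi}"
  proof -
    \<comment> \<open>The larger disc must stay short of the reflected point
      \<open>s\<^sup>2 / cnj z\<close>; for \<open>z = 0\<close> there is none.\<close>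
    define e where "e = (if z = 0 then S else min S (s\<^sup>2 / norm z))"
    have e: "s < e" using s s0 by (auto simp: e_def field_simps power2_eq_square)
    have "((\<lambda>u. H u * cnj z / (cnj z * u - (complex_of_real s)\<^sup>2)) has_contour_integral 0) (circlepath 0 s)"
    proof (rule Cauchy_theorem_disc_simple)
      show "(\<lambda>u. H u * cnj z / (cnj z * u - (complex_of_real s)\<^sup>2)) holomorphic_on ball 0 e"
      proof (intro holomorphic_intros holomorphic_on_subset[OF hol])
        show "ball 0 e \<subseteq> ball (0::complex) S" by (auto simp: e_def split: if_splits)
        fix u :: complex assume u: "u \<in> ball 0 e"
        have "norm (cnj z * u) < s\<^sup>2"
          using u s0 by (cases "z = 0") (auto simp: e_def norm_mult field_simps)
        then show "cnj z * u - (complex_of_real s)\<^sup>2 \<noteq> 0"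
          by (metis norm_of_real of_real_power order_less_irrefl abs_of_nonneg right_minus_eq zero_le_power2)
      qed
    qed (use e s0 in auto)
    then show ?thesis unfolding circlepath_def
      by (subst (asm) has_contour_integral_part_circlepath_iff) auto
  qed
  have P: "of_real (poisson z \<zeta>) = \<zeta> / (\<zeta> - z) - cnj z * \<zeta> / (cnj z * \<zeta> - (complex_of_real s)\<^sup>2)"
    if "norm \<zeta> = s" for \<zeta>
  proof -
    have ne: "\<zeta> - z \<noteq> 0" "cnj \<zeta> - cnj z \<noteq> 0" "\<zeta> \<noteq> 0" using that s s0
      by (auto simp flip: complex_cnj_diff)
    \<comment> \<open>On the circle \<open>cnj \<zeta>\<close> is
      \<open>s\<^sup>2 / \<zeta>\<close>, which turns the conjugated half of the kernel into a
      rational function of \<open>\<zeta>\<close>.\<close>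
    have sq: "(complex_of_real s)\<^sup>2 = \<zeta> * cnj \<zeta>"
      using that by (metis complex_norm_square of_real_power)
    have "of_real (poisson z \<zeta>) = ((\<zeta> + z) / (\<zeta> - z) + cnj ((\<zeta> + z) / (\<zeta> - z))) / 2"
      unfolding poisson_def by (simp only: complex_add_cnj) simp
    also have "\<dots> = ((\<zeta> + z) / (\<zeta> - z) + (cnj \<zeta> + cnj z) / (cnj \<zeta> - cnj z)) / 2" by simp
    also have "\<dots> = \<zeta> / (\<zeta> - z) + cnj z / (cnj \<zeta> - cnj z)"
      using ne(1,2) by (simp add: divide_simps) (simp add: algebra_simps)
    also have "cnj z / (cnj \<zeta> - cnj z) = - (cnj z * \<zeta> / (cnj z * \<zeta> - \<zeta> * cnj \<zeta>))"
    proof -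
      have "cnj z * \<zeta> - \<zeta> * cnj \<zeta> = - (\<zeta> * (cnj \<zeta> - cnj z))" by (simp add: algebra_simps)
      then show ?thesis using ne by simp
    qed
    finally show ?thesis using sq by simp
  qed
  have "((\<lambda>t. -\<i> * (H (?\<zeta> t) / (?\<zeta> t - z) * s * \<i> * cis t - H (?\<zeta> t) * cnj z / (cnj z * ?\<zeta> t - (complex_of_real s)\<^sup>2) * s * \<i> * cis t))
       has_integral (-\<i> * (2 * of_real pi * \<i> * H z - 0))) {0..2*pi}"
    by (intro has_integral_mult_right has_integral_diff i1 i2)
  moreover have "-\<i> * (H (?\<zeta> t) / (?\<zeta> t - z) * s * \<i> * cis t - H (?\<zeta> t) * cnj z / (cnj z * ?\<zeta> t - (complex_of_real s)\<^sup>2) * s * \<i> * cis t)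
     = of_real (poisson z (?\<zeta> t)) * H (?\<zeta> t)" for t
    unfolding P[OF n\<zeta>] by (simp add: algebra_simps)
  moreover have "-\<i> * (2 * of_real pi * \<i> * H z - 0) = 2 * of_real pi * H z" by simp
  ultimately have "((\<lambda>t. of_real (poisson z (?\<zeta> t)) * H (?\<zeta> t)) has_integral (2 * of_real pi * H z)) {0..2*pi}"
    by (simp only:)
  from has_integral_Re[OF this]
  have "((\<lambda>t. poisson z (?\<zeta> t) * Re (H (?\<zeta> t))) has_integral (2 * pi * Re (H z))) {0..2*pi}"
    by simp
  then show ?thesis unfolding cmean_def by (simp add: integral_unique)
qed

text \<open>A zero-free function on a disc has a holomorphic logarithm, and
  \<open>ln (norm (H z))\<close> is its real part.\<close>

lemma Poisson_formula_ln:
  assumes hol: "H holomorphic_on ball 0 S" and nz: "\<And>z. norm z < S \<Longrightarrow> H z \<noteq> 0"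
    and s: "norm z < s" "s < S"
  shows "ln (norm (H z)) = cmean 0 s (\<lambda>\<zeta>. poisson z \<zeta> * ln (norm (H \<zeta>)))"
proof -
  have s0: "s > 0" using s by (meson norm_ge_zero order_le_less_trans)
  obtain g where g: "g holomorphic_on ball 0 S" "\<And>x. x \<in> ball 0 S \<Longrightarrow> exp (g x) = H x"
    using holomorphic_logarithm_exists[of "ball 0 S" H 0] hol nz s s0 by auto
  have *: "ln (norm (H x)) = Re (g x)" if "norm x < S" for x
    using g(2)[of x] that by (metis ln_exp mem_ball_0 norm_exp_eq_Re)
  have "Re (g z) = cmean 0 s (\<lambda>\<zeta>. poisson z \<zeta> * Re (g \<zeta>))"
    by (rule Poisson_formula_Re[OF g(1) s])
  also have "\<dots> = cmean 0 s (\<lambda>\<zeta>. poisson z \<zeta> * ln (norm (H \<zeta>)))"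
    using s s0 by (intro cmean_cong) (auto simp: *)
  finally show ?thesis using * s by simp
qed

lemma poisson_0 [simp]: "\<zeta> \<noteq> 0 \<Longrightarrow> poisson 0 \<zeta> = 1"
  by (simp add: poisson_def)

lemma mean_value_Re:
  assumes hol: "H holomorphic_on ball b S" and s: "0 < s" "s < S"
  shows "cmean b s (\<lambda>\<zeta>. Re (H \<zeta>)) = Re (H b)"
proof -
  have "(\<lambda>z. H (z + b)) holomorphic_on ball 0 S"
    by (rule holomorphic_on_compose_gen[OF _ hol, of "\<lambda>z. z + b", unfolded o_def])
       (auto intro!: holomorphic_intros simp: dist_norm)
  from Poisson_formula_Re[OF this, of 0 s]
  have "Re (H b) = cmean 0 s (\<lambda>\<zeta>. poisson 0 \<zeta> * Re (H (\<zeta> + b)))" using s by simp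
  also have "\<dots> = cmean 0 s (\<lambda>\<zeta>. Re (H (\<zeta> + b)))"
    using s by (intro cmean_cong) auto
  finally show ?thesis by (subst cmean_shift) simp
qed

lemma mean_value_ln:
  assumes hol: "H holomorphic_on ball b S" and nz: "\<And>z. z \<in> ball b S \<Longrightarrow> H z \<noteq> 0"
    and s: "0 < s" "s < S"
  shows "cmean b s (\<lambda>\<zeta>. ln (norm (H \<zeta>))) = ln (norm (H b))"
proof -
  obtain g where g: "g holomorphic_on ball b S" "\<And>x. x \<in> ball b S \<Longrightarrow> exp (g x) = H x"
    using holomorphic_logarithm_exists[of "ball b S" H b] hol nz s by auto
  have *: "ln (norm (H x)) = Re (g x)" if "x \<in> ball b S" for x
    using g(2)[of x] that by (metis ln_exp norm_exp_eq_Re)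
  have "cmean b s (\<lambda>\<zeta>. ln (norm (H \<zeta>))) = cmean b s (\<lambda>\<zeta>. Re (g \<zeta>))"
    using s by (intro cmean_cong) (auto simp: *)
  then show ?thesis using mean_value_Re[OF g(1) s] * s by simp
qed

text \<open>For fixed \<open>\<zeta>\<close> the kernel is the real part of a function holomorphic
  near the disc about \<open>b\<close>, so the mean value property applies. Together with Fubini
  this averages Poisson integrals over circles that need not be centred at \<open>0\<close>.\<close>

lemma cmean_poisson:
  assumes "norm b + r < norm \<zeta>" "r > 0"
  shows "cmean b r (\<lambda>z. poisson z \<zeta>) = poisson b \<zeta>"
  unfolding poisson_def
proof (rule mean_value_Re)
  show "(\<lambda>z. (\<zeta> + z) / (\<zeta> - z)) holomorphic_on ball b (norm \<zeta> - norm b)"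
  proof (intro holomorphic_intros)
    fix z assume "z \<in> ball b (norm \<zeta> - norm b)"
    then have "norm z < norm \<zeta>" using norm_triangle_ineq2[of z b] by (simp add: dist_norm norm_minus_commute)
    then show "\<zeta> - z \<noteq> 0" by auto
  qed
qed (use assms in auto)

lemma cmean_swap:
  assumes cont: "continuous_on (sphere b r \<times> sphere b' r') (\<lambda>(x, y). f x y)"
    and "r \<ge> 0" "r' \<ge> 0"
  shows "cmean b r (\<lambda>x. cmean b' r' (\<lambda>y. f x y)) = cmean b' r' (\<lambda>y. cmean b r (\<lambda>x. f x y))"
proof -
  let ?F = "\<lambda>s t. f (b + of_real r * cis s) (b' + of_real r' * cis t)"
  have "continuous_on (cbox (0, 0) (2*pi, 2*pi)) (\<lambda>p. (case (b + of_real r * cis (fst p), b' + of_real r' * cis (snd p)) of (x, y) \<Rightarrow> f x y))"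
  proof (rule continuous_on_compose2[OF cont])
    show "continuous_on (cbox (0, 0) (2*pi, 2*pi)) (\<lambda>p. (b + of_real r * cis (fst p), b' + of_real r' * cis (snd p)))"
      by (intro continuous_intros)
  qed (use assms circle_in_sphere in auto)
  then have "continuous_on (cbox (0, 0) (2*pi, 2*pi)) (\<lambda>(s, t). ?F s t)"
    by (simp add: case_prod_unfold)
  from integral_swap_continuous[OF this]
  have "integral {0..2*pi} (\<lambda>s. integral {0..2*pi} (?F s)) = integral {0..2*pi} (\<lambda>t. integral {0..2*pi} (\<lambda>s. ?F s t))"
    by simp
  then show ?thesis unfolding cmean_def by simp
qed

lemma cmean_continuous:
  assumes cont: "continuous_on (sphere b r \<times> sphere b' r') (\<lambda>(x, y). f x y :: real)"
    and "r \<ge> 0" "r' \<ge> 0"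
  shows "continuous_on (sphere b r) (\<lambda>x. cmean b' r' (\<lambda>y. f x y))"
proof -
  have "continuous_on (sphere b r \<times> {0..2*pi}) (\<lambda>p. (case (fst p, b' + of_real r' * cis (snd p)) of (x, y) \<Rightarrow> f x y))"
    by (rule continuous_on_compose2[OF cont])
      (use assms circle_in_sphere in \<open>auto intro!: continuous_intros\<close>)
  then have "continuous_on (sphere b r \<times> cbox 0 (2*pi)) (\<lambda>(x, t). f x (b' + of_real r' * cis t))"
    by (simp add: case_prod_unfold)
  from integral_continuous_on_param[OF this]
  show ?thesis unfolding cmean_def by (intro continuous_intros) auto
qed

section \<open>Zeros of entire functions\<close>

definition entire_nz :: "(complex \<Rightarrow> complex) \<Rightarrow> bool" where
  "entire_nz F \<longleftrightarrow> F holomorphic_on UNIV \<and> (\<exists>w. F w \<noteq> 0)"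

definition zmult :: "(complex \<Rightarrow> complex) \<Rightarrow> complex \<Rightarrow> nat" where
  "zmult F a = (if F a = 0 then nat (zorder F a) else 0)"

definition zeros_in :: "(complex \<Rightarrow> complex) \<Rightarrow> real \<Rightarrow> complex set" where
  "zeros_in F S = {a. norm a \<le> S \<and> F a = 0}"

lemma finite_zeros_in:
  assumes "entire_nz F"
  shows "finite (zeros_in F S)"
proof (cases "F constant_on UNIV")
  case True
  then show ?thesis using assms by (auto simp: entire_nz_def zeros_in_def constant_on_def)
next
  case False
  have "finite {z \<in> cball 0 S. F z = 0}"
    using assms by (intro holomorphic_compact_finite_zeros[OF _ _ _ _ _ False]) (auto simp: entire_nz_def)
  then show ?thesis by (simp add: zeros_in_def)
qed

lemma countable_zeros:
  assumes "entire_nz F"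
  shows "countable {z. F z = 0}"
proof (cases "F constant_on UNIV")
  case True
  then show ?thesis using assms by (auto simp: entire_nz_def constant_on_def)
next
  case False
  have "countable {z \<in> UNIV. F z = 0}"
    using assms by (intro holomorphic_countable_zeros[OF _ _ _ _ False])
      (auto simp: entire_nz_def intro: fsigma_UNIV)
  then show ?thesis by simp
qed

text \<open>A bad radius is the distance from \<open>b\<close> to one of countably many zeros. Means
  of \<open>ln (norm (F z))\<close> are taken over the remaining circles, where the integrand is
  continuous.\<close>

lemma countable_bad_radii:
  assumes "entire_nz F"
  shows "countable {r. \<exists>z\<in>sphere b r. F z = 0}"
proof -
  have "{r. \<exists>z\<in>sphere b r. F z = 0} \<subseteq> dist b ` {z. F z = 0}" by auto
  then show ?thesis using countable_zeros[OF assms] countable_image countable_subset by blast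
qed

lemma entire_nz_zorder_pos:
  assumes "entire_nz F" "F a = 0"
  shows "zorder F a > 0"
  using zorder_exist_zero[of F UNIV a] assms by (auto simp: entire_nz_def)

text \<open>Near \<open>a\<close> the quotient is the local factor \<open>zor_poly F a\<close>,
  elsewhere \<open>F z / (z - a) ^ n\<close>; the two agree on the overlap of the open cover and
  glue to an entire function.\<close>

lemma entire_factor1:
  assumes F: "entire_nz F"
  shows "\<exists>G. entire_nz G \<and> G a \<noteq> 0 \<and> (\<forall>z. F z = (z - a) ^ zmult F a * G z)"
proof (cases "F a = 0")
  case False
  then show ?thesis using F by (auto simp: zmult_def intro!: exI[of _ F])
next
  case True
  define n where "n = zmult F a"
  define g where "g = zor_poly F a"
  have "\<exists>r>0. g holomorphic_on cball a r \<and> (\<forall>w\<in>cball a r. F w = g w * (w - a) ^ n \<and> g w \<noteq> 0)"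
    using zorder_exist_zero[of F UNIV a] F by (auto simp: entire_nz_def n_def g_def True zmult_def)
  then obtain r where r: "r > 0" "g holomorphic_on cball a r"
    "\<And>w. w \<in> cball a r \<Longrightarrow> F w = g w * (w - a) ^ n \<and> g w \<noteq> 0" by blast
  define G where "G z = (if z = a then g a else F z / (z - a) ^ n)" for z
  have Gg: "G z = g z" if "z \<in> cball a r" for z
    using r(3)[OF that] by (auto simp: G_def)
  have "G holomorphic_on (ball a r \<union> (UNIV - {a}))"
  proof (rule holomorphic_on_Un)
    show "G holomorphic_on ball a r"
      by (rule holomorphic_transform[OF holomorphic_on_subset[OF r(2)]]) (auto simp: Gg)
    have "(\<lambda>z. F z / (z - a) ^ n) holomorphic_on (UNIV - {a})"
      using F by (auto intro!: holomorphic_intros holomorphic_on_subset[of F UNIV] simp: entire_nz_def)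
    then show "G holomorphic_on (UNIV - {a})"
      by (rule holomorphic_transform) (auto simp: G_def)
  qed auto
  moreover have "ball a r \<union> (UNIV - {a}) = UNIV" using r(1) by auto
  moreover have ga: "G a \<noteq> 0" using r(1) r(3)[of a] Gg[of a] by simp
  moreover have "F z = (z - a) ^ n * G z" for z
    using r(3)[of a] r(1) by (cases "z = a") (auto simp: G_def)
  ultimately show ?thesis unfolding entire_nz_def n_def by metis
qed

lemma entire_nz_frequently:
  assumes "entire_nz K"
  shows "\<forall>\<^sub>F z in at a. K z \<noteq> 0"
proof -
  have "finite (zeros_in K (norm a + 1))" by (rule finite_zeros_in[OF assms])
  then have "\<not> a islimpt zeros_in K (norm a + 1)" by (simp add: islimpt_finite)
  then have "\<forall>\<^sub>F z in at a. z \<notin> zeros_in K (norm a + 1)" by (simp add: islimpt_iff_eventually)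
  moreover have "\<forall>\<^sub>F z in at a. z \<in> ball a 1" using eventually_at_ball[of 1 a UNIV] by simp
  ultimately show ?thesis
  proof eventually_elim
    case (elim z)
    have "norm z \<le> norm a + 1" using elim(2) norm_triangle_ineq2[of z a] by (simp add: dist_norm norm_minus_commute)
    then show ?case using elim by (auto simp: zeros_in_def)
  qed
qed

text \<open>Orders add and \<open>p\<close> has order 0 at \<open>a\<close>. This keeps
  multiplicities intact while zeros are split off one at a time.\<close>

lemma zmult_times_nonzero:
  assumes "entire_nz F" "entire_nz G" "\<And>z. F z = p z * G z" "p a \<noteq> 0" "p holomorphic_on UNIV"
  shows "zmult F a = zmult G a"
proof (cases "G a = 0")
  case False
  then show ?thesis using assms by (simp add: zmult_def)
next
  case True
  have F: "F = (\<lambda>z. p z * G z)" using assms(3) by auto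
  have an: "p analytic_on {a}" "G analytic_on {a}"
    using assms by (auto simp: entire_nz_def analytic_on_holomorphic)
  have fin: "\<exists>\<^sub>F z in at a. K z \<noteq> 0" if "entire_nz K" for K
    using entire_nz_frequently[OF that] by (simp add: eventually_frequently)
  have "zorder F a = zorder p a + zorder G a"
    unfolding F
  proof (rule zorder_mult)
    show "\<exists>\<^sub>F z in at a. p z \<noteq> 0" using assms by (intro fin) (auto simp: entire_nz_def)
  qed (use an fin assms in \<open>auto intro: analytic_on_imp_meromorphic_on\<close>)
  also have "zorder p a = 0"
    using zorder_exist_zero[of p UNIV a] assms by auto
  finally show ?thesis using True assms(3)[of a] by (simp add: zmult_def)
qed

lemma entire_factor:
  assumes F: "entire_nz F" and "finite A"
  shows "\<exists>G. entire_nz G \<and> (\<forall>a\<in>A. G a \<noteq> 0) \<and> (\<forall>z. F z = (\<Prod>a\<in>A. (z - a) ^ zmult F a) * G z)"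
  using assms(2)
proof (induction A rule: finite_induct)
  case empty
  then show ?case using F by (auto intro!: exI[of _ F])
next
  case (insert b A)
  then obtain G where G: "entire_nz G" "\<And>a. a\<in>A \<Longrightarrow> G a \<noteq> 0"
    "\<And>z. F z = (\<Prod>a\<in>A. (z - a) ^ zmult F a) * G z" by blast
  have eq: "zmult F b = zmult G b"
    by (rule zmult_times_nonzero[OF F G(1) G(3)])
      (use insert in \<open>auto intro!: holomorphic_intros\<close>)
  obtain G' where G': "entire_nz G'" "G' b \<noteq> 0" "\<And>z. G z = (z - b) ^ zmult G b * G' z"
    using entire_factor1[OF G(1)] by blast
  have "G' a \<noteq> 0" if "a \<in> A" for a using G'(3)[of a] G(2)[OF that] by auto
  moreover have "F z = (\<Prod>a\<in>insert b A. (z - a) ^ zmult F a) * G' z" for z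
    unfolding G(3)[of z] using G'(3)[of z] eq insert by (simp add: algebra_simps)
  ultimately show ?case using G'(1,2) by blast
qed

section \<open>Singular integrals over circles\<close>

text \<open>The mean value theorem gives slope at least \<open>cos (pi/4)\<close> on
  \<open>[0, pi/4]\<close>. Doubling the angle brings in another \<open>2 * cos (pi/4)\<close>, and
  \<open>2 * cos (pi/4) ^ 2 = 1\<close>.\<close>

lemma sin_ge_half:
  assumes "0 \<le> x" "x \<le> pi/2"
  shows "x / 2 \<le> sin x"
proof -
  have *: "y * cos (pi/4) \<le> sin y" if y: "0 < y" "y \<le> pi/4" for y
  proof -
    obtain \<xi> where \<xi>: "0 < \<xi>" "\<xi> < y" "sin y - sin 0 = (y - 0) * cos \<xi>"
      using MVT2[of 0 y sin cos, OF y(1) DERIV_sin] by blast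
    have "cos (pi/4) \<le> cos \<xi>" using \<xi> y by (intro cos_monotone_0_pi_le) auto
    then show ?thesis using \<xi> y by (simp add: mult_left_mono)
  qed
  show ?thesis
  proof (cases "x = 0")
    case False
    have c: "cos (pi/4) \<le> cos (x/2)" using assms by (intro cos_monotone_0_pi_le) auto
    have c0: "cos (pi/4) * cos (pi/4) = 1/2" "cos (pi/4) > 0"
      by (simp_all add: cos_45 field_simps)
    have "x / 2 = 2 * ((x/2 * cos (pi/4)) * cos (pi/4))" using c0 by (simp add: mult.assoc)
    also have "\<dots> \<le> 2 * (sin (x/2) * cos (x/2))"
      using assms False *[of "x/2"] c c0 sin_ge_zero[of "x/2"]
      by (intro mult_left_mono mult_mono) auto
    also have "\<dots> = sin x" using sin_double[of "x/2"] by simp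
    finally show ?thesis .
  qed simp
qed

lemma abs_powr_integral:
  fixes d \<tau> :: real
  assumes "0 < d" "d < 1" "\<bar>\<tau>\<bar> \<le> M" "2*pi + \<bar>\<tau>\<bar> \<le> M"
  shows "(\<lambda>t. \<bar>t - \<tau>\<bar> powr (-d)) integrable_on {0..2*pi}"
    and "integral {0..2*pi} (\<lambda>t. \<bar>t - \<tau>\<bar> powr (-d)) \<le> 2 * M powr (1-d) / (1-d)"
proof -
  have M: "M \<ge> 0" using assms by auto
  have 1: "((\<lambda>x. \<bar>x\<bar> powr (-d)) has_integral (M powr (1-d) / (1-d))) {0..M}"
    using has_integral_powr_from_0[of "-d" M] assms M
    by (subst has_integral_cong[where g = "\<lambda>x. x powr (-d)"]) auto
  have 2: "((\<lambda>x. \<bar>x\<bar> powr (-d)) has_integral (M powr (1-d) / (1-d))) {-M..0}"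
    using has_integral_reflect_real[of "\<lambda>x. \<bar>x\<bar> powr (-d)" _ M 0] 1 by simp
  have 3: "((\<lambda>x. \<bar>x\<bar> powr (-d)) has_integral (2 * M powr (1-d) / (1-d))) {-M..M}"
    using has_integral_combine[OF _ _ 2 1] M by simp
  have 4: "(\<lambda>x. \<bar>x\<bar> powr (-d)) integrable_on {-\<tau>..2*pi-\<tau>}"
    using 3 assms by (intro integrable_on_subinterval[OF has_integral_integrable[OF 3]]) auto
  have "integral {-\<tau>..2*pi-\<tau>} (\<lambda>x. \<bar>x\<bar> powr (-d)) \<le> integral {-M..M} (\<lambda>x. \<bar>x\<bar> powr (-d))"
    using 3 assms by (intro integral_subset_le 4) (auto simp: integrable_on_def)
  then have 5: "integral {-\<tau>..2*pi-\<tau>} (\<lambda>x. \<bar>x\<bar> powr (-d)) \<le> 2 * M powr (1-d) / (1-d)"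
    using 3 by (simp add: integral_unique)
  from has_integral_shift_real_ivl[OF integrable_integral[OF 4], of "-\<tau>"]
  have 6: "((\<lambda>t. \<bar>t - \<tau>\<bar> powr (-d)) has_integral integral {-\<tau>..2*pi-\<tau>} (\<lambda>x. \<bar>x\<bar> powr (-d))) {0..2*pi}"
    by simp
  then show "(\<lambda>t. \<bar>t - \<tau>\<bar> powr (-d)) integrable_on {0..2*pi}" by blast
  show "integral {0..2*pi} (\<lambda>t. \<bar>t - \<tau>\<bar> powr (-d)) \<le> 2 * M powr (1-d) / (1-d)"
    using 5 6 by (simp add: integral_unique)
qed

lemma abs_sin_ge:
  assumes "-pi \<le> x" "x \<le> 3*pi"
  shows "\<exists>k\<in>{-1..3::int}. \<bar>x - of_int k * pi\<bar> / 2 \<le> \<bar>sin x\<bar>"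
proof -
  \<comment> \<open>The multiple of \<open>pi\<close> nearest to \<open>x\<close>; sine is compared
    with the distance to it. The range of \<open>x\<close> leaves the indices -1 to 3.\<close>
  define k where "k = \<lfloor>x / pi + 1/2\<rfloor>"
  have k: "of_int k \<le> x / pi + 1/2" "x / pi + 1/2 < of_int k + 1"
    unfolding k_def by linarith+
  have "-1 \<le> x / pi" "x / pi \<le> 3" using assms by (auto simp: field_simps)
  then have kr: "k \<in> {-1..3}" using k by simp
  define y where "y = x - of_int k * pi"
  have y: "\<bar>y\<bar> \<le> pi/2"
  proof -
    have "x = x / pi * pi" by simp
    moreover have "x / pi * pi \<le> (of_int k + 1/2) * pi" "(of_int k - 1/2) * pi \<le> x / pi * pi"
      using k by (intro mult_right_mono; simp)+
    ultimately have "y \<le> pi/2" "-y \<le> pi/2" by (simp_all add: y_def algebra_simps)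
    then show ?thesis by linarith
  qed
  have "\<bar>sin x\<bar> = \<bar>sin y\<bar>"
  proof -
    have "sin (of_int k * pi) = 0" by (metis mult.commute sin_integer_2pi sin_zero_iff_int2)
    moreover have "x = y + of_int k * pi" by (simp add: y_def)
    ultimately have "sin x = sin y * cos (of_int k * pi)" by (simp add: sin_add)
    moreover have "\<bar>cos (of_int k * pi)\<bar> = 1"
      using sin_cos_squared_add[of "of_int k * pi"] \<open>sin (of_int k * pi) = 0\<close>
      by (metis abs_1 abs_square_eq_1 add_0 power_zero_numeral)
    ultimately show ?thesis by (simp add: abs_mult)
  qed
  also have "\<bar>sin y\<bar> = sin \<bar>y\<bar>" using y sin_ge_zero[of "\<bar>y\<bar>"] by (auto simp: abs_if split: if_splits)
  finally show ?thesis using sin_ge_half[of "\<bar>y\<bar>"] y kr by (intro bexI[of _ k]) (auto simp: y_def)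
qed

text \<open>The factor 5 counts the multiples \<open>k * pi\<close> with \<open>k\<close> from -1 to
  3, \<open>2 powr d\<close> comes from \<open>sin y \<ge> y / 2\<close>, the last factor is
  \<open>abs_powr_integral\<close> with \<open>M = 6 * pi\<close>, and the outer 2 is the one in
  \<open>p0\<close> below.\<close>

definition circle_const :: "real \<Rightarrow> real" where
  "circle_const d = 5 * (2 * (2 powr d * (2 * (6*pi) powr (1-d) / (1-d))))"

text \<open>After rotating \<open>w\<close> to the nonnegative real axis, the imaginary part gives
  \<open>norm (r * cis t - w) \<ge> r * \<bar>sin (t - Arg w)\<bar>\<close>, so the bound does not
  depend on \<open>norm w\<close>. A majorant \<open>p\<close> is supplied instead of an estimate of
  the integral because \<open>w\<close> may lie on the circle.\<close>

lemma circle_singularity: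
  assumes d: "0 < d" "d < 1" and r: "r > 0"
  shows "\<exists>p. p integrable_on {0..2*pi} \<and> integral {0..2*pi} p \<le> circle_const d \<and>
     (\<forall>t\<in>{0..2*pi}. 0 \<le> p t \<and>
       (of_real r * cis t \<noteq> w \<longrightarrow> norm (of_real r * cis t - w) powr (-d) \<le> r powr (-d) * p t))"
proof -
  define \<alpha> where "\<alpha> = Arg w"
  define q where "q k t = \<bar>t - (\<alpha> + of_int k * pi)\<bar> powr (-d)" for k :: int and t
  define Z where "Z = (\<lambda>k. \<alpha> + of_int k * pi) ` {-1..3::int}"
  define p0 where "p0 t = 2 * (\<Sum>k\<in>{-1..3}. 2 powr d * q k t)" for t
  \<comment> \<open>On \<open>Z\<close> one summand of \<open>p0\<close> is \<open>0 powr (-d) = 0\<close> instead of infinite.\<close>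
  define p where "p t = (if t \<in> Z then r powr d * norm (of_real r * cis t - w) powr (-d) else p0 t)" for t
  have \<alpha>: "-pi < \<alpha>" "\<alpha> \<le> pi" unfolding \<alpha>_def by (simp_all add: mpi_less_Arg Arg_le_pi)
  have \<alpha>k: "\<bar>\<alpha> + of_int k * pi\<bar> \<le> 4*pi" if "k \<in> {-1..3}" for k
  proof -
    have "\<bar>real_of_int k\<bar> \<le> 3" using that by auto
    then have "\<bar>real_of_int k * pi\<bar> \<le> 3 * pi" by (simp add: abs_mult)
    moreover have "\<bar>\<alpha>\<bar> \<le> pi" using \<alpha> by auto
    ultimately show ?thesis by linarith
  qed
  have int: "q k integrable_on {0..2*pi}" "integral {0..2*pi} (q k) \<le> 2 * (6*pi) powr (1-d) / (1-d)"
    if "k \<in> {-1..3}" for k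
    unfolding q_def using abs_powr_integral[of d "\<alpha> + of_int k * pi" "6*pi"] \<alpha>k[OF that] d pi_gt_zero by linarith+
  have "integral {0..2*pi} p0 = 2 * (\<Sum>k\<in>{-1..3}. 2 powr d * integral {0..2*pi} (q k))"
    unfolding p0_def integral_mult_right
    by (subst integral_sum) (use int in \<open>auto intro!: integrable_on_cmult_left\<close>)
  also have "\<dots> \<le> 2 * (\<Sum>k\<in>{-1..3::int}. 2 powr d * (2 * (6*pi) powr (1-d) / (1-d)))"
    by (intro mult_left_mono sum_mono int) auto
  also have "\<dots> = circle_const d" by (simp add: circle_const_def)
  finally have "integral {0..2*pi} p0 \<le> circle_const d" .
  moreover have "p0 integrable_on {0..2*pi}"
    unfolding p0_def
    using integrable_on_cmult_left[OF integrable_sum, of "{-1..3}" "\<lambda>k t. 2 powr d * q k t" _ 2]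
      integrable_on_cmult_left[OF int(1), of _ "2 powr d"] by simp
  ultimately have "(p0 has_integral integral {0..2*pi} p0) {0..2*pi}" "integral {0..2*pi} p0 \<le> circle_const d"
    by auto
  then have "(p has_integral integral {0..2*pi} p0) {0..2*pi}"
    by (intro has_integral_spike_finite[of Z _ p p0]) (auto simp: Z_def p_def)
  then have I: "integral {0..2*pi} p \<le> circle_const d" and J: "p integrable_on {0..2*pi}"
    using \<open>integral {0..2*pi} p0 \<le> circle_const d\<close> by (auto simp: integral_unique)
  have nonneg: "0 \<le> p t" for t unfolding p_def p0_def q_def by (auto intro!: sum_nonneg)
  have bound: "norm (of_real r * cis t - w) powr (-d) \<le> r powr (-d) * p t"
    if t: "t \<in> {0..2*pi}" and ne: "of_real r * cis t \<noteq> w" for t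
  proof -
    have w: "w = of_real (norm w) * cis \<alpha>"
      unfolding \<alpha>_def by (metis rcis_cmod_Arg rcis_def)
    have e: "of_real r * cis t - w = cis \<alpha> * (of_real r * cis (t - \<alpha>) - of_real (norm w))"
      by (subst w) (simp add: algebra_simps cis_mult)
    have "norm (of_real r * cis t - w) = norm (of_real r * cis (t - \<alpha>) - of_real (norm w))"
      unfolding e by (simp add: norm_mult)
    also have "\<dots> \<ge> \<bar>Im (of_real r * cis (t - \<alpha>) - of_real (norm w))\<bar>" by (rule abs_Im_le_cmod)
    finally have ge: "norm (of_real r * cis t - w) \<ge> r * \<bar>sin (t - \<alpha>)\<bar>"
      using r by (simp add: abs_mult)
    obtain k where k: "k \<in> {-1..3::int}" "\<bar>(t - \<alpha>) - of_int k * pi\<bar> / 2 \<le> \<bar>sin (t - \<alpha>)\<bar>"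
      using abs_sin_ge[of "t - \<alpha>"] t \<alpha> by auto
    define y where "y = \<bar>t - (\<alpha> + of_int k * pi)\<bar>"
    have y: "r * (y / 2) \<le> norm (of_real r * cis t - w)"
      using k(2) r ge by (simp add: y_def algebra_simps)
        (smt (verit, ccfv_SIG) mult_left_mono distrib_left)
    have qy: "q k t = y powr (-d)" by (simp add: q_def y_def)
    have le1: "2 powr d * q k t \<le> (\<Sum>k\<in>{-1..3}. 2 powr d * q k t)"
      using k by (intro member_le_sum) (auto simp: q_def)
    show ?thesis
    proof (cases "t \<in> Z")
      case False
      then have y0: "y > 0" using k by (auto simp: y_def Z_def)
      have "norm (of_real r * cis t - w) powr (-d) \<le> (r * (y / 2)) powr (-d)"
        using y y0 r d by (intro powr_mono2') auto
      also have "\<dots> = r powr (-d) * (2 powr d * q k t)"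
        using y0 r by (simp add: powr_mult powr_divide qy powr_minus divide_simps)
      also have "\<dots> \<le> r powr (-d) * (\<Sum>k\<in>{-1..3}. 2 powr d * q k t)"
        by (intro mult_left_mono le1) auto
      also have "\<dots> \<le> r powr (-d) * p t"
      proof -
        have "0 \<le> (\<Sum>k\<in>{-1..3}. 2 powr d * q k t)" by (intro sum_nonneg) (simp add: q_def)
        then show ?thesis using False unfolding p_def p0_def by (intro mult_left_mono) auto
      qed
      finally show ?thesis .
    next
      case True
      then show ?thesis using r by (simp add: p_def powr_minus field_simps)
    qed
  qed
  show ?thesis using I J nonneg bound by blast
qed


section \<open>The formulas of Jensen and Poisson--Jensen\<close>

text \<open>On the circle,
  \<open>s\<^sup>2 - cnj a * \<zeta> = \<zeta> * cnj (\<zeta> - a)\<close>.\<close>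

lemma norm_reflect:
  assumes "norm \<zeta> = s" "s > 0"
  shows "norm (\<zeta> - a) = norm ((of_real s)\<^sup>2 - cnj a * \<zeta>) / s"
proof -
  have "(of_real s)\<^sup>2 - cnj a * \<zeta> = \<zeta> * cnj (\<zeta> - a)"
    using assms(1) by (simp add: complex_norm_square[of \<zeta>, symmetric, simplified] algebra_simps flip: complex_norm_square)
  then have "norm ((of_real s)\<^sup>2 - cnj a * \<zeta>) = s * norm (cnj (\<zeta> - a))"
    using assms by (simp only: norm_mult)
  then show ?thesis using assms unfolding complex_mod_cnj by simp
qed

lemma reflect_nonzero:
  assumes "norm a < s" "norm z < S" "S \<le> (if a = 0 then S else s\<^sup>2 / norm a)"
  shows "(of_real s)\<^sup>2 - cnj a * z \<noteq> 0"
proof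
  assume "(of_real s)\<^sup>2 - cnj a * z = 0"
  then have "cnj a * z = of_real (s\<^sup>2)" by simp
  then have "norm (cnj a * z) = s\<^sup>2" by (metis abs_of_nonneg norm_of_real zero_le_power2)
  then have *: "norm a * norm z = s\<^sup>2" by (simp add: norm_mult)
  show False
  proof (cases "a = 0")
    case True
    then show False using * assms by auto
  next
    case False
    then have "norm z < s\<^sup>2 / norm a" using assms by auto
    then show False using * False by (simp add: field_simps)
  qed
qed

text \<open>On the circle \<open>\<zeta> - a\<close> may be replaced by
  \<open>(s\<^sup>2 - cnj a * \<zeta>) / s\<close>, which has the same modulus there and no zero in
  the disc; the Poisson formula then applies.\<close>

lemma Poisson_ln_inside:
  assumes "norm a < s" "norm z < s"
  shows "cmean 0 s (\<lambda>\<zeta>. poisson z \<zeta> * ln (norm (\<zeta> - a))) = ln (norm ((of_real s)\<^sup>2 - cnj a * z) / s)"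
proof -
  have s0: "s > 0" using assms by (meson norm_ge_zero order_le_less_trans)
  define S where "S = (if a = 0 then s + 1 else s\<^sup>2 / norm a)"
  have S: "s < S" using assms s0 by (auto simp: S_def field_simps power2_eq_square)
  define H where "H = (\<lambda>\<zeta>. ((of_real s)\<^sup>2 - cnj a * \<zeta>) / of_real s)"
  have "ln (norm (H z)) = cmean 0 s (\<lambda>\<zeta>. poisson z \<zeta> * ln (norm (H \<zeta>)))"
  proof (rule Poisson_formula_ln)
    show "H holomorphic_on ball 0 S" unfolding H_def using s0 by (intro holomorphic_intros) auto
    show "H w \<noteq> 0" if "norm w < S" for w
      using reflect_nonzero[OF assms(1) that] s0 by (auto simp: H_def S_def split: if_splits)
  qed (use assms S in auto)
  also have "\<dots> = cmean 0 s (\<lambda>\<zeta>. poisson z \<zeta> * ln (norm (\<zeta> - a)))"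
    using s0 by (intro cmean_cong) (auto simp: H_def norm_divide norm_reflect[of _ s a])
  finally show ?thesis using s0 by (simp add: H_def norm_divide)
qed

lemma Poisson_ln_outside:
  assumes "norm a > s" "norm z < s"
  shows "cmean 0 s (\<lambda>\<zeta>. poisson z \<zeta> * ln (norm (\<zeta> - a))) = ln (norm (z - a))"
  by (rule Poisson_formula_ln[symmetric, where S = "norm a"])
     (use assms in \<open>auto intro!: holomorphic_intros\<close>)

text \<open>Jensen's formula for a single zero: at the centre the kernel is 1, and the zero lies
  either inside or outside the circle.\<close>

lemma mean_ln_dist:
  assumes r: "r > 0" and "norm (a - b) \<noteq> r"
  shows "cmean b r (\<lambda>z. ln (norm (z - a))) = ln (max r (norm (a - b)))"
proof -
  have "cmean b r (\<lambda>z. ln (norm (z - a))) = cmean 0 r (\<lambda>z. poisson 0 z * ln (norm (z - (a - b))))"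
    using r by (subst cmean_shift, intro cmean_cong) (auto simp: algebra_simps)
  also have "\<dots> = ln (max r (norm (a - b)))"
  proof (cases "norm (a - b) < r")
    case True
    then show ?thesis using r
      by (subst Poisson_ln_inside) (auto simp: norm_power power2_eq_square norm_mult)
  next
    case False
    then show ?thesis using assms
      by (subst Poisson_ln_outside) (auto simp: norm_minus_commute)
  qed
  finally show ?thesis .
qed

lemma continuous_ln_norm:
  assumes "F holomorphic_on UNIV" "\<And>z. z \<in> A \<Longrightarrow> F z \<noteq> 0"
  shows "continuous_on A (\<lambda>z. ln (norm (F z)))"
  using assms by (intro continuous_intros holomorphic_on_imp_continuous_on)
    (auto intro: holomorphic_on_subset)

lemma ln_norm_factor:
  fixes F G :: "complex \<Rightarrow> complex"
  assumes "F z = (\<Prod>a\<in>A. (z - a) ^ m a) * G z" "F z \<noteq> 0" "finite A"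
  shows "ln (norm (F z)) = (\<Sum>a\<in>A. real (m a) * ln (norm (z - a))) + ln (norm (G z))"
proof -
  have "(\<Prod>a\<in>A. (z - a) ^ m a) * G z \<noteq> 0" using assms(1,2) by metis
  then have nz: "(\<Prod>a\<in>A. (z - a) ^ m a) \<noteq> 0" "G z \<noteq> 0"
    by (metis mult_zero_left, metis mult_zero_right)
  have "ln (norm (F z)) = ln (norm (\<Prod>a\<in>A. (z - a) ^ m a)) + ln (norm (G z))"
    unfolding assms(1) norm_mult using nz by (intro ln_mult_pos) auto
  also have "norm (\<Prod>a\<in>A. (z - a) ^ m a) = (\<Prod>a\<in>A. norm (z - a) ^ m a)"
    by (simp add: prod_norm[symmetric] norm_power)
  also have "ln \<dots> = (\<Sum>a\<in>A. ln (norm (z - a) ^ m a))"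
    using nz assms(3) by (intro ln_prod) (auto simp: prod_zero_iff)
  also have "\<dots> = (\<Sum>a\<in>A. real (m a) * ln (norm (z - a)))"
  proof (rule sum.cong[OF refl])
    fix a assume "a \<in> A"
    then have "(z - a) ^ m a \<noteq> 0" using nz assms(3) by (auto simp: prod_zero_iff)
    then show "ln (norm (z - a) ^ m a) = real (m a) * ln (norm (z - a))"
      by (cases "m a = 0") (auto simp: ln_realpow)
  qed
  finally show ?thesis .
qed

lemma entire_factor_zeros:
  assumes F: "entire_nz F"
  obtains G where "entire_nz G" "\<And>z. norm z \<le> S \<Longrightarrow> G z \<noteq> 0"
    "\<And>z. F z = (\<Prod>a\<in>zeros_in F S. (z - a) ^ zmult F a) * G z"
proof -
  obtain G where G: "entire_nz G" "\<And>a. a \<in> zeros_in F S \<Longrightarrow> G a \<noteq> 0"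
    "\<And>z. F z = (\<Prod>a\<in>zeros_in F S. (z - a) ^ zmult F a) * G z"
    using entire_factor[OF F finite_zeros_in[OF F]] by blast
  have "G z \<noteq> 0" if "norm z \<le> S" for z
    using G(2)[of z] G(3)[of z] that by (cases "z \<in> zeros_in F S") (auto simp: zeros_in_def)
  then show ?thesis using that G by blast
qed

text \<open>Green's function of the disc of radius \<open>s\<close> with pole
  \<open>a\<close>.\<close>

definition green :: "real \<Rightarrow> complex \<Rightarrow> complex \<Rightarrow> real" where
  "green s a z = ln (norm ((of_real s)\<^sup>2 - cnj a * z) / s) - ln (norm (z - a))"

text \<open>\<open>norm (s\<^sup>2 - cnj a * z) ^ 2 - (s * norm (z - a)) ^ 2\<close> factors as
  \<open>(s\<^sup>2 - norm a ^ 2) * (s\<^sup>2 - norm z ^ 2)\<close>.\<close>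

lemma green_nonneg:
  assumes "norm a < s" "norm z < s" "z \<noteq> a"
  shows "green s a z \<ge> 0"
proof -
  have s0: "s > 0" using assms by (meson norm_ge_zero order_le_less_trans)
  have "(norm ((of_real s)\<^sup>2 - cnj a * z))\<^sup>2 - (s * norm (z - a))\<^sup>2 = (s\<^sup>2 - (norm a)\<^sup>2) * (s\<^sup>2 - (norm z)\<^sup>2)"
    unfolding power_mult_distrib cmod_power2
    by (simp add: power2_eq_square algebra_simps)
  moreover have "(norm a)\<^sup>2 \<le> s\<^sup>2" "(norm z)\<^sup>2 \<le> s\<^sup>2" using assms by (auto intro!: power_mono)
  ultimately have "(s * norm (z - a))\<^sup>2 \<le> (norm ((of_real s)\<^sup>2 - cnj a * z))\<^sup>2"
    by (smt (verit) mult_nonneg_nonneg)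
  then have "s * norm (z - a) \<le> norm ((of_real s)\<^sup>2 - cnj a * z)"
    by (rule power2_le_imp_le) simp
  then have "norm (z - a) \<le> norm ((of_real s)\<^sup>2 - cnj a * z) / s" using s0 by (simp add: field_simps)
  moreover have "0 < norm (z - a)" using assms by simp
  ultimately have "ln (norm (z - a)) \<le> ln (norm ((of_real s)\<^sup>2 - cnj a * z) / s)"
    using ln_mono by (metis order_less_le_trans)
  then show ?thesis unfolding green_def by simp
qed

text \<open>Split off the zeros: the zero-free factor and the linear factors with zeros outside the
  circle are reproduced by the Poisson integral, while a zero inside leaves its Green
  function.\<close>

lemma Poisson_Jensen:
  assumes F: "entire_nz F" and good: "\<And>\<zeta>. norm \<zeta> = s \<Longrightarrow> F \<zeta> \<noteq> 0"
    and z: "norm z < s" "F z \<noteq> 0"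
  shows "ln (norm (F z)) = cmean 0 s (\<lambda>\<zeta>. poisson z \<zeta> * ln (norm (F \<zeta>)))
           - (\<Sum>a\<in>zeros_in F s. real (zmult F a) * green s a z)"
proof -
  have s0: "s > 0" using z by (meson norm_ge_zero order_le_less_trans)
  \<comment> \<open>Zeros are split off in a slightly larger disc, since
    \<open>Poisson_formula_ln\<close> asks for a zero-free function beyond the circle.\<close>
  let ?A = "zeros_in F (s + 1)" and ?m = "zmult F"
  have fin: "finite ?A" using finite_zeros_in[OF F] .
  have sub: "zeros_in F s \<subseteq> ?A" by (auto simp: zeros_in_def)
  obtain G where G: "entire_nz G" "\<And>z. norm z \<le> s + 1 \<Longrightarrow> G z \<noteq> 0"
    "\<And>z. F z = (\<Prod>a\<in>?A. (z - a) ^ ?m a) * G z"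
    using entire_factor_zeros[OF F] by blast
  have A: "norm a \<noteq> s" if "a \<in> ?A" for a using good that by (auto simp: zeros_in_def)
  have c1: "continuous_on (sphere 0 s) (\<lambda>\<zeta>. poisson z \<zeta> * ln (norm (\<zeta> - a)))" if "a \<in> ?A" for a
    using A[OF that] by (intro continuous_intros poisson_continuous z) auto
  have c2: "continuous_on (sphere 0 s) (\<lambda>\<zeta>. poisson z \<zeta> * ln (norm (G \<zeta>)))"
    using G by (intro continuous_on_mult poisson_continuous z continuous_ln_norm) (auto simp: entire_nz_def)
  have "cmean 0 s (\<lambda>\<zeta>. poisson z \<zeta> * ln (norm (F \<zeta>)))
      = cmean 0 s (\<lambda>\<zeta>. (\<Sum>a\<in>?A. real (?m a) * (poisson z \<zeta> * ln (norm (\<zeta> - a)))) + poisson z \<zeta> * ln (norm (G \<zeta>)))"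
  proof (rule cmean_cong)
    fix \<zeta> assume "\<zeta> \<in> sphere (0::complex) s"
    then have "F \<zeta> \<noteq> 0" using good by auto
    from ln_norm_factor[where F = F and G = G and m = ?m, OF G(3) this fin]
    show "poisson z \<zeta> * ln (norm (F \<zeta>)) =
        (\<Sum>a\<in>?A. real (?m a) * (poisson z \<zeta> * ln (norm (\<zeta> - a)))) + poisson z \<zeta> * ln (norm (G \<zeta>))"
      by (simp add: distrib_left sum_distrib_left algebra_simps)
  qed (use s0 in simp)
  also have "\<dots> = (\<Sum>a\<in>?A. real (?m a) * cmean 0 s (\<lambda>\<zeta>. poisson z \<zeta> * ln (norm (\<zeta> - a)))) + cmean 0 s (\<lambda>\<zeta>. poisson z \<zeta> * ln (norm (G \<zeta>)))"
  proof -
    have c3: "continuous_on (sphere 0 s) (\<lambda>\<zeta>. real (?m a) * (poisson z \<zeta> * ln (norm (\<zeta> - a))))" if "a \<in> ?A" for a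
      by (intro continuous_on_mult continuous_on_const c1 that)
    show ?thesis using s0
      by (subst cmean_add[OF continuous_on_sum c2]) (auto intro: c3 simp: cmean_sum[OF fin c3] cmean_cmult)
  qed
  also have "cmean 0 s (\<lambda>\<zeta>. poisson z \<zeta> * ln (norm (G \<zeta>))) = ln (norm (G z))"
    using G z by (intro Poisson_formula_ln[symmetric, where S = "s + 1"])
       (auto simp: entire_nz_def intro: holomorphic_on_subset)
  also have "(\<Sum>a\<in>?A. real (?m a) * cmean 0 s (\<lambda>\<zeta>. poisson z \<zeta> * ln (norm (\<zeta> - a))))
      = (\<Sum>a\<in>?A. real (?m a) * ln (norm (z - a)) + (if norm a < s then real (?m a) * green s a z else 0))"
  proof (rule sum.cong[OF refl])
    fix a assume "a \<in> ?A"
    then show "real (?m a) * cmean 0 s (\<lambda>\<zeta>. poisson z \<zeta> * ln (norm (\<zeta> - a)))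
      = real (?m a) * ln (norm (z - a)) + (if norm a < s then real (?m a) * green s a z else 0)"
      using A[of a] Poisson_ln_inside[of a s z] Poisson_ln_outside[of s a z] z
      by (cases "norm a < s") (auto simp: green_def algebra_simps)
  qed
  also have "\<dots> = (\<Sum>a\<in>?A. real (?m a) * ln (norm (z - a))) + (\<Sum>a\<in>?A. if norm a < s then real (?m a) * green s a z else 0)"
    by (simp add: sum.distrib)
  also have "(\<Sum>a\<in>?A. if norm a < s then real (?m a) * green s a z else 0) = (\<Sum>a\<in>zeros_in F s. real (?m a) * green s a z)"
    using fin sub good by (intro sum.mono_neutral_cong_right) (force simp: zeros_in_def)+
  finally show ?thesis using ln_norm_factor[where F = F and G = G and m = ?m, OF G(3) z(2) fin] by linarith
qed

text \<open>Green's function is nonnegative, so dropping the zeros gives the subharmonic inequality;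
  \<open>U\<close> then replaces the boundary values by a majorant.\<close>

lemma Poisson_ineq:
  assumes F: "entire_nz F" and good: "\<And>\<zeta>. norm \<zeta> = s \<Longrightarrow> F \<zeta> \<noteq> 0"
    and z: "norm z < s" "F z \<noteq> 0"
    and U: "continuous_on (sphere 0 s) U" "\<And>\<zeta>. norm \<zeta> = s \<Longrightarrow> ln (norm (F \<zeta>)) \<le> U \<zeta>"
  shows "ln (norm (F z)) \<le> cmean 0 s (\<lambda>\<zeta>. poisson z \<zeta> * U \<zeta>)"
proof -
  have s0: "s > 0" using z by (meson norm_ge_zero order_le_less_trans)
  have "0 \<le> (\<Sum>a\<in>zeros_in F s. real (zmult F a) * green s a z)"
  proof (intro sum_nonneg mult_nonneg_nonneg green_nonneg)
    fix a assume a: "a \<in> zeros_in F s"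
    then show "norm a < s" using good by (force simp: zeros_in_def)
    show "z \<noteq> a" using a z by (auto simp: zeros_in_def)
  qed (use z in auto)
  then have "ln (norm (F z)) \<le> cmean 0 s (\<lambda>\<zeta>. poisson z \<zeta> * ln (norm (F \<zeta>)))"
    using Poisson_Jensen[OF F good z] by simp
  also have "\<dots> \<le> cmean 0 s (\<lambda>\<zeta>. poisson z \<zeta> * U \<zeta>)"
    using s0 z F good U
    by (intro cmean_mono continuous_on_mult poisson_continuous continuous_ln_norm mult_left_mono poisson_nonneg)
      (auto simp: entire_nz_def)
  finally show ?thesis .
qed

text \<open>The zeros are split off in a disc about \<open>0\<close> while the circle is centred at
  \<open>b\<close>; hence one factorization serves several centres, as in
  \<open>mean_shift_center\<close>.\<close>

lemma mean_ln_factor: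
  assumes G: "G holomorphic_on UNIV" "\<And>z. norm z \<le> S \<Longrightarrow> G z \<noteq> 0" and fin: "finite A"
    and F: "\<And>z. F z = (\<Prod>a\<in>A. (z - a) ^ m a) * G z"
    and good: "\<And>z. z \<in> sphere b r \<Longrightarrow> F z \<noteq> 0" and r: "0 < r" "norm b + r < S"
    and m: "\<And>a. a \<in> A \<Longrightarrow> m a \<noteq> 0"
  shows "cmean b r (\<lambda>z. ln (norm (F z))) = (\<Sum>a\<in>A. real (m a) * ln (max r (norm (a - b)))) + ln (norm (G b))"
proof -
  have A: "a \<notin> sphere b r" if "a \<in> A" for a
    using good[of a] F[of a] m[OF that] that fin by (auto simp: prod_zero_iff)
  have A': "norm (a - b) \<noteq> r" if "a \<in> A" for a
    using A[OF that] by (auto simp: dist_norm norm_minus_commute)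
  have inS: "norm z \<le> S" if "z \<in> ball b (S - norm b)" for z
    using that norm_triangle_ineq2[of z b] by (simp add: dist_norm norm_minus_commute)
  have "cmean b r (\<lambda>z. ln (norm (F z))) = cmean b r (\<lambda>z. (\<Sum>a\<in>A. real (m a) * ln (norm (z - a))) + ln (norm (G z)))"
    using r good by (intro cmean_cong ln_norm_factor[OF F] fin) auto
  also have "\<dots> = (\<Sum>a\<in>A. real (m a) * cmean b r (\<lambda>z. ln (norm (z - a)))) + cmean b r (\<lambda>z. ln (norm (G z)))"
  proof -
    have 1: "continuous_on (sphere b r) (\<lambda>z. real (m a) * ln (norm (z - a)))" if "a \<in> A" for a
      using A[OF that] by (intro continuous_intros) auto
    have 2: "continuous_on (sphere b r) (\<lambda>z. ln (norm (G z)))"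
      using r by (intro continuous_ln_norm G inS) auto
    show ?thesis using 1 2 fin r
      by (subst cmean_add) (auto intro!: continuous_on_sum simp: cmean_sum cmean_cmult)
  qed
  also have "cmean b r (\<lambda>z. ln (norm (G z))) = ln (norm (G b))"
    using r by (intro mean_value_ln[where S = "S - norm b"] holomorphic_on_subset[OF G(1)] G(2) inS) auto
  also have "(\<Sum>a\<in>A. real (m a) * cmean b r (\<lambda>z. ln (norm (z - a)))) = (\<Sum>a\<in>A. real (m a) * ln (max r (norm (a - b))))"
    by (intro sum.cong refl) (simp add: mean_ln_dist r A')
  finally show ?thesis .
qed

lemma zmult_pos: "entire_nz F \<Longrightarrow> F a = 0 \<Longrightarrow> zmult F a \<noteq> 0"
  using entire_nz_zorder_pos[of F a] by (simp add: zmult_def)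

text \<open>Classically \<open>n(s, 1/F)\<close>.\<close>

definition zcount :: "(complex \<Rightarrow> complex) \<Rightarrow> real \<Rightarrow> real" where
  "zcount F s = (\<Sum>a\<in>zeros_in F s. real (zmult F a))"

lemma zcount_nonneg: "zcount F s \<ge> 0"
  unfolding zcount_def by (simp add: sum_nonneg)

lemma zcount_mono:
  assumes "entire_nz F" "s \<le> s'"
  shows "zcount F s \<le> zcount F s'"
  unfolding zcount_def using finite_zeros_in[OF assms(1)] assms(2)
  by (intro sum_mono2) (auto simp: zeros_in_def)

lemma zcount_ge1:
  assumes "entire_nz F" "F a = 0" "norm a \<le> s"
  shows "zcount F s \<ge> 1"
proof -
  have "real (zmult F a) \<le> zcount F s"
    unfolding zcount_def using finite_zeros_in[OF assms(1)] assms
    by (intro member_le_sum) (auto simp: zeros_in_def)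
  then show ?thesis using zmult_pos[OF assms(1,2)] by simp
qed

text \<open>By Jensen's formula each zero contributes
  \<open>ln (max s' (norm a)) - ln (max s (norm a))\<close>, which is nonnegative and equals
  \<open>ln (s' / s)\<close> if \<open>norm a \<le> s\<close>.\<close>

lemma zcount_ln_le:
  assumes F: "entire_nz F" and s: "0 < s" "s \<le> s'"
    and good: "\<And>z. norm z = s \<Longrightarrow> F z \<noteq> 0" "\<And>z. norm z = s' \<Longrightarrow> F z \<noteq> 0"
  shows "zcount F s * ln (s' / s) \<le> cmean 0 s' (\<lambda>z. ln (norm (F z))) - cmean 0 s (\<lambda>z. ln (norm (F z)))"
proof -
  let ?A = "zeros_in F (s' + 1)" and ?m = "zmult F"
  have fin: "finite ?A" using finite_zeros_in[OF F] .
  obtain G where G: "entire_nz G" "\<And>z. norm z \<le> s' + 1 \<Longrightarrow> G z \<noteq> 0"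
    "\<And>z. F z = (\<Prod>a\<in>?A. (z - a) ^ ?m a) * G z"
    using entire_factor_zeros[OF F] by blast
  have Gh: "G holomorphic_on UNIV" using G by (simp add: entire_nz_def)
  have m: "?m a \<noteq> 0" if "a \<in> ?A" for a using zmult_pos[OF F] that by (auto simp: zeros_in_def)
  have "cmean 0 s' (\<lambda>z. ln (norm (F z))) - cmean 0 s (\<lambda>z. ln (norm (F z)))
    = (\<Sum>a\<in>?A. real (?m a) * (ln (max s' (norm a)) - ln (max s (norm a))))"
  proof -
    have "cmean 0 \<rho> (\<lambda>z. ln (norm (F z))) = (\<Sum>a\<in>?A. real (?m a) * ln (max \<rho> (norm a))) + ln (norm (G 0))"
      if "\<rho> = s \<or> \<rho> = s'" for \<rho>
      using mean_ln_factor[OF Gh G(2) fin G(3) _ _ _ m, of "s' + 1" 0 \<rho>] good s that by auto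
    then show ?thesis by (simp add: sum_subtractf right_diff_distrib)
  qed
  also have "\<dots> \<ge> (\<Sum>a\<in>zeros_in F s. real (?m a) * (ln (max s' (norm a)) - ln (max s (norm a))))"
    using fin s by (intro sum_mono2) (auto simp: zeros_in_def intro!: mult_nonneg_nonneg)
  also have "(\<Sum>a\<in>zeros_in F s. real (?m a) * (ln (max s' (norm a)) - ln (max s (norm a)))) = zcount F s * ln (s' / s)"
    unfolding zcount_def sum_distrib_right using s
    by (intro sum.cong refl) (auto simp: zeros_in_def ln_div max_def)
  finally show ?thesis .
qed

lemma mean_ln_mono:
  assumes F: "entire_nz F" and s: "0 < s" "s \<le> s'"
    and good: "\<And>z. norm z = s \<Longrightarrow> F z \<noteq> 0" "\<And>z. norm z = s' \<Longrightarrow> F z \<noteq> 0"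
  shows "cmean 0 s (\<lambda>z. ln (norm (F z))) \<le> cmean 0 s' (\<lambda>z. ln (norm (F z)))"
proof -
  have "0 \<le> zcount F s * ln (s' / s)"
    using s by (intro mult_nonneg_nonneg zcount_nonneg) auto
  then show ?thesis using zcount_ln_le[OF assms] by linarith
qed

definition log_ratio :: "real \<Rightarrow> complex \<Rightarrow> real" where
  "log_ratio r a = (if a = 0 then ln r else ln (r / norm a))"

text \<open>Classically \<open>N(r, 1/F)\<close>, with the integral over \<open>t\<close> already
  evaluated; a zero at \<open>0\<close> contributes \<open>ln r\<close>, as in
  \<open>nevanlinna_N\<close>.\<close>

definition log_zcount :: "real \<Rightarrow> (complex \<Rightarrow> complex) \<Rightarrow> real" where
  "log_zcount r F = (\<Sum>a\<in>zeros_in F r. real (zmult F a) * log_ratio r a)"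

text \<open>The constant is the logarithm of the modulus of the leading Taylor coefficient of
  \<open>F\<close> at \<open>0\<close>. The point is that it is the same for every disc in which
  zeros are split off.\<close>

lemma jensen_const:
  assumes F: "entire_nz F"
  shows "\<exists>\<kappa>. \<forall>S G. 0 \<le> S \<longrightarrow> entire_nz G \<longrightarrow> (\<forall>z. norm z \<le> S \<longrightarrow> G z \<noteq> 0) \<longrightarrow>
     (\<forall>z. F z = (\<Prod>a\<in>zeros_in F S. (z - a) ^ zmult F a) * G z) \<longrightarrow>
     ln (norm (G 0)) + (\<Sum>a\<in>zeros_in F S - {0}. real (zmult F a) * ln (norm a)) = \<kappa>"
proof -
  obtain H where H: "entire_nz H" "H 0 \<noteq> 0" "\<And>z. F z = (z - 0) ^ zmult F 0 * H z"
    using entire_factor1[OF F] by blast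
  have "ln (norm (G 0)) + (\<Sum>a\<in>zeros_in F S - {0}. real (zmult F a) * ln (norm a)) = ln (norm (H 0))"
    if S: "0 \<le> S" and G: "entire_nz G" "\<And>z. norm z \<le> S \<Longrightarrow> G z \<noteq> 0"
      "\<And>z. F z = (\<Prod>a\<in>zeros_in F S. (z - a) ^ zmult F a) * G z" for S G
  proof -
    let ?A = "zeros_in F S - {0}"
    define K where "K z = (\<Prod>a\<in>?A. (z - a) ^ zmult F a) * G z" for z
    have fin: "finite (zeros_in F S)" using finite_zeros_in[OF F] .
    have FK: "F z = z ^ zmult F 0 * K z" for z
    proof (cases "0 \<in> zeros_in F S")
      case True
      then show ?thesis unfolding G(3)[of z] K_def by (subst prod.remove[OF fin True]) simp
    next
      case False
      then have "F 0 \<noteq> 0" using S by (auto simp: zeros_in_def)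
      then show ?thesis unfolding G(3)[of z] K_def using False by (simp add: zmult_def)
    qed
    have eq: "K z = H z" if "z \<noteq> 0" for z
      using FK[of z] H(3)[of z] that by simp
    have c: "isCont K 0" "isCont H 0"
      using G(1) H(1) unfolding K_def entire_nz_def
      by (auto intro!: continuous_intros intro: holomorphic_on_imp_continuous_on
           continuous_on_interior[of UNIV])
    have "K \<midarrow>0\<rightarrow> K 0" "H \<midarrow>0\<rightarrow> H 0" using c by (simp_all add: isCont_def)
    \<comment> \<open>\<open>K\<close> and \<open>H\<close> agree off \<open>0\<close>, where the
      power of \<open>z\<close> can be cancelled, and by continuity also at
      \<open>0\<close>.\<close>
    moreover have "H \<midarrow>0\<rightarrow> K 0"
      by (rule Lim_transform_eventually[OF \<open>K \<midarrow>0\<rightarrow> K 0\<close>]) (auto simp: eventually_at_filter eq)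
    ultimately have "K 0 = H 0" using LIM_unique by blast
    moreover have "ln (norm (K 0)) = (\<Sum>a\<in>?A. real (zmult F a) * ln (norm (0 - a))) + ln (norm (G 0))"
      by (rule ln_norm_factor) (use fin H(2) \<open>K 0 = H 0\<close> in \<open>auto simp: K_def\<close>)
    ultimately show ?thesis by simp
  qed
  then show ?thesis by blast
qed

text \<open>The constant is independent of \<open>r\<close>, so it disappears in an error that is
  small compared with \<open>T\<close>.\<close>

lemma Jensen:
  assumes F: "entire_nz F"
  shows "\<exists>\<kappa>. \<forall>r>0. (\<forall>z. norm z = r \<longrightarrow> F z \<noteq> 0) \<longrightarrow>
     cmean 0 r (\<lambda>z. ln (norm (F z))) = log_zcount r F + \<kappa>"
proof -
  from jensen_const[OF F] obtain \<kappa> where \<kappa>: "\<forall>S G. 0 \<le> S \<longrightarrow> entire_nz G \<longrightarrow> (\<forall>z. norm z \<le> S \<longrightarrow> G z \<noteq> 0) \<longrightarrow>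
     (\<forall>z. F z = (\<Prod>a\<in>zeros_in F S. (z - a) ^ zmult F a) * G z) \<longrightarrow>
     ln (norm (G 0)) + (\<Sum>a\<in>zeros_in F S - {0}. real (zmult F a) * ln (norm a)) = \<kappa>" ..
  have "cmean 0 r (\<lambda>z. ln (norm (F z))) = log_zcount r F + \<kappa>"
    if r: "r > 0" and good: "\<And>z. norm z = r \<Longrightarrow> F z \<noteq> 0" for r
  proof -
    let ?A = "zeros_in F (r + 1)" and ?m = "zmult F"
    have fin: "finite ?A" using finite_zeros_in[OF F] .
    obtain G where G: "entire_nz G" "\<And>z. norm z \<le> r + 1 \<Longrightarrow> G z \<noteq> 0"
      "\<And>z. F z = (\<Prod>a\<in>?A. (z - a) ^ ?m a) * G z"
      using entire_factor_zeros[OF F] by blast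
    have Gh: "G holomorphic_on UNIV" using G by (simp add: entire_nz_def)
    have m: "?m a \<noteq> 0" if "a \<in> ?A" for a using zmult_pos[OF F] that by (auto simp: zeros_in_def)
    have k: "\<kappa> = ln (norm (G 0)) + (\<Sum>a\<in>?A. if a = 0 then 0 else real (?m a) * ln (norm a))"
    proof -
      have "(\<Sum>a\<in>?A. if a = 0 then 0 else real (?m a) * ln (norm a)) = (\<Sum>a\<in>?A - {0}. real (?m a) * ln (norm a))"
        using fin by (intro sum.mono_neutral_cong_right) auto
      moreover have "ln (norm (G 0)) + (\<Sum>a\<in>?A - {0}. real (?m a) * ln (norm a)) = \<kappa>"
        by (rule \<kappa>[rule_format]) (use r G in auto)
      ultimately show ?thesis by simp
    qed
    have "log_zcount r F = (\<Sum>a\<in>?A. if norm a \<le> r then real (?m a) * log_ratio r a else 0)"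
      unfolding log_zcount_def using fin
      by (intro sum.mono_neutral_cong_left) (auto simp: zeros_in_def)
    then have "log_zcount r F + \<kappa> = (\<Sum>a\<in>?A. (if norm a \<le> r then real (?m a) * log_ratio r a else 0)
        + (if a = 0 then 0 else real (?m a) * ln (norm a))) + ln (norm (G 0))"
      using k by (simp add: sum.distrib)
    \<comment> \<open>For \<open>r < norm a\<close> the term \<open>ln (norm a)\<close> is
      contributed by the constant; for a nonzero \<open>a\<close> inside it cancels the denominator
      in \<open>log_ratio\<close>.\<close>
    also have "(\<Sum>a\<in>?A. (if norm a \<le> r then real (?m a) * log_ratio r a else 0)
        + (if a = 0 then 0 else real (?m a) * ln (norm a))) = (\<Sum>a\<in>?A. real (?m a) * ln (max r (norm a)))"
      using r by (intro sum.cong refl) (auto simp: log_ratio_def ln_div algebra_simps max_def)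
    also have "\<dots> + ln (norm (G 0)) = cmean 0 r (\<lambda>z. ln (norm (F z)))"
      using mean_ln_factor[OF Gh G(2) fin G(3) _ _ _ m, of "r + 1" 0 r] good r by auto
    finally show ?thesis by simp
  qed
  then show ?thesis by blast
qed

section \<open>Integrated counting functions of quotients of entire functions\<close>

lemma nevanlinna_N_eq:
  assumes fin: "finite {z. norm z \<le> r \<and> is_pole f z}" and r: "r > 0"
  shows "nevanlinna_N r f = (\<Sum>a | norm a \<le> r \<and> is_pole f a. real (pole_mult f a) * log_ratio r a)"
proof -
  let ?P = "{z. norm z \<le> r \<and> is_pole f z}" and ?m = "\<lambda>a. real (pole_mult f a)"
  have fin': "finite {z. norm z \<le> t \<and> is_pole f z}" if "t \<le> r" for t
    by (rule finite_subset[OF _ fin]) (use that in auto)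
  have 0: "pole_count 0 f = (\<Sum>a\<in>?P. if a = 0 then ?m a else 0)"
    unfolding pole_count_def using fin r by (intro sum.mono_neutral_cong_left) auto
  have pc: "pole_count t f - pole_count 0 f = (\<Sum>a\<in>?P. if a \<noteq> 0 \<and> norm a \<le> t then ?m a else 0)"
    if t: "0 \<le> t" "t \<le> r" for t
  proof -
    have pt: "pole_count t f = (\<Sum>a\<in>?P. if norm a \<le> t then ?m a else 0)"
      unfolding pole_count_def using fin t by (intro sum.mono_neutral_cong_left) auto
    show ?thesis unfolding pt 0 sum_subtractf[symmetric] using t by (auto intro!: sum.cong)
  qed
  \<comment> \<open>A pole \<open>a \<noteq> 0\<close> enters the integrand only from
    \<open>t = norm a\<close> on, so it integrates \<open>1 / t\<close> from there to
    \<open>r\<close>; a pole at \<open>0\<close> is accounted for by the separate term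
    \<open>pole_count 0 f * ln r\<close>.\<close>
  have i1: "((\<lambda>t. (if a \<noteq> 0 \<and> norm a \<le> t then ?m a else 0) / t) has_integral (if a = 0 then 0 else ?m a * ln (r / norm a))) {0..r}"
    if a: "norm a \<le> r" for a
  proof (cases "a = 0")
    case False
    have "((\<lambda>t. ?m a * (1 / t)) has_integral (?m a * (ln r - ln (norm a)))) {norm a..r}"
    proof (intro has_integral_mult_right fundamental_theorem_of_calculus)
      show "(ln has_vector_derivative 1 / x) (at x within {norm a..r})" if "x \<in> {norm a..r}" for x
      proof -
        have "x > 0" using that False by (metis atLeastAtMost_iff order_less_le_trans zero_less_norm_iff)
        then show ?thesis
          by (auto intro!: derivative_eq_intros simp: has_real_derivative_iff_has_vector_derivative[symmetric])
      qed
    qed (use a in auto)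
    then have "((\<lambda>t. if t \<in> {norm a..r} then ?m a / t else 0) has_integral (?m a * (ln r - ln (norm a)))) {0..r}"
      using False by (subst has_integral_restrict) (auto simp: divide_simps)
    then have "((\<lambda>t. (if a \<noteq> 0 \<and> norm a \<le> t then ?m a else 0) / t) has_integral (?m a * (ln r - ln (norm a)))) {0..r}"
      using False by (subst has_integral_cong[where g = "\<lambda>t. if t \<in> {norm a..r} then ?m a / t else 0"]) auto
    then show ?thesis using False r by (simp add: ln_div)
  qed auto
  have "((\<lambda>t. \<Sum>a\<in>?P. (if a \<noteq> 0 \<and> norm a \<le> t then ?m a else 0) / t) has_integral (\<Sum>a\<in>?P. if a = 0 then 0 else ?m a * ln (r / norm a))) {0..r}"
    by (intro has_integral_sum fin i1) auto
  then have "((\<lambda>t. (pole_count t f - pole_count 0 f) / t) has_integral (\<Sum>a\<in>?P. if a = 0 then 0 else ?m a * ln (r / norm a))) {0..r}"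
    by (subst has_integral_cong[where g = "\<lambda>t. \<Sum>a\<in>?P. (if a \<noteq> 0 \<and> norm a \<le> t then ?m a else 0) / t"])
       (auto simp: pc sum_divide_distrib)
  then have "nevanlinna_N r f = (\<Sum>a\<in>?P. if a = 0 then 0 else ?m a * ln (r / norm a)) + (\<Sum>a\<in>?P. if a = 0 then ?m a else 0) * ln r"
    unfolding nevanlinna_N_def 0 by (simp add: integral_unique)
  also have "\<dots> = (\<Sum>a\<in>?P. ?m a * log_ratio r a)"
    unfolding sum_distrib_right sum.distrib[symmetric] by (intro sum.cong) (auto simp: log_ratio_def)
  finally show ?thesis .
qed

lemma zorder_entire:
  assumes "entire_nz F"
  shows "zorder F a = int (zmult F a)"
proof -
  have "if F a = 0 then 0 < zorder F a else zorder F a = 0"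
    using zorder_exist_zero[OF _ open_UNIV connected_UNIV UNIV_I, of F a] assms
    by (auto simp: entire_nz_def simp del: if_split)
  then show ?thesis by (simp add: zmult_def split: if_splits)
qed

text \<open>The truncation in the subtraction of naturals is intended: common zeros cancel, and a
  surplus in the numerator is no pole.\<close>

lemma pole_mult_quotient:
  assumes P: "entire_nz P" and Q: "entire_nz Q"
  shows "pole_mult (\<lambda>z. P z / Q z) a = zmult Q a - zmult P a"
    and "is_pole (\<lambda>z. P z / Q z) a \<Longrightarrow> Q a = 0"
proof -
  have an: "P analytic_on {a}" "Q analytic_on {a}"
    using assms by (auto simp: entire_nz_def analytic_on_holomorphic)
  have mero: "P meromorphic_on {a}" "Q meromorphic_on {a}"
    using an by (auto intro: analytic_on_imp_meromorphic_on)
  have fr: "\<exists>\<^sub>F z in at a. P z \<noteq> 0" "\<exists>\<^sub>F z in at a. Q z \<noteq> 0"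
    using entire_nz_frequently[OF P] entire_nz_frequently[OF Q] by (auto simp: eventually_frequently)
  have z: "zorder (\<lambda>z. P z / Q z) a = int (zmult P a) - int (zmult Q a)"
    using zorder_divide[OF mero(1) fr(1) mero(2) fr(2)] zorder_entire[OF P] zorder_entire[OF Q] by simp
  have m: "(\<lambda>z. P z / Q z) meromorphic_on {a}" using mero by (intro meromorphic_intros)
  have ev: "\<forall>\<^sub>F z in at a. P z / Q z \<noteq> 0"
    using entire_nz_frequently[OF P] entire_nz_frequently[OF Q] by eventually_elim auto
  have neg: "is_pole (\<lambda>z. P z / Q z) a" if "zorder (\<lambda>z. P z / Q z) a < 0"
    using that m ev by (intro neg_zorder_imp_is_pole) (auto simp: meromorphic_at_iff eventually_frequently)
  show "pole_mult (\<lambda>z. P z / Q z) a = zmult Q a - zmult P a"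
  proof (cases "is_pole (\<lambda>z. P z / Q z) a")
    case False
    then have "\<not> zorder (\<lambda>z. P z / Q z) a < 0" using neg by blast
    then show ?thesis using False z by (simp add: pole_mult_def)
  qed (simp add: pole_mult_def z)
  show "Q a = 0" if "is_pole (\<lambda>z. P z / Q z) a"
  proof (rule ccontr)
    assume "Q a \<noteq> 0"
    then have "(\<lambda>z. P z / Q z) analytic_on {a}" using an by (intro analytic_intros) auto
    then show False using that analytic_at_imp_no_pole by blast
  qed
qed

text \<open>Admitting a larger set \<open>A\<close> lets \<open>P / Q\<close> and
  \<open>Q / P\<close> be summed over one common set; points of \<open>A\<close> that are no poles
  contribute 0.\<close>

lemma nevanlinna_N_quotient_sum:
  assumes P: "entire_nz P" and Q: "entire_nz Q" and r: "r > 0"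
    and A: "finite A" "zeros_in Q r \<subseteq> A" "A \<subseteq> cball 0 r"
  shows "nevanlinna_N r (\<lambda>z. P z / Q z) = (\<Sum>a\<in>A. real (zmult Q a - zmult P a) * log_ratio r a)"
proof -
  have sub: "{z. norm z \<le> r \<and> is_pole (\<lambda>z. P z / Q z) z} \<subseteq> zeros_in Q r"
    unfolding zeros_in_def by (intro Collect_mono conj_mono impI pole_mult_quotient(2)[OF P Q])
  have fin: "finite {z. norm z \<le> r \<and> is_pole (\<lambda>z. P z / Q z) z}"
    by (rule finite_subset[OF subset_trans[OF sub A(2)] A(1)])
  show ?thesis
    unfolding nevanlinna_N_eq[OF fin r] pole_mult_quotient(1)[OF P Q]
  proof (rule sum.mono_neutral_left[OF A(1)])
    show "{z. norm z \<le> r \<and> is_pole (\<lambda>z. P z / Q z) z} \<subseteq> A" using sub A(2) by (rule subset_trans)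
    show "\<forall>i\<in>A - {z. norm z \<le> r \<and> is_pole (\<lambda>z. P z / Q z) z}. real (zmult Q i - zmult P i) * log_ratio r i = 0"
    proof
      fix i assume "i \<in> A - {z. norm z \<le> r \<and> is_pole (\<lambda>z. P z / Q z) z}"
      then have "\<not> is_pole (\<lambda>z. P z / Q z) i" using A(3) by auto
      then have "zmult Q i - zmult P i = 0"
        using pole_mult_quotient(1)[OF P Q, of i] unfolding pole_mult_def by presburger
      then show "real (zmult Q i - zmult P i) * log_ratio r i = 0" by simp
    qed
  qed
qed

text \<open>Zeros common to \<open>P\<close> and \<open>Q\<close> are harmless, because the two
  truncated differences of multiplicities differ by the true one.\<close>

lemma nevanlinna_N_quotient:
  assumes P: "entire_nz P" and Q: "entire_nz Q" and r: "r > 0"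
  shows "nevanlinna_N r (\<lambda>z. P z / Q z) - nevanlinna_N r (\<lambda>z. Q z / P z) = log_zcount r Q - log_zcount r P"
proof -
  let ?A = "zeros_in P r \<union> zeros_in Q r"
  have fin: "finite ?A" using finite_zeros_in P Q by auto
  have l: "log_zcount r K = (\<Sum>a\<in>?A. real (zmult K a) * log_ratio r a)" if "K = P \<or> K = Q" for K
    unfolding log_zcount_def using fin that
    by (intro sum.mono_neutral_left) (auto simp: zeros_in_def zmult_def)
  have A: "?A \<subseteq> cball 0 r" by (auto simp: zeros_in_def)
  have "nevanlinna_N r (\<lambda>z. P z / Q z) - nevanlinna_N r (\<lambda>z. Q z / P z)
     = (\<Sum>a\<in>?A. real (zmult Q a - zmult P a) * log_ratio r a - real (zmult P a - zmult Q a) * log_ratio r a)"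
    using nevanlinna_N_quotient_sum[OF P Q r fin _ A] nevanlinna_N_quotient_sum[OF Q P r fin _ A]
    unfolding sum_subtractf by simp
  also have "\<dots> = (\<Sum>a\<in>?A. real (zmult Q a) * log_ratio r a - real (zmult P a) * log_ratio r a)"
  proof (rule sum.cong[OF refl])
    fix a
    have "real (zmult Q a - zmult P a) - real (zmult P a - zmult Q a) = real (zmult Q a) - real (zmult P a)"
      by linarith
    then show "real (zmult Q a - zmult P a) * log_ratio r a - real (zmult P a - zmult Q a) * log_ratio r a
      = real (zmult Q a) * log_ratio r a - real (zmult P a) * log_ratio r a"
      by (simp only: left_diff_distrib[symmetric])
  qed
  also have "\<dots> = log_zcount r Q - log_zcount r P"
    using l[of P] l[of Q] unfolding sum_subtractf by simp
  finally show ?thesis .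
qed

text \<open>For \<open>r \<ge> 1\<close> every \<open>log_ratio r a\<close> in the sum is
  nonnegative, also the value \<open>ln r\<close> at \<open>a = 0\<close>, so cancelled zeros may be
  added back.\<close>

lemma nevanlinna_N_quotient_le:
  assumes P: "entire_nz P" and Q: "entire_nz Q" and r: "r \<ge> 1"
  shows "nevanlinna_N r (\<lambda>z. P z / Q z) \<le> log_zcount r Q"
proof -
  have "nevanlinna_N r (\<lambda>z. P z / Q z) = (\<Sum>a\<in>zeros_in Q r. real (zmult Q a - zmult P a) * log_ratio r a)"
    by (rule nevanlinna_N_quotient_sum[OF P Q]) (use r finite_zeros_in[OF Q] in \<open>auto simp: zeros_in_def\<close>)
  also have "\<dots> \<le> log_zcount r Q"
    unfolding log_zcount_def
  proof (intro sum_mono mult_right_mono)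
    fix a assume "a \<in> zeros_in Q r"
    then show "0 \<le> log_ratio r a" using r by (auto simp: log_ratio_def zeros_in_def)
  qed auto
  finally show ?thesis .
qed

section \<open>A growth lemma\<close>

text \<open>With \<open>a k = \<phi> k / k\<close>, the summand is
  \<open>a (k + 2) - a k + 2 * \<phi> k / (k * (k + 2))\<close>. The differences telescope because
  \<open>a\<close> tends to 0, and the rest is at most \<open>2 * k powr (\<kappa> - 2)\<close>;
  both use \<open>\<kappa> < 1\<close>.\<close>

lemma summable_increments:
  fixes \<phi> :: "nat \<Rightarrow> real"
  assumes \<kappa>: "\<kappa> < 1" and nonneg: "\<And>k. 0 \<le> \<phi> k"
    and bound: "\<forall>\<^sub>F k in sequentially. \<phi> k \<le> real k powr \<kappa>"
  shows "summable (\<lambda>k. (\<phi> (k + 2) - \<phi> k) / real (k + 2))"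
proof -
  define a where "a k = \<phi> k / real k" for k
  have lim: "a \<longlonglongrightarrow> 0"
  proof (rule tendsto_sandwich)
    show "\<forall>\<^sub>F k in sequentially. 0 \<le> a k" by (simp add: a_def nonneg)
    show "\<forall>\<^sub>F k in sequentially. a k \<le> real k powr (\<kappa> - 1)"
      using bound eventually_gt_at_top[of 0]
      by eventually_elim (simp add: a_def powr_diff divide_right_mono)
    show "(\<lambda>k. real k powr (\<kappa> - 1)) \<longlonglongrightarrow> 0"
      using \<kappa> by (intro tendsto_neg_powr filterlim_real_sequentially) auto
  qed auto
  have s1: "summable (\<lambda>k. a (Suc k) - a k)" by (rule telescope_summable[OF lim])
  have s2: "summable (\<lambda>k. a (Suc (Suc k)) - a (Suc k))"
    using telescope_summable[OF LIMSEQ_Suc[OF lim]] by simp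
  have s3: "summable (\<lambda>k. 2 * \<phi> k / (real k * real (k + 2)))"
  proof (rule summable_comparison_test_ev)
    show "summable (\<lambda>k. 2 * real k powr (\<kappa> - 2))"
      using \<kappa> by (intro summable_mult) (simp add: summable_real_powr_iff)
    show "\<forall>\<^sub>F k in sequentially. norm (2 * \<phi> k / (real k * real (k + 2))) \<le> 2 * real k powr (\<kappa> - 2)"
      using bound eventually_gt_at_top[of 0]
    proof eventually_elim
      case (elim k)
      have "\<phi> k / (real k * real (k + 2)) \<le> real k powr \<kappa> / (real k * real k)"
        using elim nonneg[of k] by (intro frac_le mult_left_mono) auto
      also have "\<dots> = real k powr (\<kappa> - 2)"
        using elim by (simp add: powr_diff power2_eq_square)
      finally show ?case using nonneg[of k] by simp
    qed
  qed
  have "summable (\<lambda>k. (a (Suc (Suc k)) - a (Suc k)) + (a (Suc k) - a k) + 2 * \<phi> k / (real k * real (k + 2)))"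
    by (intro summable_add s1 s2 s3)
  moreover have "\<forall>\<^sub>F k in sequentially. (a (Suc (Suc k)) - a (Suc k)) + (a (Suc k) - a k) + 2 * \<phi> k / (real k * real (k + 2))
      = (\<phi> (k + 2) - \<phi> k) / real (k + 2)"
    using eventually_gt_at_top[of 0]
  proof eventually_elim
    case (elim k)
    have "\<phi> k / real k - \<phi> k / real (k + 2) = 2 * \<phi> k / (real k * real (k + 2))"
      using elim by (simp add: field_simps)
    then show ?case by (simp add: a_def diff_divide_distrib)
  qed
  ultimately show ?thesis using summable_cong by force
qed

lemma finite_log_measure_union_countable:
  assumes "finite_log_measure E" "countable Z"
  shows "finite_log_measure (E \<union> (Z \<inter> {0<..}))"
proof -
  have c: "countable (Z \<inter> {0<..})" using assms(2) by (rule countable_subset[rotated]) auto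
  then have null: "Z \<inter> {0<..} \<in> null_sets lebesgue"
    by (metis countable_imp_null_set_lborel null_sets_completionI)
  then have AE: "AE t in lebesgue. t \<notin> Z \<inter> {0<..}" by (rule AE_not_in)
  have "(\<integral>\<^sup>+ t \<in> (E \<union> (Z \<inter> {0<..})) \<inter> {1..}. ennreal (1 / t) \<partial>lebesgue) = (\<integral>\<^sup>+ t \<in> E \<inter> {1..}. ennreal (1 / t) \<partial>lebesgue)"
    using AE by (intro nn_integral_cong_AE) (auto simp: indicator_def)
  then show ?thesis using assms(1) null unfolding finite_log_measure_def by (auto intro: null_setsD2)
qed

text \<open>The interval with index \<open>k\<close> has logarithmic measure
  \<open>p * ln (1 + 1 / k)\<close>, which is at most \<open>p / k\<close>.\<close>

lemma finite_log_measure_Union_intervals: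
  fixes p :: real
  assumes p: "p > 0" and B: "0 \<notin> B" and sum: "summable (\<lambda>k. if k \<in> B then 1 / real k else 0)"
  shows "finite_log_measure (\<Union>k\<in>B. {real k powr p .. real (k + 1) powr p})"
proof -
  define I where "I k = {real k powr p .. real (k + 1) powr p}" for k
  let ?E = "\<Union>k\<in>B. I k"
  have pos: "0 < t" if "t \<in> I k" "k \<in> B" for t k
  proof -
    have "k \<noteq> 0" using that B by metis
    then have "0 < real k powr p" by simp
    also have "\<dots> \<le> t" using that by (simp add: I_def)
    finally show ?thesis .
  qed
  define h where "h k t = (if k \<in> B then ennreal (1 / t) * indicator (I k) t else 0)" for k :: nat and t :: real
  have meas: "h k \<in> borel_measurable lborel" for k
    unfolding h_def I_def by (cases "k \<in> B") simp_all
  have int: "(\<integral>\<^sup>+ t. h k t \<partial>lborel) \<le> ennreal (p * (if k \<in> B then 1 / real k else 0))" for k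
  proof (cases "k \<in> B")
    case True
    then have k: "real k > 0" using B by (metis gr0I of_nat_0_less_iff)
    have le: "real k powr p \<le> real (k + 1) powr p" using p by (intro powr_mono2) auto
    have "((\<lambda>t. 1 / t) has_integral (ln (real (k + 1) powr p) - ln (real k powr p))) (I k)"
      unfolding I_def
    proof (intro fundamental_theorem_of_calculus le)
      show "(ln has_vector_derivative 1 / x) (at x within {real k powr p..real (k + 1) powr p})"
        if "x \<in> {real k powr p..real (k + 1) powr p}" for x
        using pos[of x k] True that unfolding I_def
        by (auto intro!: derivative_eq_intros simp: has_real_derivative_iff_has_vector_derivative[symmetric])
    qed
    then have hi: "((\<lambda>t. 1 / t) has_integral (ln (real (k + 1) powr p) - ln (real k powr p))) (I k)" .
    have "(\<integral>\<^sup>+ t. h k t \<partial>lborel) = ennreal (ln (real (k + 1) powr p) - ln (real k powr p))"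
    proof -
      have "0 \<le> 1 / x" if "x \<in> I k" for x using pos[OF that True] by simp
      then show ?thesis
        using nn_integral_has_integral_lebesgue'[OF _ hi] True unfolding h_def by simp
    qed
    also have "ln (real (k + 1) powr p) - ln (real k powr p) = p * ln (1 + 1 / real k)"
    proof -
      have "1 + 1 / real k = real (k + 1) / real k" using k by (simp add: field_simps)
      then have "ln (1 + 1 / real k) = ln (real (k + 1) / real k)" by (rule arg_cong)
      also have "\<dots> = ln (real (k + 1)) - ln (real k)" using k by (intro ln_divide_pos) auto
      finally have "p * ln (1 + 1 / real k) = p * ln (real (k + 1)) - p * ln (real k)"
        by (simp only: right_diff_distrib)
      then show ?thesis using k by (simp only: ln_powr)
    qed
    also have "\<dots> \<le> p * (1 / real k)"
      using k p by (intro mult_left_mono ln_add_one_self_le_self) auto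
    finally show ?thesis using True by (simp add: ennreal_leI)
  qed (simp add: h_def)
  have "(\<integral>\<^sup>+ t \<in> ?E \<inter> {1..}. ennreal (1 / t) \<partial>lebesgue) = (\<integral>\<^sup>+ t \<in> ?E \<inter> {1..}. ennreal (1 / t) \<partial>lborel)"
    by (rule nn_integral_completion)
  also have "\<dots> \<le> (\<integral>\<^sup>+ t. (\<Sum>k. h k t) \<partial>lborel)"
  proof (intro nn_integral_mono)
    fix t :: real
    show "ennreal (1 / t) * indicator (?E \<inter> {1..}) t \<le> (\<Sum>k. h k t)"
    proof (cases "t \<in> ?E")
      case True
      then obtain k where k: "k \<in> B" "t \<in> I k" by auto
      have "ennreal (1 / t) * indicator (?E \<inter> {1..}) t \<le> h k t"
        using k by (auto simp: h_def indicator_def)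
      also have "h k t = (\<Sum>j\<in>{k}. h j t)" by simp
      also have "\<dots> \<le> (\<Sum>k. h k t)" by (rule sum_le_suminf) auto
      finally show ?thesis .
    qed simp
  qed
  also have "\<dots> = (\<Sum>k. \<integral>\<^sup>+ t. h k t \<partial>lborel)" by (intro nn_integral_suminf meas)
  also have "\<dots> \<le> (\<Sum>k. ennreal (p * (if k \<in> B then 1 / real k else 0)))"
    by (intro suminf_le int) auto
  also have "\<dots> < \<infinity>"
  proof -
    have "(\<Sum>k. ennreal (p * (if k \<in> B then 1 / real k else 0))) \<noteq> \<infinity>"
      unfolding infinity_ennreal_def by (rule ennreal_suminf_neq_top[OF summable_mult[OF sum]]) (use p in auto)
    then show ?thesis by (simp add: less_top)
  qed
  finally have "(\<integral>\<^sup>+ t \<in> ?E \<inter> {1..}. ennreal (1 / t) \<partial>lebesgue) < \<infinity>" .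
  moreover have "?E \<in> sets lebesgue" unfolding I_def by (intro sets.countable_UN') auto
  moreover have "?E \<subseteq> {0<..}" using pos by auto
  ultimately show ?thesis unfolding finite_log_measure_def I_def by blast
qed

text \<open>In the variable \<open>x = r\<^sup>\<tau>\<close> the step from \<open>r\<close> to \<open>r + r\<^bsup>1-\<tau>\<^esup>\<close> has length at most \<open>1\<close>; the exceptional
  set consists of the unit intervals \<open>[k, k + 1]\<close> for which \<open>log T\<close> increases by more than \<open>log 2\<close>
  on \<open>[k, k + 2]\<close>.\<close>

lemma growth_lemma:
  fixes T :: "real \<Rightarrow> real"
  assumes \<sigma>: "0 < \<sigma>" "\<sigma> < \<tau>" "\<tau> < 1"
    and mono: "\<And>x y. 0 < x \<Longrightarrow> x \<le> y \<Longrightarrow> T x \<le> T y"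
    and upper: "\<forall>\<^sub>F r in at_top. T r \<le> exp (r powr \<sigma>)"
    and lower: "\<forall>\<^sub>F r in at_top. 1 \<le> T r"
  shows "\<exists>E. finite_log_measure E \<and> (\<forall>\<^sub>F r in at_top. r \<notin> E \<longrightarrow> T (r + r powr (1 - \<tau>)) \<le> 2 * T r)"
proof -
  define p where "p = 1 / \<tau>"
  have p: "p > 0" "p * \<tau> = 1" "\<tau> > 0" using \<sigma> by (auto simp: p_def)
  \<comment> \<open>\<open>max 1\<close> makes \<open>\<phi>\<close> nonnegative whatever
    \<open>T\<close> does at small radii.\<close>
  define \<phi> where "\<phi> k = ln (max 1 (T (real k powr p)))" for k :: nat
  \<comment> \<open>Index 0 is excluded because \<open>T\<close> is assumed monotone on positive
    radii, and to keep the intervals inside the positive axis.\<close>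
  define B where "B = {k. 1 \<le> k \<and> ln 2 < \<phi> (k + 2) - \<phi> k}"
  have nonneg: "0 \<le> \<phi> k" for k by (simp add: \<phi>_def)
  have \<phi>_mono: "\<phi> j \<le> \<phi> k" if "1 \<le> j" "j \<le> k" for j k
  proof -
    have "T (real j powr p) \<le> T (real k powr p)"
      using that p by (intro mono powr_mono2) auto
    then show ?thesis unfolding \<phi>_def by auto
  qed
  have lim: "filterlim (\<lambda>k::nat. real k powr p) at_top sequentially"
    using p(1) by real_asymp
  have bound: "\<forall>\<^sub>F k in sequentially. \<phi> k \<le> real k powr (\<sigma> / \<tau>)"
    using eventually_compose_filterlim[OF upper lim]
  proof eventually_elim
    case (elim k)
    have "max 1 (T (real k powr p)) \<le> exp ((real k powr p) powr \<sigma>)" using elim by simp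
    then have "\<phi> k \<le> ln (exp ((real k powr p) powr \<sigma>))"
      unfolding \<phi>_def by (intro ln_mono) auto
    also have "\<dots> = (real k powr p) powr \<sigma>" by simp
    also have "\<dots> = real k powr (\<sigma> / \<tau>)" by (simp add: powr_powr p_def)
    finally show ?case .
  qed
  have "summable (\<lambda>k. 3 / ln 2 * ((\<phi> (k + 2) - \<phi> k) / real (k + 2)))"
    using \<sigma> by (intro summable_mult summable_increments[OF _ nonneg bound]) auto
  then have "summable (\<lambda>k. if k \<in> B then 1 / real k else 0)"
  proof (rule summable_comparison_test_ev[rotated])
    show "\<forall>\<^sub>F k in sequentially. norm (if k \<in> B then 1 / real k else 0) \<le> 3 / ln 2 * ((\<phi> (k + 2) - \<phi> k) / real (k + 2))"
      using eventually_ge_at_top[of 1]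
    proof eventually_elim
      case (elim k)
      show ?case
      proof (cases "k \<in> B")
        case True
        \<comment> \<open>\<open>k + 2 \<le> 3 * k\<close> for \<open>k \<ge> 1\<close>; this is the
          3 in the comparison series.\<close>
        have "1 / real k \<le> 3 / real (k + 2)" using elim by (simp add: field_simps)
        also have "\<dots> = 3 / ln 2 * (ln 2 / real (k + 2))" by simp
        also have "\<dots> \<le> 3 / ln 2 * ((\<phi> (k + 2) - \<phi> k) / real (k + 2))"
          using True by (intro mult_left_mono divide_right_mono) (auto simp: B_def)
        finally show ?thesis using True by simp
      qed (use \<phi>_mono[of k "k + 2"] elim in auto)
    qed
  qed
  then have E: "finite_log_measure (\<Union>k\<in>B. {real k powr p .. real (k + 1) powr p})"
    using p by (intro finite_log_measure_Union_intervals) (auto simp: B_def)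
  have "\<forall>\<^sub>F r in at_top. r \<notin> (\<Union>k\<in>B. {real k powr p .. real (k + 1) powr p}) \<longrightarrow> T (r + r powr (1 - \<tau>)) \<le> 2 * T r"
    using lower eventually_ge_at_top[of 1]
  proof eventually_elim
    case (elim r)
    show ?case
    proof
      assume nE: "r \<notin> (\<Union>k\<in>B. {real k powr p .. real (k + 1) powr p})"
      define k where "k = nat \<lfloor>r powr \<tau>\<rfloor>"
      have r1: "1 \<le> r powr \<tau>" using elim p by (simp add: ge_one_powr_ge_zero)
      have k: "real k \<le> r powr \<tau>" "r powr \<tau> \<le> real (k + 1)" "1 \<le> k"
        unfolding k_def using r1 by (auto simp: le_nat_floor) linarith+
      have rp: "(r powr \<tau>) powr p = r" using elim p by (simp add: powr_powr mult.commute)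
      have kr: "real k powr p \<le> r" "r \<le> real (k + 1) powr p"
        using k p powr_mono2[of p "real k" "r powr \<tau>"] powr_mono2[of p "r powr \<tau>" "real (k + 1)"] rp by auto
      then have "k \<notin> B" using nE by auto
      then have "\<phi> (k + 2) \<le> \<phi> k + ln 2" using k by (auto simp: B_def)
      then have "exp (\<phi> (k + 2)) \<le> exp (\<phi> k + ln 2)" by simp
      then have *: "max 1 (T (real (k + 2) powr p)) \<le> 2 * max 1 (T (real k powr p))"
        unfolding exp_add by (simp add: \<phi>_def mult.commute)
      \<comment> \<open>As \<open>\<tau> < 1\<close>,
        \<open>(1 + x) powr \<tau> \<le> 1 + x\<close>, so the step moves
        \<open>r powr \<tau>\<close> by at most 1 and its end stays below
        \<open>k + 2\<close>.\<close>
      have "r + r powr (1 - \<tau>) = r * (1 + r powr (-\<tau>))"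
        using elim by (simp add: powr_diff powr_minus field_simps)
      then have "(r + r powr (1 - \<tau>)) powr \<tau> = r powr \<tau> * (1 + r powr (-\<tau>)) powr \<tau>"
        using elim by (simp add: powr_mult)
      also have "(1 + r powr (-\<tau>)) powr \<tau> \<le> (1 + r powr (-\<tau>)) powr 1"
        using \<sigma> by (intro powr_mono) auto
      then have "r powr \<tau> * (1 + r powr (-\<tau>)) powr \<tau> \<le> r powr \<tau> * (1 + r powr (-\<tau>))"
        by (intro mult_left_mono) (auto simp: powr_one)
      also have "\<dots> = r powr \<tau> + 1" using elim by (simp add: powr_minus field_simps)
      also have "\<dots> \<le> real (k + 2)" using k by simp
      finally have "((r + r powr (1 - \<tau>)) powr \<tau>) powr p \<le> real (k + 2) powr p"
        using p by (intro powr_mono2) auto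
      then have le: "r + r powr (1 - \<tau>) \<le> real (k + 2) powr p"
        using elim p by (simp add: powr_powr mult.commute add_nonneg_nonneg)
      have "T (r + r powr (1 - \<tau>)) \<le> T (real (k + 2) powr p)"
        using elim by (intro mono le) (auto intro: add_pos_nonneg)
      also have "\<dots> \<le> 2 * max 1 (T (real k powr p))" using * by simp
      \<comment> \<open>Here \<open>1 \<le> T r\<close> removes the \<open>max\<close>.\<close>
      also have "\<dots> \<le> 2 * T r"
        using elim kr k mono[of "real k powr p" r] by auto
      finally show "T (r + r powr (1 - \<tau>)) \<le> 2 * T r" .
    qed
  qed
  then show ?thesis using E by blast
qed

section \<open>Differences of logarithms\<close>

text \<open>Trades the logarithm for a power that stays integrable across a singularity. For
  \<open>t \<le> 1\<close> use \<open>ln (1 + t) \<le> t \<le> t powr d\<close>, otherwise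
  \<open>1 + t \<le> 2 * t\<close>; the factor 2 covers both.\<close>

lemma ln_one_plus_powr:
  fixes t d :: real
  assumes "0 < d" "d < 1" "0 \<le> t"
  shows "ln (1 + t) \<le> 2 * t powr d / d"
proof (cases "t \<le> 1")
  case True
  have "ln (1 + t) \<le> t" using assms by (intro ln_add_one_self_le_self)
  also have "t \<le> t powr d"
    using powr_mono'[of d 1 t] assms True by simp
  also have "\<dots> \<le> 2 * t powr d / d"
    using assms mult_left_mono[of 1 "2 / d" "t powr d"] by (simp add: field_simps)
  finally show ?thesis .
next
  case False
  have "ln (1 + t) \<le> (1 + t) powr d / d" using assms by (intro ln_powr_bound) auto
  also have "(1 + t) powr d \<le> (2 * t) powr d" using assms False by (intro powr_mono2) auto
  also have "(2 * t) powr d = 2 powr d * t powr d" using assms by (simp add: powr_mult)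
  also have "2 powr d \<le> (2::real) powr 1" using assms by (intro powr_mono) auto
  finally show ?thesis using assms by (simp add: divide_right_mono mult_right_mono)
qed

text \<open>The larger number exceeds the smaller one, \<open>m\<close> say, by at most
  \<open>\<beta>\<close>, so the difference is at most \<open>ln (1 + \<beta> / m)\<close>. Adding
  the terms for \<open>x\<close> and \<open>y\<close> avoids saying which one is smaller.\<close>

lemma ln_diff_powr:
  fixes x y \<beta> d :: real
  assumes d: "0 < d" "d < 1" and xy: "0 < x" "0 < y" "\<bar>x - y\<bar> \<le> \<beta>"
  shows "\<bar>ln x - ln y\<bar> \<le> 2 * \<beta> powr d / d * (x powr (-d) + y powr (-d))"
proof -
  have *: "ln v - ln u \<le> 2 * \<beta> powr d / d * u powr (-d)" if "0 < u" "0 < v" "v - u \<le> \<beta>" "0 \<le> \<beta>" for u v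
  proof -
    have "ln v - ln u = ln (v / u)" using that by (simp add: ln_div)
    also have "\<dots> \<le> ln (1 + \<beta> / u)"
      using that by (intro ln_mono) (auto simp: field_simps add_pos_nonneg)
    also have "\<dots> \<le> 2 * (\<beta> / u) powr d / d" using that d by (intro ln_one_plus_powr) auto
    also have "\<dots> = 2 * \<beta> powr d / d * u powr (-d)"
      using that by (simp add: powr_divide powr_minus field_simps)
    finally show ?thesis .
  qed
  have b: "0 \<le> \<beta>" using xy by linarith
  have "0 \<le> 2 * \<beta> powr d / d * x powr (-d)" "0 \<le> 2 * \<beta> powr d / d * y powr (-d)"
    using d by auto
  then show ?thesis using *[of x y] *[of y x] xy b unfolding distrib_left by linarith
qed

lemma mean_powr:
  assumes d: "0 < d" "d < 1" and r: "r > 0" "norm w \<noteq> r"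
  shows "cmean 0 r (\<lambda>z. norm (z - w) powr (-d)) \<le> circle_const d / (2*pi) * r powr (-d)"
proof -
  obtain p where p: "p integrable_on {0..2*pi}" "integral {0..2*pi} p \<le> circle_const d"
    "\<And>t. t \<in> {0..2*pi} \<Longrightarrow> of_real r * cis t \<noteq> w \<Longrightarrow> norm (of_real r * cis t - w) powr (-d) \<le> r powr (-d) * p t"
    using circle_singularity[OF d r(1), of w] by blast
  have ne: "of_real r * cis t \<noteq> w" for t using r by (auto simp: norm_mult)
  have c: "continuous_on (sphere 0 r) (\<lambda>z. norm (z - w) powr (-d))"
    using r by (intro continuous_intros) auto
  have "integral {0..2*pi} (\<lambda>t. norm (0 + of_real r * cis t - w) powr (-d)) \<le> integral {0..2*pi} (\<lambda>t. r powr (-d) * p t)"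
    using p ne circle_integrable[OF c] r by (intro integral_le) (auto intro: integrable_on_cmult_left)
  also have "\<dots> = r powr (-d) * integral {0..2*pi} p" by simp
  also have "\<dots> \<le> r powr (-d) * circle_const d" by (intro mult_left_mono p) auto
  finally show ?thesis unfolding cmean_def by (simp add: divide_right_mono mult.commute)
qed

text \<open>Shifting by \<open>b\<close> changes the distance to \<open>w\<close> by at most
  \<open>norm b\<close>. The singularities at \<open>w\<close> and \<open>w - b\<close> obey the
  same bound, which doubles the constant of \<open>ln_diff_powr\<close>.\<close>

lemma mean_ln_shift:
  assumes d: "0 < d" "d < 1" and r: "r > 0" "norm w \<noteq> r" "norm (w - b) \<noteq> r"
  shows "cmean 0 r (\<lambda>z. \<bar>ln (norm (z + b - w)) - ln (norm (z - w))\<bar>) \<le> 4 * norm b powr d / d * (circle_const d / (2*pi)) * r powr (-d)"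
proof -
  let ?c = "2 * norm b powr d / d"
  have ne: "z + b - w \<noteq> 0" "z - w \<noteq> 0" "z - (w - b) \<noteq> 0" if "z \<in> sphere 0 r" for z
    using r that by (auto simp: algebra_simps)
  have c: "continuous_on (sphere 0 r) (\<lambda>z. norm (z - (w - b)) powr (-d))" "continuous_on (sphere 0 r) (\<lambda>z. norm (z - w) powr (-d))"
    using ne by (auto intro!: continuous_intros)
  have "cmean 0 r (\<lambda>z. \<bar>ln (norm (z + b - w)) - ln (norm (z - w))\<bar>)
      \<le> cmean 0 r (\<lambda>z. ?c * (norm (z - (w - b)) powr (-d) + norm (z - w) powr (-d)))"
  proof (rule cmean_mono)
    fix z assume z: "z \<in> sphere (0::complex) r"
    have "\<bar>norm (z + b - w) - norm (z - w)\<bar> \<le> norm b"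
      using norm_triangle_ineq3[of "z + b - w" "z - w"] by simp
    from ln_diff_powr[OF d _ _ this] ne[OF z]
    show "\<bar>ln (norm (z + b - w)) - ln (norm (z - w))\<bar> \<le> ?c * (norm (z - (w - b)) powr (-d) + norm (z - w) powr (-d))"
      by (simp add: algebra_simps)
  qed (use r ne d in \<open>auto intro!: continuous_intros\<close>)
  also have "\<dots> = ?c * (cmean 0 r (\<lambda>z. norm (z - (w - b)) powr (-d)) + cmean 0 r (\<lambda>z. norm (z - w) powr (-d)))"
    using r by (subst cmean_cmult, subst cmean_add[OF c]) auto
  also have "\<dots> \<le> ?c * (circle_const d / (2*pi) * r powr (-d) + circle_const d / (2*pi) * r powr (-d))"
    using d r by (intro mult_left_mono add_mono mean_powr) auto
  finally show ?thesis by (simp add: algebra_simps)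
qed

text \<open>Up to constants, Green's function is a difference of two logarithms of distances, to
  \<open>a\<close> and to its reflection in the circle of radius \<open>s\<close>; each obeys
  \<open>mean_ln_shift\<close>, hence 8 in place of 4.\<close>

lemma mean_green_shift:
  assumes d: "0 < d" "d < 1" and r: "r > 0" "norm a \<noteq> r" "norm (a - b) \<noteq> r"
    and s: "r + norm b < s" "norm a < s"
  shows "cmean 0 r (\<lambda>z. \<bar>green s a (z + b) - green s a z\<bar>) \<le> 8 * norm b powr d / d * (circle_const d / (2*pi)) * r powr (-d)"
    and "continuous_on (sphere 0 r) (\<lambda>z. \<bar>green s a (z + b) - green s a z\<bar>)"
proof -
  let ?K = "4 * norm b powr d / d * (circle_const d / (2*pi)) * r powr (-d)"
  have s0: "s > 0" using r s norm_ge_zero[of b] by linarith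
  have refl: "(of_real s)\<^sup>2 - cnj a * z \<noteq> 0" if "norm z < s" for z
  proof -
    have "norm a * s \<le> s * s" using s s0 by (intro mult_right_mono) auto
    then have "s \<le> (if a = 0 then s else s\<^sup>2 / norm a)"
      by (simp add: pos_le_divide_eq power2_eq_square mult.commute)
    from reflect_nonzero[OF s(2) that this] show ?thesis .
  qed
  have rs: "r < s" using s norm_ge_zero[of b] by linarith
  have ne: "z + b - a \<noteq> 0" "z - a \<noteq> 0" "norm (z + b) < s" "norm z < s" if "z \<in> sphere 0 r" for z
    using r that s rs norm_triangle_ineq[of z b] by (auto simp: algebra_simps)
  have c1: "continuous_on (sphere 0 r) (\<lambda>z. \<bar>ln (norm (z + b - a)) - ln (norm (z - a))\<bar>)"
    using ne by (intro continuous_intros) auto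
  have c2: "continuous_on (sphere 0 r) (\<lambda>z. \<bar>ln (norm ((of_real s)\<^sup>2 - cnj a * (z + b)) / s) - ln (norm ((of_real s)\<^sup>2 - cnj a * z) / s)\<bar>)"
    using ne s0 refl by (intro continuous_intros) auto
  show c3: "continuous_on (sphere 0 r) (\<lambda>z. \<bar>green s a (z + b) - green s a z\<bar>)"
    unfolding green_def using ne s0 refl by (intro continuous_intros) auto
  have 2: "cmean 0 r (\<lambda>z. \<bar>ln (norm ((of_real s)\<^sup>2 - cnj a * (z + b)) / s) - ln (norm ((of_real s)\<^sup>2 - cnj a * z) / s)\<bar>) \<le> ?K"
  proof (cases "a = 0")
    \<comment> \<open>For \<open>a = 0\<close> the reflected point is at infinity and the first
      logarithm is constant.\<close>
    case True
    have "0 \<le> circle_const d" unfolding circle_const_def using d by auto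
    then show ?thesis using True d by simp
  next
    case False
    \<comment> \<open>The reflection of \<open>a\<close>; it lies outside the disc of radius
      \<open>s\<close>, so both \<open>w\<close> and \<open>w - b\<close> stay off the circle of
      radius \<open>r\<close>.\<close>
    define w where "w = (of_real s)\<^sup>2 / cnj a"
    have nw: "norm w = s\<^sup>2 / norm a" by (simp add: w_def norm_divide norm_power)
    have ws: "norm w > s" unfolding nw using s False s0 by (simp add: field_simps power2_eq_square)
    have e: "norm ((of_real s)\<^sup>2 - cnj a * z) = norm a * norm (z - w)" for z
    proof -
      have "(of_real s)\<^sup>2 - cnj a * z = - (cnj a * (z - w))" using False by (simp add: w_def algebra_simps)
      then show ?thesis by (simp add: norm_mult)
    qed
    have "cmean 0 r (\<lambda>z. \<bar>ln (norm ((of_real s)\<^sup>2 - cnj a * (z + b)) / s) - ln (norm ((of_real s)\<^sup>2 - cnj a * z) / s)\<bar>)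
        = cmean 0 r (\<lambda>z. \<bar>ln (norm (z + b - w)) - ln (norm (z - w))\<bar>)"
    proof (rule cmean_cong)
      fix z assume z: "z \<in> sphere (0::complex) r"
      have "norm (z + b - w) > 0" "norm (z - w) > 0" using ne(3,4)[OF z] ws by auto
      then show "\<bar>ln (norm ((of_real s)\<^sup>2 - cnj a * (z + b)) / s) - ln (norm ((of_real s)\<^sup>2 - cnj a * z) / s)\<bar>
        = \<bar>ln (norm (z + b - w)) - ln (norm (z - w))\<bar>"
        unfolding e using False s0 by (simp add: ln_div ln_mult)
    qed (use r in simp)
    also have "\<dots> \<le> ?K"
    proof (rule mean_ln_shift[OF d r(1)])
      show "norm w \<noteq> r" using ws s norm_ge_zero[of b] by linarith
      show "norm (w - b) \<noteq> r" using ws s norm_triangle_ineq2[of w b] by linarith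
    qed
    finally show ?thesis .
  qed
  have "cmean 0 r (\<lambda>z. \<bar>green s a (z + b) - green s a z\<bar>)
     \<le> cmean 0 r (\<lambda>z. \<bar>ln (norm ((of_real s)\<^sup>2 - cnj a * (z + b)) / s) - ln (norm ((of_real s)\<^sup>2 - cnj a * z) / s)\<bar>
           + \<bar>ln (norm (z + b - a)) - ln (norm (z - a))\<bar>)"
    using r by (intro cmean_mono c3 continuous_on_add c1 c2) (auto simp: green_def)
  also have "\<dots> \<le> ?K + ?K"
  proof -
    have "cmean 0 r (\<lambda>z. \<bar>ln (norm (z + b - a)) - ln (norm (z - a))\<bar>) \<le> ?K"
      by (rule mean_ln_shift[OF d r])
    then show ?thesis unfolding cmean_add[OF c2 c1 less_imp_le[OF r(1)]] by (rule add_mono[OF 2])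
  qed
  finally show "cmean 0 r (\<lambda>z. \<bar>green s a (z + b) - green s a z\<bar>) \<le> 8 * norm b powr d / d * (circle_const d / (2*pi)) * r powr (-d)"
    by (simp add: mult_ac)
qed

text \<open>The difference of the kernels is the real part of
  \<open>2 * \<zeta> * b / ((\<zeta> - (z + b)) * (\<zeta> - z))\<close>, and
  \<open>\<zeta> - (z + b)\<close> has at least half the modulus of \<open>\<zeta> - z\<close>. The
  bound is relative to the kernel, not uniform, so that averaging over \<open>z\<close> later costs
  nothing.\<close>

lemma poisson_shift:
  assumes z: "norm z = r" and \<zeta>: "norm \<zeta> = s" and b: "2 * norm b \<le> s - r" and rs: "r < s"
  shows "\<bar>poisson (z + b) \<zeta> - poisson z \<zeta>\<bar> \<le> 4 * s * norm b / (s\<^sup>2 - r\<^sup>2) * poisson z \<zeta>"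
proof -
  have n1: "s - r \<le> norm (\<zeta> - z)" using norm_triangle_ineq2[of \<zeta> z] z \<zeta> by simp
  have n2: "norm (\<zeta> - z) / 2 \<le> norm (\<zeta> - (z + b))"
    using norm_triangle_ineq2[of "\<zeta> - z" b] n1 b by (simp add: algebra_simps)
  have pos: "0 < norm (\<zeta> - z)" "0 < norm (\<zeta> - (z + b))" using n1 n2 rs by linarith+
  then have ne: "\<zeta> - z \<noteq> 0" "\<zeta> - (z + b) \<noteq> 0" by auto
  have "(\<zeta> + (z + b)) / (\<zeta> - (z + b)) - (\<zeta> + z) / (\<zeta> - z) = 2 * \<zeta> * b / ((\<zeta> - (z + b)) * (\<zeta> - z))"
    using ne by (simp add: diff_frac_eq) (simp add: algebra_simps)
  then have "poisson (z + b) \<zeta> - poisson z \<zeta> = Re (2 * \<zeta> * b / ((\<zeta> - (z + b)) * (\<zeta> - z)))"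
    unfolding poisson_def by (metis minus_complex.sel(1))
  then have "\<bar>poisson (z + b) \<zeta> - poisson z \<zeta>\<bar> \<le> norm (2 * \<zeta> * b / ((\<zeta> - (z + b)) * (\<zeta> - z)))"
    using abs_Re_le_cmod by metis
  also have "\<dots> = 2 * s * norm b / (norm (\<zeta> - (z + b)) * norm (\<zeta> - z))"
    using \<zeta> by (simp add: norm_mult norm_divide)
  also have "\<dots> \<le> 2 * s * norm b / ((norm (\<zeta> - z) / 2) * norm (\<zeta> - z))"
    using n2 pos \<zeta> norm_ge_zero[of \<zeta>] by (intro divide_left_mono mult_right_mono mult_pos_pos) auto
  also have "\<dots> = 4 * s * norm b / (s\<^sup>2 - r\<^sup>2) * poisson z \<zeta>"
  proof -
    have "0 \<le> r" using z norm_ge_zero[of z] by simp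
    then have "r\<^sup>2 < s\<^sup>2" using rs by (intro power_strict_mono) auto
    then show ?thesis using ne z \<zeta> by (subst poisson_eq) (auto simp: power2_eq_square)
  qed
  finally show ?thesis .
qed


lemma cmean_abs:
  assumes "continuous_on (sphere b r) \<phi>" "r \<ge> 0"
  shows "\<bar>cmean b r \<phi>\<bar> \<le> cmean b r (\<lambda>z. \<bar>\<phi> z\<bar>)"
proof -
  have "cmean b r \<phi> \<le> cmean b r (\<lambda>z. \<bar>\<phi> z\<bar>)" "cmean b r (\<lambda>z. - \<phi> z) \<le> cmean b r (\<lambda>z. \<bar>\<phi> z\<bar>)"
    using assms by (auto intro!: cmean_mono continuous_intros)
  then show ?thesis by (simp add: cmean_minus)
qed

lemma Poisson_Jensen_shift:
  assumes F: "entire_nz F" and good: "\<And>\<zeta>. norm \<zeta> = s \<Longrightarrow> F \<zeta> \<noteq> 0"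
    and z: "norm z < s" "F z \<noteq> 0" "norm (z + b) < s" "F (z + b) \<noteq> 0"
  shows "ln (norm (F (z + b))) - ln (norm (F z)) = cmean 0 s (\<lambda>\<zeta>. (poisson (z + b) \<zeta> - poisson z \<zeta>) * ln (norm (F \<zeta>)))
           - (\<Sum>a\<in>zeros_in F s. real (zmult F a) * (green s a (z + b) - green s a z))"
proof -
  have s0: "s \<ge> 0" using z by (meson norm_ge_zero order_less_imp_le order_le_less_trans)
  have c: "continuous_on (sphere 0 s) (\<lambda>\<zeta>. ln (norm (F \<zeta>)))"
    using F good by (intro continuous_ln_norm) (auto simp: entire_nz_def)
  have "cmean 0 s (\<lambda>\<zeta>. (poisson (z + b) \<zeta> - poisson z \<zeta>) * ln (norm (F \<zeta>)))
      = cmean 0 s (\<lambda>\<zeta>. poisson (z + b) \<zeta> * ln (norm (F \<zeta>))) - cmean 0 s (\<lambda>\<zeta>. poisson z \<zeta> * ln (norm (F \<zeta>)))"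
    unfolding left_diff_distrib by (intro cmean_diff continuous_on_mult poisson_continuous c z s0)
  then show ?thesis
    using Poisson_Jensen[OF F good z(1,2)] Poisson_Jensen[OF F good z(3,4)]
    by (simp add: sum_subtractf right_diff_distrib)
qed

text \<open>Subtract the Poisson--Jensen formulas at \<open>z + b\<close> and \<open>z\<close>.
  Zeros are bounded one by one by \<open>mean_green_shift\<close>; the boundary integral is bounded
  relatively by \<open>poisson_shift\<close>, and averaging over \<open>z\<close> first turns the
  kernel into its value 1 at the centre.\<close>

lemma mean_shift_quotient:
  assumes F: "entire_nz F" and G: "entire_nz G" and d: "0 < d" "d < 1"
    and r: "0 < r" "r < s" "r + norm b < s" "2 * norm b \<le> s - r"
    and good_r: "\<And>z. norm z = r \<Longrightarrow> F z \<noteq> 0 \<and> G z \<noteq> 0 \<and> F (z + b) \<noteq> 0 \<and> G (z + b) \<noteq> 0"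
    and good_s: "\<And>\<zeta>. norm \<zeta> = s \<Longrightarrow> F \<zeta> \<noteq> 0 \<and> G \<zeta> \<noteq> 0"
  defines "\<Lambda> \<equiv> \<lambda>\<zeta>. ln (norm (F \<zeta>)) - ln (norm (G \<zeta>))"
  shows "cmean 0 r (\<lambda>z. \<bar>\<Lambda> (z + b) - \<Lambda> z\<bar>)
     \<le> 4 * s * norm b / (s\<^sup>2 - r\<^sup>2) * cmean 0 s (\<lambda>\<zeta>. \<bar>\<Lambda> \<zeta>\<bar>)
       + 8 * norm b powr d / d * (circle_const d / (2*pi)) * r powr (-d) * (zcount F s + zcount G s)"
    and "continuous_on (sphere 0 r) (\<lambda>z. \<bar>\<Lambda> (z + b) - \<Lambda> z\<bar>)"
proof -
  define \<kappa> where "\<kappa> = 4 * s * norm b / (s\<^sup>2 - r\<^sup>2)"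
  define K where "K = 8 * norm b powr d / d * (circle_const d / (2*pi)) * r powr (-d)"
  define W where "W H z = (\<Sum>a\<in>zeros_in H s. real (zmult H a) * \<bar>green s a (z + b) - green s a z\<bar>)" for H z
  have r2: "r\<^sup>2 < s\<^sup>2" using r by (intro power_strict_mono) auto
  have \<kappa>: "\<kappa> \<ge> 0" unfolding \<kappa>_def using r r2 by simp
  have hF: "F holomorphic_on UNIV" and hG: "G holomorphic_on UNIV" using F G by (auto simp: entire_nz_def)
  have hFb: "(\<lambda>z. F (z + b)) holomorphic_on UNIV" and hGb: "(\<lambda>z. G (z + b)) holomorphic_on UNIV"
    by (rule holomorphic_on_compose_gen[OF _ hF, of "\<lambda>z. z + b" UNIV, unfolded o_def]
             holomorphic_on_compose_gen[OF _ hG, of "\<lambda>z. z + b" UNIV, unfolded o_def];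
        auto intro!: holomorphic_intros)+
  have c\<Lambda>: "continuous_on (sphere 0 s) \<Lambda>"
    unfolding \<Lambda>_def using good_s by (intro continuous_on_diff continuous_ln_norm hF hG) auto
  have c\<Lambda>r: "continuous_on (sphere 0 r) (\<lambda>z. \<Lambda> (z + b) - \<Lambda> z)"
    unfolding \<Lambda>_def using good_r
    by (intro continuous_on_diff continuous_ln_norm hF hG continuous_ln_norm[OF hFb] continuous_ln_norm[OF hGb]) auto
  then show "continuous_on (sphere 0 r) (\<lambda>z. \<bar>\<Lambda> (z + b) - \<Lambda> z\<bar>)" by (rule continuous_on_rabs)
  have cP: "continuous_on (sphere 0 r \<times> sphere 0 s) (\<lambda>(z, \<zeta>). poisson z \<zeta> * \<bar>\<Lambda> \<zeta>\<bar>)"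
    unfolding case_prod_unfold poisson_def using r
    by (intro continuous_intros continuous_on_compose2[OF c\<Lambda>]) auto
  have green: "cmean 0 r (\<lambda>z. \<bar>green s a (z + b) - green s a z\<bar>) \<le> K"
    "continuous_on (sphere 0 r) (\<lambda>z. \<bar>green s a (z + b) - green s a z\<bar>)"
    if H: "H = F \<or> H = G" and a: "a \<in> zeros_in H s" for H a
  proof -
    have Ha: "H a = 0" "norm a \<le> s" using a by (auto simp: zeros_in_def)
    have "norm a \<noteq> s" "norm a \<noteq> r" using good_s good_r H Ha by blast+
    moreover have "norm (a - b) \<noteq> r" using good_r[of "a - b"] H Ha by auto
    ultimately show "cmean 0 r (\<lambda>z. \<bar>green s a (z + b) - green s a z\<bar>) \<le> K"
      "continuous_on (sphere 0 r) (\<lambda>z. \<bar>green s a (z + b) - green s a z\<bar>)"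
      unfolding K_def using mean_green_shift[OF d r(1), of a b s] r Ha by auto
  qed
  have cW: "continuous_on (sphere 0 r) (W H)" if "H = F \<or> H = G" for H
    unfolding W_def by (intro continuous_on_sum continuous_on_mult continuous_on_const green[OF that])
  have W: "cmean 0 r (W H) \<le> K * zcount H s" if H: "H = F \<or> H = G" for H
  proof -
    have "finite (zeros_in H s)" using H F G finite_zeros_in by blast
    then have "cmean 0 r (W H) = (\<Sum>a\<in>zeros_in H s. cmean 0 r (\<lambda>z. real (zmult H a) * \<bar>green s a (z + b) - green s a z\<bar>))"
      unfolding W_def using r by (intro cmean_sum continuous_on_mult continuous_on_const green[OF H]) auto
    also have "\<dots> \<le> (\<Sum>a\<in>zeros_in H s. real (zmult H a) * K)"
      unfolding cmean_cmult by (intro sum_mono mult_left_mono green[OF H]) auto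
    finally show ?thesis by (simp add: zcount_def sum_distrib_left mult.commute)
  qed
  define Q where "Q z = cmean 0 s (\<lambda>\<zeta>. poisson z \<zeta> * \<bar>\<Lambda> \<zeta>\<bar>)" for z
  have cQ: "continuous_on (sphere 0 r) Q"
    unfolding Q_def using cmean_continuous[OF cP] r by simp
  have point: "\<bar>\<Lambda> (z + b) - \<Lambda> z\<bar> \<le> \<kappa> * Q z + (W F z + W G z)" if z: "norm z = r" for z
  proof -
    have zs: "norm z < s" "norm (z + b) < s" using z r norm_triangle_ineq[of z b] by auto
    define D where "D = (\<lambda>\<zeta>. poisson (z + b) \<zeta> - poisson z \<zeta>)"
    have cD: "continuous_on (sphere 0 s) D"
      unfolding D_def by (intro continuous_on_diff poisson_continuous zs)
    have clF: "continuous_on (sphere 0 s) (\<lambda>\<zeta>. ln (norm (F \<zeta>)))" and clG: "continuous_on (sphere 0 s) (\<lambda>\<zeta>. ln (norm (G \<zeta>)))"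
      using good_s by (auto intro!: continuous_ln_norm hF hG)
    have eF: "ln (norm (F (z + b))) - ln (norm (F z)) = cmean 0 s (\<lambda>\<zeta>. D \<zeta> * ln (norm (F \<zeta>)))
           - (\<Sum>a\<in>zeros_in F s. real (zmult F a) * (green s a (z + b) - green s a z))"
      unfolding D_def using good_r[OF z] good_s zs by (intro Poisson_Jensen_shift F) auto
    have eG: "ln (norm (G (z + b))) - ln (norm (G z)) = cmean 0 s (\<lambda>\<zeta>. D \<zeta> * ln (norm (G \<zeta>)))
           - (\<Sum>a\<in>zeros_in G s. real (zmult G a) * (green s a (z + b) - green s a z))"
      unfolding D_def using good_r[OF z] good_s zs by (intro Poisson_Jensen_shift G) auto
    \<comment> \<open>The boundary integrals of \<open>F\<close> and \<open>G\<close> are merged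
      before absolute values are taken, because only the difference \<open>\<Lambda>\<close> will
      have a controlled absolute mean.\<close>
    have "cmean 0 s (\<lambda>\<zeta>. D \<zeta> * \<Lambda> \<zeta>) = cmean 0 s (\<lambda>\<zeta>. D \<zeta> * ln (norm (F \<zeta>))) - cmean 0 s (\<lambda>\<zeta>. D \<zeta> * ln (norm (G \<zeta>)))"
      unfolding \<Lambda>_def right_diff_distrib using r
      by (intro cmean_diff continuous_on_mult cD clF clG) auto
    then have e: "\<Lambda> (z + b) - \<Lambda> z = cmean 0 s (\<lambda>\<zeta>. D \<zeta> * \<Lambda> \<zeta>)
       - (\<Sum>a\<in>zeros_in F s. real (zmult F a) * (green s a (z + b) - green s a z))
       + (\<Sum>a\<in>zeros_in G s. real (zmult G a) * (green s a (z + b) - green s a z))"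
      using eF eG unfolding \<Lambda>_def by simp
    have sW: "\<bar>\<Sum>a\<in>zeros_in H s. real (zmult H a) * (green s a (z + b) - green s a z)\<bar> \<le> W H z" for H
      unfolding W_def by (rule order_trans[OF sum_abs]) (simp add: abs_mult)
    have "\<bar>cmean 0 s (\<lambda>\<zeta>. D \<zeta> * \<Lambda> \<zeta>)\<bar> \<le> cmean 0 s (\<lambda>\<zeta>. \<bar>D \<zeta> * \<Lambda> \<zeta>\<bar>)"
      using r by (intro cmean_abs continuous_on_mult cD c\<Lambda>) auto
    also have "\<dots> \<le> cmean 0 s (\<lambda>\<zeta>. \<kappa> * (poisson z \<zeta> * \<bar>\<Lambda> \<zeta>\<bar>))"
    proof (rule cmean_mono)
      fix \<zeta> assume "\<zeta> \<in> sphere (0::complex) s"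
      then have "\<bar>D \<zeta>\<bar> \<le> \<kappa> * poisson z \<zeta>"
        unfolding D_def \<kappa>_def using z r by (intro poisson_shift) auto
      then show "\<bar>D \<zeta> * \<Lambda> \<zeta>\<bar> \<le> \<kappa> * (poisson z \<zeta> * \<bar>\<Lambda> \<zeta>\<bar>)"
        unfolding abs_mult mult.assoc[symmetric] by (rule mult_right_mono) simp
    qed (use r in \<open>auto intro!: continuous_intros cD c\<Lambda> poisson_continuous zs\<close>)
    also have "\<dots> = \<kappa> * Q z" unfolding Q_def by (rule cmean_cmult)
    finally show ?thesis using sW[of F] sW[of G] unfolding e by linarith
  qed
  have "cmean 0 r (\<lambda>z. \<bar>\<Lambda> (z + b) - \<Lambda> z\<bar>) \<le> cmean 0 r (\<lambda>z. \<kappa> * Q z + (W F z + W G z))"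
    using r by (intro cmean_mono continuous_on_add continuous_on_mult continuous_on_const cQ cW point)
       (use c\<Lambda>r in \<open>auto intro: continuous_on_rabs\<close>)
  also have "\<dots> = \<kappa> * cmean 0 r Q + (cmean 0 r (W F) + cmean 0 r (W G))"
  proof -
    have "cmean 0 r (\<lambda>z. \<kappa> * Q z + (W F z + W G z)) = cmean 0 r (\<lambda>z. \<kappa> * Q z) + cmean 0 r (\<lambda>z. W F z + W G z)"
      using r by (intro cmean_add continuous_on_add continuous_on_mult continuous_on_const cQ cW) auto
    also have "cmean 0 r (\<lambda>z. W F z + W G z) = cmean 0 r (W F) + cmean 0 r (W G)"
      using r by (intro cmean_add cW) auto
    finally show ?thesis by (simp add: cmean_cmult)
  qed
  also have "cmean 0 r Q = cmean 0 s (\<lambda>\<zeta>. cmean 0 r (\<lambda>z. poisson z \<zeta> * \<bar>\<Lambda> \<zeta>\<bar>))"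
    unfolding Q_def using r by (intro cmean_swap cP) auto
  also have "\<dots> = cmean 0 s (\<lambda>\<zeta>. \<bar>\<Lambda> \<zeta>\<bar>)"
  proof (rule cmean_cong)
    fix \<zeta> assume \<zeta>: "\<zeta> \<in> sphere (0::complex) s"
    then have "cmean 0 r (\<lambda>z. poisson z \<zeta>) = poisson 0 \<zeta>" using r by (intro cmean_poisson) auto
    moreover have "\<zeta> \<noteq> 0" using \<zeta> r by auto
    ultimately show "cmean 0 r (\<lambda>z. poisson z \<zeta> * \<bar>\<Lambda> \<zeta>\<bar>) = \<bar>\<Lambda> \<zeta>\<bar>"
      by (simp add: mult.commute[of _ "\<bar>\<Lambda> \<zeta>\<bar>"] cmean_cmult)
  qed (use r in simp)
  also have "\<kappa> * cmean 0 s (\<lambda>\<zeta>. \<bar>\<Lambda> \<zeta>\<bar>) + (cmean 0 r (W F) + cmean 0 r (W G))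
     \<le> \<kappa> * cmean 0 s (\<lambda>\<zeta>. \<bar>\<Lambda> \<zeta>\<bar>) + K * (zcount F s + zcount G s)"
    using W[of F] W[of G] by (simp add: algebra_simps)
  finally show "cmean 0 r (\<lambda>z. \<bar>\<Lambda> (z + b) - \<Lambda> z\<bar>)
     \<le> 4 * s * norm b / (s\<^sup>2 - r\<^sup>2) * cmean 0 s (\<lambda>\<zeta>. \<bar>\<Lambda> \<zeta>\<bar>)
       + 8 * norm b powr d / d * (circle_const d / (2*pi)) * r powr (-d) * (zcount F s + zcount G s)"
    unfolding \<kappa>_def K_def .
qed

text \<open>In the difference of the two Jensen formulas a zero \<open>a\<close> contributes at most
  \<open>norm b / norm (a - b)\<close>. Zeros up to the fixed radius \<open>K\<close> give a
  constant; those up to \<open>r / 2\<close> have a weight made small by \<open>K\<close>; the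
  remaining ones may be numerous but carry a weight of order \<open>1 / r\<close>.\<close>

lemma mean_shift_center:
  assumes G: "entire_nz G" "G 0 \<noteq> 0" "G b \<noteq> 0"
    and r: "0 < r" and good: "\<And>z. norm z = r \<Longrightarrow> G z \<noteq> 0 \<and> G (z + b) \<noteq> 0"
    and K: "2 * norm b \<le> K" "0 < K" "2 * K \<le> r"
  shows "cmean b r (\<lambda>z. ln (norm (G z))) - cmean 0 r (\<lambda>z. ln (norm (G z)))
    \<le> ln (norm (G b)) - ln (norm (G 0)) + (\<Sum>a\<in>zeros_in G K. real (zmult G a) * (norm b / norm (a - b)))
      + 2 * norm b / K * zcount G (r / 2) + 4 * norm b / r * zcount G (r + norm b + 1)"
proof -
  let ?S = "r + norm b + 1" and ?m = "zmult G"
  let ?A = "zeros_in G ?S"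
  have fin: "finite ?A" using finite_zeros_in[OF G(1)] .
  obtain H where H: "entire_nz H" "\<And>z. norm z \<le> ?S \<Longrightarrow> H z \<noteq> 0"
    "\<And>z. G z = (\<Prod>a\<in>?A. (z - a) ^ ?m a) * H z"
    using entire_factor_zeros[OF G(1)] by blast
  have Hh: "H holomorphic_on UNIV" using H by (simp add: entire_nz_def)
  have m: "?m a \<noteq> 0" if "a \<in> ?A" for a using zmult_pos[OF G(1)] that by (auto simp: zeros_in_def)
  have b: "G z \<noteq> 0" if "z \<in> sphere b r" for z
    using good[of "z - b"] that by (auto simp: dist_norm norm_minus_commute)
  have mb: "cmean b r (\<lambda>z. ln (norm (G z))) = (\<Sum>a\<in>?A. real (?m a) * ln (max r (norm (a - b)))) + ln (norm (H b))"
    using mean_ln_factor[OF Hh H(2) fin H(3) b r _ m] by auto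
  have m0: "cmean 0 r (\<lambda>z. ln (norm (G z))) = (\<Sum>a\<in>?A. real (?m a) * ln (max r (norm a))) + ln (norm (H 0))"
    using mean_ln_factor[where b = 0 and S = ?S and F = G and G = H and m = ?m, OF Hh H(2) fin H(3) _ r _ m] good
    by (simp add: add_nonneg_pos)
  have lb: "ln (norm (G b)) = (\<Sum>a\<in>?A. real (?m a) * ln (norm (a - b))) + ln (norm (H b))"
    using ln_norm_factor[where F = G and G = H and m = ?m, OF H(3) G(3) fin] by (simp add: norm_minus_commute)
  have l0: "ln (norm (G 0)) = (\<Sum>a\<in>?A. real (?m a) * ln (norm a)) + ln (norm (H 0))"
    using ln_norm_factor[where F = G and G = H and m = ?m, OF H(3) G(2) fin] by simp
  define w where "w a = (if norm a \<le> K then norm b / norm (a - b) else 0)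
      + (if norm a \<le> r / 2 then 2 * norm b / K else 0) + 4 * norm b / r" for a
  have "cmean b r (\<lambda>z. ln (norm (G z))) - cmean 0 r (\<lambda>z. ln (norm (G z))) - (ln (norm (G b)) - ln (norm (G 0)))
    = (\<Sum>a\<in>?A. real (?m a) * (ln (max r (norm (a - b))) - ln (norm (a - b)) - (ln (max r (norm a)) - ln (norm a))))"
    unfolding mb m0 lb l0 by (simp add: sum_subtractf right_diff_distrib)
  also have "\<dots> \<le> (\<Sum>a\<in>?A. real (?m a) * w a)"
  proof (intro sum_mono mult_left_mono)
    fix a assume a: "a \<in> ?A"
    define x y where "x = norm (a - b)" and "y = norm a"
    have xy: "x > 0" "y > 0" using a G by (auto simp: zeros_in_def x_def y_def)
    have yx: "y \<le> x + norm b" unfolding x_def y_def using norm_triangle_ineq[of "a - b" b] by simp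
    have "ln (max r x) - ln x - (ln (max r y) - ln y) \<le> ln (1 + norm b / x)"
    proof -
      have "max r x * y \<le> (x + norm b) * max r y"
        using xy yx r by (auto simp: max_def intro: mult_mono)
      then have "max r x / x * (y / max r y) \<le> (x + norm b) / x"
        using xy r by (simp add: divide_simps max_def mult.commute split: if_splits)
      then have "ln (max r x / x * (y / max r y)) \<le> ln ((x + norm b) / x)"
        using xy r by (intro ln_mono) (auto simp: max_def)
      moreover have "ln (max r x / x * (y / max r y)) = ln (max r x) - ln x - (ln (max r y) - ln y)"
      proof -
        have "max r x > 0" "max r y > 0" using r by auto
        then show ?thesis using xy by (simp add: ln_mult_pos ln_divide_pos)
      qed
      moreover have "(x + norm b) / x = 1 + norm b / x" using xy by (simp add: field_simps)
      ultimately show ?thesis by simp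
    qed
    also have "\<dots> \<le> norm b / x" using xy by (intro ln_add_one_self_le_self) auto
    also have "\<dots> \<le> w a"
    proof -
      have p: "0 \<le> norm b / x" "0 \<le> 2 * norm b / K" "0 \<le> 4 * norm b / r" using xy K r by auto
      have big: "norm b / x \<le> 2 * norm b / y" if "2 * norm b \<le> y"
      proof -
        have "y / 2 \<le> x" using yx that by simp
        then have "norm b / x \<le> norm b / (y / 2)" using xy by (intro divide_left_mono) auto
        then show ?thesis by (simp add: mult.commute)
      qed
      consider "y \<le> K" | "K < y" "y \<le> r / 2" | "r / 2 < y" by linarith
      then show ?thesis
      proof cases
        case 1
        then show ?thesis using p unfolding w_def x_def[symmetric] y_def[symmetric] by auto
      next
        case 2
        have "norm b / x \<le> 2 * norm b / y" using 2 K by (intro big) auto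
        also have "\<dots> \<le> 2 * norm b / K" using 2 K xy by (intro divide_left_mono) auto
        finally show ?thesis using 2 p unfolding w_def x_def[symmetric] y_def[symmetric] by auto
      next
        case 3
        have "norm b / x \<le> 2 * norm b / y" using 3 K by (intro big) auto
        also have "\<dots> \<le> 2 * norm b / (r / 2)" using 3 r xy by (intro divide_left_mono) auto
        finally show ?thesis using p unfolding w_def x_def[symmetric] y_def[symmetric] by auto
      qed
    qed
    finally show "ln (max r (norm (a - b))) - ln (norm (a - b)) - (ln (max r (norm a)) - ln (norm a)) \<le> w a"
      unfolding x_def y_def .
  qed auto
  also have "\<dots> = (\<Sum>a\<in>?A. if norm a \<le> K then real (?m a) * (norm b / norm (a - b)) else 0)
      + (\<Sum>a\<in>?A. if norm a \<le> r / 2 then 2 * norm b / K * real (?m a) else 0) + (\<Sum>a\<in>?A. 4 * norm b / r * real (?m a))"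
    unfolding sum.distrib[symmetric] w_def by (intro sum.cong) (auto simp: algebra_simps)
  also have "(\<Sum>a\<in>?A. if norm a \<le> K then real (?m a) * (norm b / norm (a - b)) else 0)
     = (\<Sum>a\<in>zeros_in G K. real (?m a) * (norm b / norm (a - b)))"
  proof -
    have "K \<le> ?S" using K norm_ge_zero[of b] by linarith
    then have "zeros_in G K \<subseteq> ?A" by (auto simp: zeros_in_def)
    then show ?thesis using fin by (intro sum.mono_neutral_cong_right) (auto simp: zeros_in_def)
  qed
  also have "(\<Sum>a\<in>?A. if norm a \<le> r / 2 then 2 * norm b / K * real (?m a) else 0) = 2 * norm b / K * zcount G (r / 2)"
  proof -
    have "r / 2 \<le> ?S" using r norm_ge_zero[of b] by linarith
    then have "zeros_in G (r / 2) \<subseteq> ?A" by (auto simp: zeros_in_def)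
    then show ?thesis unfolding zcount_def sum_distrib_left using fin
      by (intro sum.mono_neutral_cong_right) (auto simp: zeros_in_def)
  qed
  also have "(\<Sum>a\<in>?A. 4 * norm b / r * real (?m a)) = 4 * norm b / r * zcount G ?S"
    unfolding zcount_def sum_distrib_left ..
  finally show ?thesis by simp
qed

section \<open>The characteristic function of a curve\<close>

lemma hyper_order_less_1D:
  assumes "hyper_order X < 1"
  shows "\<exists>\<sigma>. 0 < \<sigma> \<and> \<sigma> < 1 \<and> (\<forall>\<^sub>F r in at_top. X r \<le> exp (r powr \<sigma>))"
proof -
  obtain y where y: "hyper_order X < ereal y" "ereal y < 1"
    using ereal_dense2[OF assms] by auto
  \<comment> \<open>The maximum with 1/2 keeps \<open>\<sigma>\<close> positive even if the
    hyper-order is 0.\<close>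
  define \<sigma> where "\<sigma> = max y (1/2)"
  have \<sigma>: "0 < \<sigma>" "\<sigma> < 1" "y \<le> \<sigma>" using y by (auto simp: \<sigma>_def)
  have "\<forall>\<^sub>F r in at_top. ereal (log_plus (log_plus (X r)) / ln r) < ereal y"
    using Limsup_lessD[OF y(1)[unfolded hyper_order_def]] by simp
  then have "\<forall>\<^sub>F r in at_top. X r \<le> exp (r powr \<sigma>)"
    using eventually_gt_at_top[of 1]
  proof eventually_elim
    case (elim r)
    have *: "x \<le> exp y" if "log_plus x \<le> y" for x y
    proof -
      have "exp (ln (max 1 x)) \<le> exp y" using that by (simp only: log_plus_def exp_le_cancel_iff)
      moreover have "0 < max 1 x" by simp
      ultimately show ?thesis by (simp only: exp_ln max.bounded_iff)
    qed
    have "log_plus (log_plus (X r)) \<le> y * ln r" using elim by (simp add: field_simps)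
    also have "\<dots> \<le> \<sigma> * ln r" using elim \<sigma> by (intro mult_right_mono) auto
    finally have "log_plus (X r) \<le> exp (\<sigma> * ln r)" using * by blast
    also have "\<dots> = r powr \<sigma>" using elim by (simp add: powr_def)
    finally show ?case using * by blast
  qed
  then show ?thesis using \<sigma> by blast
qed

lemma hyper_order_less_1I:
  assumes "0 < \<sigma>" "\<sigma> < 1" and "\<forall>\<^sub>F r in at_top. X r \<le> exp (r powr \<sigma>)"
  shows "hyper_order X < 1"
proof -
  have "\<forall>\<^sub>F r in at_top. ereal (log_plus (log_plus (X r)) / ln r) \<le> ereal \<sigma>"
    using assms(3) eventually_gt_at_top[of 1]
  proof eventually_elim
    case (elim r)
    have "log_plus (X r) \<le> ln (exp (r powr \<sigma>))"
      unfolding log_plus_def using elim by (intro ln_mono) auto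
    moreover have "1 \<le> r powr \<sigma>" using elim assms by (simp add: ge_one_powr_ge_zero)
    ultimately have "log_plus (log_plus (X r)) \<le> ln (r powr \<sigma>)"
      unfolding log_plus_def[of "log_plus (X r)"] by (intro ln_mono) auto
    also have "\<dots> = \<sigma> * ln r" using elim by (simp add: ln_powr)
    finally show ?case using elim by (simp add: field_simps)
  qed
  then have "hyper_order X \<le> ereal \<sigma>" unfolding hyper_order_def by (rule Limsup_bounded)
  also have "\<dots> < 1" using assms by simp
  finally show ?thesis .
qed

text \<open>On the scale \<open>exp (r powr \<sigma>)\<close> a linear factor and a dilation are
  absorbed by any larger exponent; the midpoint of \<open>\<sigma>\<close> and 1 is still below
  1.\<close>

lemma exp_powr_absorb:
  fixes \<sigma> C A :: real
  assumes "0 < \<sigma>" "\<sigma> < 1" "C > 0" "A > 0"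
  shows "\<forall>\<^sub>F r in at_top. C * r * exp ((A * r) powr \<sigma>) \<le> exp (r powr ((1 + \<sigma>) / 2))"
proof -
  define \<tau> where "\<tau> = (1 + \<sigma>) / 2"
  have \<tau>: "\<sigma> < \<tau>" "0 < \<tau>" using assms by (auto simp: \<tau>_def)
  have 1: "((\<lambda>r. (ln C + ln r) / r powr \<tau>) \<longlongrightarrow> 0) at_top" using \<tau>(2) by real_asymp
  have 2: "((\<lambda>r. A powr \<sigma> * r powr (\<sigma> - \<tau>)) \<longlongrightarrow> 0) at_top"
    using \<tau> by (intro tendsto_mult_right_zero tendsto_neg_powr filterlim_ident) auto
  have "((\<lambda>r. (ln C + ln r) / r powr \<tau> + A powr \<sigma> * r powr (\<sigma> - \<tau>)) \<longlongrightarrow> 0 + 0) at_top"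
    by (intro tendsto_add 1 2)
  then have "\<forall>\<^sub>F r in at_top. (ln C + ln r) / r powr \<tau> + A powr \<sigma> * r powr (\<sigma> - \<tau>) < 1"
    by (rule order_tendstoD) auto
  then show ?thesis using eventually_gt_at_top[of 0]
  proof eventually_elim
    case (elim r)
    define w where "w = r powr \<tau>"
    have w: "w > 0" "r powr (\<sigma> - \<tau>) = r powr \<sigma> / w" using elim by (simp_all add: w_def powr_diff)
    have "(ln C + ln r) / w + A powr \<sigma> * (r powr \<sigma> / w) \<le> 1"
      using elim w by (simp add: w_def)
    then have "(ln C + ln r + A powr \<sigma> * r powr \<sigma>) / w \<le> 1" by (simp add: add_divide_distrib)
    then have "ln C + ln r + A powr \<sigma> * r powr \<sigma> \<le> w" using w by (simp add: pos_divide_le_eq)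
    then have "ln C + ln r + (A * r) powr \<sigma> \<le> r powr \<tau>"
      using elim assms by (simp add: w_def powr_mult)
    then have "exp (ln C + ln r + (A * r) powr \<sigma>) \<le> exp (r powr \<tau>)" by simp
    then show ?case using elim assms by (simp add: exp_add \<tau>_def)
  qed
qed

lemma continuous_on_Max_image:
  fixes f :: "'i \<Rightarrow> 'a :: topological_space \<Rightarrow> real"
  assumes "finite K" "K \<noteq> {}" "\<And>k. k \<in> K \<Longrightarrow> continuous_on A (f k)"
  shows "continuous_on A (\<lambda>z. Max ((\<lambda>k. f k z) ` K))"
  using assms
proof (induction K rule: finite_ne_induct)
  case (insert k K)
  have "(\<lambda>z. Max ((\<lambda>k. f k z) ` insert k K)) = (\<lambda>z. max (f k z) (Max ((\<lambda>k. f k z) ` K)))"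
    using insert by simp
  then show ?case using insert by (simp only:) (intro continuous_on_max; simp)
qed simp

text \<open>The bad radii are countable, an open interval is not.\<close>

lemma good_radius_exists:
  assumes "finite H" "\<And>F. F \<in> H \<Longrightarrow> entire_nz F" "x < y"
  shows "\<exists>r. x < r \<and> r < y \<and> (\<forall>F\<in>H. \<forall>z\<in>sphere b r. F z \<noteq> 0)"
proof -
  have "countable (\<Union>F\<in>H. {r. \<exists>z\<in>sphere b r. F z = 0})"
    by (rule countable_UN[OF countable_finite[OF assms(1)] countable_bad_radii[OF assms(2)]])
  moreover have "uncountable {x<..<y}" using assms uncountable_open_interval by simp
  ultimately have "\<not> {x<..<y} \<subseteq> (\<Union>F\<in>H. {r. \<exists>z\<in>sphere b r. F z = 0})"
    using countable_subset by blast
  then show ?thesis by fastforce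
qed

locale curve =
  fixes n :: nat and g :: "nat \<Rightarrow> complex \<Rightarrow> complex"
  assumes reduced: "reduced_representation n g"
begin

abbreviation "u \<equiv> cartan_u n g"
abbreviation "T \<equiv> cartan_T n g"

lemma g_hol: "k \<le> n \<Longrightarrow> g k holomorphic_on UNIV"
  using reduced by (simp add: reduced_representation_def)

lemma g_nonzero: "\<exists>k\<le>n. g k z \<noteq> 0"
  using reduced by (simp add: reduced_representation_def)

lemma u_attained: "\<exists>k\<le>n. g k z \<noteq> 0 \<and> u z = ln (norm (g k z))"
proof -
  let ?S = "(\<lambda>k. ln (norm (g k z))) ` {k. k \<le> n \<and> g k z \<noteq> 0}"
  have "finite ?S" "?S \<noteq> {}" using g_nonzero by auto
  then have "u z \<in> ?S" unfolding cartan_u_def by (rule Max_in)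
  then show ?thesis by auto
qed

lemma ln_g_le: "k \<le> n \<Longrightarrow> g k z \<noteq> 0 \<Longrightarrow> ln (norm (g k z)) \<le> u z"
  unfolding cartan_u_def by (intro Max_ge) auto

lemma norm_g_le: "k \<le> n \<Longrightarrow> norm (g k z) \<le> exp (u z)"
  using ln_g_le[of k z] by (cases "g k z = 0") (auto simp: ln_le_cancel_iff[symmetric] exp_ge_zero ln_ge_iff)

text \<open>The index set in \<open>cartan_u\<close> varies with \<open>z\<close>; here it is fixed,
  so continuity follows from that of the components.\<close>

lemma u_eq: "u z = ln (Max ((\<lambda>k. norm (g k z)) ` {..n}))"
proof -
  obtain k where k: "k \<le> n" "g k z \<noteq> 0" "u z = ln (norm (g k z))" using u_attained by blast
  then have e: "exp (u z) = norm (g k z)" by simp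
  have "Max ((\<lambda>k. norm (g k z)) ` {..n}) = exp (u z)"
  proof (rule Max_eqI)
    show "exp (u z) \<in> (\<lambda>k. norm (g k z)) ` {..n}" unfolding e using k by auto
  qed (auto simp: norm_g_le)
  then show ?thesis by simp
qed

lemma u_continuous: "continuous_on A u"
proof -
  have "continuous_on A (\<lambda>z. ln (Max ((\<lambda>k. norm (g k z)) ` {..n})))"
  proof (rule continuous_on_ln)
    show "continuous_on A (\<lambda>z. Max ((\<lambda>k. norm (g k z)) ` {..n}))"
      by (intro continuous_on_Max_image continuous_on_norm holomorphic_on_imp_continuous_on)
         (auto intro: holomorphic_on_subset g_hol)
    show "\<forall>z\<in>A. Max ((\<lambda>k. norm (g k z)) ` {..n}) \<noteq> 0"
    proof
      fix z
      obtain k where k: "k \<le> n" "g k z \<noteq> 0" using g_nonzero by blast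
      then have "0 < norm (g k z)" by simp
      also have "\<dots> \<le> Max ((\<lambda>k. norm (g k z)) ` {..n})" using k by (intro Max_ge) auto
      finally show "Max ((\<lambda>k. norm (g k z)) ` {..n}) \<noteq> 0" by (rule less_imp_neq[symmetric])
    qed
  qed
  then show ?thesis by (simp only: u_eq[symmetric])
qed

lemma T_eq: "T r = cmean 0 r u - u 0"
  by (simp add: cartan_T_def cmean_def)

lemma cmean_u_continuous: "continuous_on {0..R} (\<lambda>s. cmean 0 s u)"
proof -
  have "continuous_on ({0..R} \<times> cbox 0 (2*pi)) (\<lambda>(s, t). u (0 + of_real s * cis t))"
    unfolding case_prod_unfold
    by (rule continuous_on_compose2[OF u_continuous[of UNIV]]) (auto intro!: continuous_intros)
  from integral_continuous_on_param[OF this]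
  show ?thesis unfolding cmean_def by (intro continuous_intros) auto
qed

text \<open>Components that vanish identically are left out, since no circle avoids their
  zeros.\<close>

definition G_nz :: "(complex \<Rightarrow> complex) set" where
  "G_nz = {F. \<exists>k\<le>n. F = g k \<and> entire_nz F}"

lemma G_nz: "finite G_nz" "F \<in> G_nz \<Longrightarrow> entire_nz F"
  unfolding G_nz_def by (auto intro: finite_subset[of _ "g ` {..n}"])

text \<open>Subharmonicity of \<open>u\<close>: apply the inequality for one entire function to a
  component that attains the maximum at \<open>z\<close>.\<close>

lemma u_poisson:
  assumes good: "\<And>F z. F \<in> G_nz \<Longrightarrow> norm z = s \<Longrightarrow> F z \<noteq> 0" and z: "norm z < s"
  shows "u z \<le> cmean 0 s (\<lambda>\<zeta>. poisson z \<zeta> * u \<zeta>)"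
proof -
  obtain k where k: "k \<le> n" "g k z \<noteq> 0" "u z = ln (norm (g k z))" using u_attained by blast
  then have nz: "entire_nz (g k)" using g_hol by (auto simp: entire_nz_def)
  have gd: "g k \<zeta> \<noteq> 0" if "norm \<zeta> = s" for \<zeta> using good[of "g k" \<zeta>] that k nz by (auto simp: G_nz_def)
  show ?thesis unfolding k(3)
    by (rule Poisson_ineq[OF nz gd z k(2) u_continuous]) (use ln_g_le k gd in auto)
qed

text \<open>Average \<open>u_poisson\<close> over the circle about \<open>b\<close>, exchange the
  means and evaluate the kernel by \<open>cmean_poisson\<close>. The kernel at \<open>b\<close> need
  not be 1 for \<open>b \<noteq> 0\<close>, which is the difficulty in
  \<open>cmean_u_crude\<close>.\<close>

lemma cmean_u_poisson:
  assumes good: "\<And>F z. F \<in> G_nz \<Longrightarrow> norm z = s \<Longrightarrow> F z \<noteq> 0" and r: "0 < r" "norm b + r < s"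
  shows "cmean b r u \<le> cmean 0 s (\<lambda>\<zeta>. poisson b \<zeta> * u \<zeta>)"
proof -
  have s: "s > 0" using r norm_ge_zero[of b] by linarith
  have ns: "norm z < s" if "z \<in> sphere b r" for z
    using that r norm_triangle_ineq2[of z b] by (simp add: dist_norm norm_minus_commute)
  have cP: "continuous_on (sphere b r \<times> sphere 0 s) (\<lambda>(z, \<zeta>). poisson z \<zeta> * u \<zeta>)"
    unfolding case_prod_unfold poisson_def
    using ns by (intro continuous_intros continuous_on_compose2[OF u_continuous[of UNIV]]) force+
  have "cmean b r u \<le> cmean b r (\<lambda>z. cmean 0 s (\<lambda>\<zeta>. poisson z \<zeta> * u \<zeta>))"
    using r s by (intro cmean_mono u_continuous cmean_continuous[OF cP] u_poisson good ns) auto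
  also have "\<dots> = cmean 0 s (\<lambda>\<zeta>. cmean b r (\<lambda>z. poisson z \<zeta> * u \<zeta>))"
    using r s by (intro cmean_swap cP) auto
  also have "\<dots> = cmean 0 s (\<lambda>\<zeta>. poisson b \<zeta> * u \<zeta>)"
  proof (rule cmean_cong)
    fix \<zeta> assume "\<zeta> \<in> sphere (0::complex) s"
    then have "cmean b r (\<lambda>z. poisson z \<zeta>) = poisson b \<zeta>" using r by (intro cmean_poisson) auto
    then show "cmean b r (\<lambda>z. poisson z \<zeta> * u \<zeta>) = poisson b \<zeta> * u \<zeta>"
      by (simp add: mult.commute[of _ "u \<zeta>"] cmean_cmult)
  qed (use s in simp)
  finally show ?thesis .
qed

text \<open>Subharmonicity compares the circle of radius \<open>r\<close> with larger ones that
  avoid the zeros of the components. As \<open>s\<close> itself may be bad, it is approximated from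
  above by good radii, and the mean of \<open>u\<close> is continuous in the radius.\<close>

lemma T_mono:
  assumes "0 < r" "r \<le> s"
  shows "T r \<le> T s"
proof (cases "r = s")
  case False
  then have rs: "r < s" using assms by simp
  have "\<exists>s'. s < s' \<and> s' < s + 1 / real (Suc m) \<and> (\<forall>F\<in>G_nz. \<forall>z\<in>sphere 0 s'. F z \<noteq> 0)" for m
    using good_radius_exists[OF G_nz, of s "s + 1 / real (Suc m)"] by simp
  then have "\<exists>S. \<forall>m. s < S m \<and> S m < s + 1 / real (Suc m) \<and> (\<forall>F\<in>G_nz. \<forall>z\<in>sphere 0 (S m). F z \<noteq> 0)"
    by (intro choice allI)
  then obtain S where S0: "\<forall>m. s < S m \<and> S m < s + 1 / real (Suc m) \<and> (\<forall>F\<in>G_nz. \<forall>z\<in>sphere 0 (S m). F z \<noteq> 0)" ..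
  then have S: "\<And>m. s < S m" "\<And>m. S m < s + 1 / real (Suc m)"
    "\<And>m F z. F \<in> G_nz \<Longrightarrow> norm z = S m \<Longrightarrow> F z \<noteq> 0"
    by (blast, blast, simp)
  have lim: "S \<longlonglongrightarrow> s"
  proof (rule tendsto_sandwich[of "\<lambda>_. s" S sequentially "\<lambda>m. s + 1 / real (Suc m)"])
    show "(\<lambda>m. s + 1 / real (Suc m)) \<longlonglongrightarrow> s" by real_asymp
    show "\<forall>\<^sub>F m in sequentially. S m \<le> s + 1 / real (Suc m)"
      by (intro always_eventually allI less_imp_le S)
  qed (use S in \<open>auto intro!: always_eventually less_imp_le\<close>)
  have le: "cmean 0 r u \<le> cmean 0 (S m) u" for m
  proof -
    have "cmean 0 r u \<le> cmean 0 (S m) (\<lambda>\<zeta>. poisson 0 \<zeta> * u \<zeta>)"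
    proof (rule cmean_u_poisson)
      show "norm (0::complex) + r < S m" using rs S(1)[of m] by simp
    qed (use S assms in auto)
    also have "\<dots> = cmean 0 (S m) u"
    proof (rule cmean_cong)
      fix z assume "z \<in> sphere (0::complex) (S m)"
      then have "z \<noteq> 0" using S(1)[of m] assms by auto
      then show "poisson 0 z * u z = u z" by simp
    qed (use S(1)[of m] assms in simp)
    finally show ?thesis .
  qed
  have "(\<lambda>m. cmean 0 (S m) u) \<longlonglongrightarrow> cmean 0 s u"
  proof (rule continuous_on_tendsto_compose[OF cmean_u_continuous[of "s + 1"] lim])
    have "S m \<le> s + 1" for m
    proof -
      have "1 / real (Suc m) \<le> 1" by simp
      then show ?thesis using S(2)[of m] by linarith
    qed
    moreover have "0 \<le> S m" for m using S(1)[of m] assms by linarith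
    ultimately show "\<forall>\<^sub>F m in sequentially. S m \<in> {0..s + 1}"
      by (intro always_eventually) auto
  qed (use assms in auto)
  then have "cmean 0 r u \<le> cmean 0 s u" using le by (intro LIMSEQ_le_const) auto
  then show ?thesis by (simp add: T_eq)
qed simp

section \<open>Linear combinations of the components\<close>

definition lincomb :: "(nat \<Rightarrow> complex) \<Rightarrow> complex \<Rightarrow> complex" where
  "lincomb \<mu> z = (\<Sum>k\<le>n. \<mu> k * g k z)"

lemma lincomb_hol: "lincomb \<mu> holomorphic_on UNIV"
  unfolding lincomb_def by (intro holomorphic_intros g_hol) auto

lemma norm_lincomb: "norm (lincomb \<mu> z) \<le> (\<Sum>k\<le>n. norm (\<mu> k)) * exp (u z)"
proof -
  have "norm (lincomb \<mu> z) \<le> (\<Sum>k\<le>n. norm (\<mu> k * g k z))" unfolding lincomb_def by (rule norm_sum)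
  also have "\<dots> \<le> (\<Sum>k\<le>n. norm (\<mu> k) * exp (u z))"
    by (intro sum_mono) (auto simp: norm_mult intro!: mult_left_mono norm_g_le)
  finally show ?thesis by (simp add: sum_distrib_right)
qed

text \<open>With \<open>\<mu> k\<close> proportional to \<open>t ^ k\<close>, the value at
  \<open>b\<close> is a polynomial in \<open>t\<close> that is not zero, as the components have no
  common zero; a \<open>t\<close> outside finitely many root sets works. Division by
  \<open>M\<close> normalizes the coefficients, which later gives
  \<open>norm (lincomb \<mu> z) \<le> exp (u z)\<close>.\<close>

lemma lincomb_avoid:
  assumes "finite B"
  shows "\<exists>\<mu>. (\<Sum>k\<le>n. norm (\<mu> k)) \<le> 1 \<and> (\<forall>b\<in>B. lincomb \<mu> b \<noteq> 0)"
proof -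
  have "finite (\<Union>b\<in>B. {t. (\<Sum>k\<le>n. g k b * t ^ k) = 0})"
    using assms g_nonzero by (intro finite_UN_I) (auto simp: polyfun_finite_roots)
  then have "(\<Union>b\<in>B. {t. (\<Sum>k\<le>n. g k b * t ^ k) = 0}) \<noteq> UNIV"
    using infinite_UNIV_char_0[where 'a = complex] by force
  then obtain t where t: "\<And>b. b \<in> B \<Longrightarrow> (\<Sum>k\<le>n. g k b * t ^ k) \<noteq> 0" by blast
  define M where "M = (\<Sum>k\<le>n. norm t ^ k)"
  have M: "M > 0" unfolding M_def by (intro sum_pos2[of _ 0]) auto
  define \<mu> where "\<mu> k = t ^ k / of_real M" for k
  have "(\<Sum>k\<le>n. norm (\<mu> k)) = M / M"
    unfolding \<mu>_def using M by (simp add: norm_divide norm_power sum_divide_distrib[symmetric] flip: M_def)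
  moreover have "lincomb \<mu> b = (\<Sum>k\<le>n. g k b * t ^ k) / of_real M" for b
    unfolding lincomb_def \<mu>_def by (simp add: sum_divide_distrib mult.commute)
  ultimately show ?thesis using t M by (intro exI[of _ \<mu>]) auto
qed

lemma cmean_ln_le:
  assumes "F holomorphic_on UNIV" "continuous_on (sphere 0 s) \<phi>" "s > 0"
    and "\<And>z. norm z = s \<Longrightarrow> F z \<noteq> 0"
    and "\<And>z. norm z = s \<Longrightarrow> norm (F z) \<le> exp (u z + \<phi> z)"
  shows "cmean 0 s (\<lambda>z. ln (norm (F z))) \<le> T s + u 0 + cmean 0 s \<phi>"
proof -
  have "cmean 0 s (\<lambda>z. ln (norm (F z))) \<le> cmean 0 s (\<lambda>z. u z + \<phi> z)"
  proof (rule cmean_mono)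
    fix z assume z: "z \<in> sphere (0::complex) s"
    then have "ln (norm (F z)) \<le> ln (exp (u z + \<phi> z))"
      using assms(4,5)[of z] by (intro ln_mono) auto
    then show "ln (norm (F z)) \<le> u z + \<phi> z" by simp
  qed (use assms in \<open>auto intro!: continuous_ln_norm continuous_on_add u_continuous\<close>)
  also have "\<dots> = T s + u 0 + cmean 0 s \<phi>"
    unfolding T_eq using assms by (subst cmean_add) (auto intro: u_continuous)
  finally show ?thesis .
qed

text \<open>A combination that vanishes at \<open>0\<close> but not identically has a zero count of
  at least 1, so by Jensen's formula its logarithmic mean, and with it \<open>T\<close>, grows at
  least like \<open>ln r\<close>.\<close>

lemma T_at_top:
  assumes "n \<ge> 1" and indep: "\<And>\<mu>. (\<forall>z. lincomb \<mu> z = 0) \<Longrightarrow> \<forall>k\<le>n. \<mu> k = 0"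
  shows "filterlim T at_top at_top"
proof -
  obtain j where j: "j \<le> n" "g j 0 \<noteq> 0" using g_nonzero by blast
  obtain i where i: "i \<le> n" "i \<noteq> j" using assms(1) by (metis le0 nat_le_linear le_antisym not_one_le_zero)
  \<comment> \<open>The combination \<open>g j 0 * g i - g i 0 * g j\<close> vanishes at
    \<open>0\<close>; independence prevents it from vanishing identically, because its coefficient
    at \<open>i\<close> is \<open>g j 0 \<noteq> 0\<close>.\<close>
  define \<mu> where "\<mu> k = (if k = i then g j 0 else if k = j then - g i 0 else 0)" for k
  define G where "G = lincomb \<mu>"
  have "G 0 = (\<Sum>k\<in>{i, j}. \<mu> k * g k 0)"
    unfolding G_def lincomb_def using i j by (intro sum.mono_neutral_right) (auto simp: \<mu>_def)
  also have "\<dots> = 0" using i by (simp add: \<mu>_def)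
  finally have G0: "G 0 = 0" .
  have "\<mu> i \<noteq> 0" using j by (simp add: \<mu>_def)
  then have "\<exists>z. G z \<noteq> 0" using indep[of \<mu>] i unfolding G_def by blast
  then have G: "entire_nz G" using lincomb_hol by (auto simp: entire_nz_def G_def)
  define M where "M = ln (max 1 (\<Sum>k\<le>n. norm (\<mu> k)))"
  have GM: "norm (G z) \<le> exp (u z + M)" for z
  proof -
    have "(\<Sum>k\<le>n. norm (\<mu> k)) * exp (u z) \<le> max 1 (\<Sum>k\<le>n. norm (\<mu> k)) * exp (u z)"
      by (intro mult_right_mono) auto
    also have "\<dots> = exp (u z + M)" by (simp add: M_def exp_add)
    finally show ?thesis using norm_lincomb[of \<mu> z] unfolding G_def by linarith
  qed
  obtain s where s: "1 < s" "s < 2" "\<And>z. norm z = s \<Longrightarrow> G z \<noteq> 0"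
    using good_radius_exists[of "{G}" 1 2 0] G by auto
  define C where "C = cmean 0 s (\<lambda>z. ln (norm (G z))) - u 0 - M"
  have lower: "ln (r / 4) + C \<le> T r" if r: "r > 4" for r
  proof -
    obtain s' where s': "r / 2 < s'" "s' < r" "\<And>z. norm z = s' \<Longrightarrow> G z \<noteq> 0"
      using good_radius_exists[of "{G}" "r / 2" r 0] G r by auto
    have "1 * ln (s' / s) \<le> zcount G s * ln (s' / s)"
      using s s' r by (intro mult_right_mono zcount_ge1[OF G G0]) auto
    also have "\<dots> \<le> cmean 0 s' (\<lambda>z. ln (norm (G z))) - cmean 0 s (\<lambda>z. ln (norm (G z)))"
      using s s' r by (intro zcount_ln_le[OF G]) auto
    also have "cmean 0 s' (\<lambda>z. ln (norm (G z))) \<le> T s' + u 0 + cmean 0 s' (\<lambda>_. M)"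
      using s' r GM by (intro cmean_ln_le) (auto simp: G_def lincomb_hol)
    finally have "ln (s' / s) + C \<le> T s'" by (simp add: C_def)
    moreover have "ln (r / 4) \<le> ln (s' / s)"
    proof (rule ln_mono)
      have "r * s \<le> r * 2" using s r by (intro mult_left_mono) auto
      also have "\<dots> \<le> s' * 4" using s'(1) by linarith
      finally have "r * s \<le> s' * 4" .
      then show "r / 4 \<le> s' / s" using s by (simp add: divide_simps)
    qed (use r in auto)
    moreover have "T s' \<le> T r" using s' r by (intro T_mono) auto
    ultimately show ?thesis by linarith
  qed
  have "filterlim (\<lambda>r. ln (r / 4) + C) at_top at_top" by real_asymp
  then show ?thesis
    by (rule filterlim_at_top_mono) (rule eventually_mono[OF eventually_gt_at_top[of 4] lower])
qed

end

section \<open>Determinants\<close>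

lemma entire_nz_mult:
  assumes "entire_nz f" "entire_nz h"
  shows "entire_nz (\<lambda>z. f z * h z)"
proof -
  have "\<exists>\<^sub>F z in at 0. f z * h z \<noteq> 0"
    using eventually_conj[OF entire_nz_frequently[OF assms(1), of 0] entire_nz_frequently[OF assms(2), of 0]]
    by (intro eventually_frequently) auto
  then have "\<exists>z. f z * h z \<noteq> 0" using frequently_ex by fastforce
  then show ?thesis using assms by (auto simp: entire_nz_def intro!: holomorphic_intros)
qed

lemma entire_nz_prod:
  assumes "finite A" "\<And>a. a \<in> A \<Longrightarrow> entire_nz (f a)"
  shows "entire_nz (\<lambda>z. \<Prod>a\<in>A. f a z)"
  using assms
proof (induction A rule: finite_induct)
  case empty
  then show ?case by (auto simp: entire_nz_def)
next
  case (insert a A)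
  then show ?case using entire_nz_mult[of "f a" "\<lambda>z. \<Prod>a\<in>A. f a z"] by simp
qed

lemma entire_nz_shift:
  assumes "entire_nz f"
  shows "entire_nz (\<lambda>z. f (z + b))"
proof -
  have "(\<lambda>z. f (z + b)) holomorphic_on UNIV"
    by (rule holomorphic_on_compose_gen[of "\<lambda>z. z + b" UNIV f UNIV, unfolded o_def])
       (use assms in \<open>auto simp: entire_nz_def intro!: holomorphic_intros\<close>)
  moreover obtain w where "f w \<noteq> 0" using assms by (auto simp: entire_nz_def)
  then have "f (w - b + b) \<noteq> 0" by simp
  ultimately show ?thesis unfolding entire_nz_def by blast
qed

text \<open>The proof is fraction-free Gaussian elimination; \<open>Q\<close> collects the pivots.\<close>

lemma singular_system_solution:
  fixes R :: "(complex \<Rightarrow> complex) set" and a :: "'i \<Rightarrow> 'j \<Rightarrow> complex \<Rightarrow> complex"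
  assumes hol: "\<And>f. f \<in> R \<Longrightarrow> f holomorphic_on UNIV"
    and mult: "\<And>f h. f \<in> R \<Longrightarrow> h \<in> R \<Longrightarrow> (\<lambda>z. f z * h z) \<in> R"
    and diff: "\<And>f h. f \<in> R \<Longrightarrow> h \<in> R \<Longrightarrow> (\<lambda>z. f z - h z) \<in> R"
    and one: "(\<lambda>_. 1) \<in> R"
    and "finite I" "finite J" "card I = card J" "\<And>i j. i \<in> I \<Longrightarrow> j \<in> J \<Longrightarrow> a i j \<in> R"
    and "Q \<in> R" "\<exists>z. Q z \<noteq> 0"
    and "\<And>z. Q z \<noteq> 0 \<Longrightarrow> \<exists>v. (\<exists>j\<in>J. v j \<noteq> 0) \<and> (\<forall>i\<in>I. (\<Sum>j\<in>J. a i j z * v j) = 0)"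
  shows "\<exists>b. (\<forall>j\<in>J. b j \<in> R) \<and> (\<exists>j\<in>J. \<exists>z. b j z \<noteq> 0) \<and> (\<forall>i\<in>I. \<forall>z. (\<Sum>j\<in>J. a i j z * b j z) = 0)"
  using assms(5-)
proof (induction "card I" arbitrary: I J a Q)
  case 0
  then show ?case by auto
next
  case (Suc m)
  have zero: "(\<lambda>_. 0) \<in> R" using diff[OF one one] by simp
  have sum: "(\<lambda>z. \<Sum>j\<in>A. f j z) \<in> R" if "finite A" "\<And>j. j \<in> A \<Longrightarrow> f j \<in> R" for A and f :: "'j \<Rightarrow> complex \<Rightarrow> complex"
    using that
  proof (induction A rule: finite_induct)
    case (insert x A)
    have "(\<lambda>z. f x z - (0 - (\<Sum>j\<in>A. f j z))) \<in> R"
      using insert by (intro diff zero) auto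
    then show ?case using insert by simp
  qed (use zero in simp)
  have J: "J \<noteq> {}" using Suc by auto
  show ?case
  proof (cases "\<forall>i\<in>I. \<forall>j\<in>J. \<forall>z. a i j z = 0")
    case True
    then show ?thesis using one J by (intro exI[of _ "\<lambda>_ _. 1"]) auto
  next
    case False
    then obtain i0 p where ip: "i0 \<in> I" "p \<in> J" and piv: "\<exists>z. a i0 p z \<noteq> 0" by blast
    let ?I = "I - {i0}" and ?J = "J - {p}"
    \<comment> \<open>Row \<open>i\<close> is multiplied by the pivot before the pivot row is
      subtracted, so that the entries stay in \<open>R\<close>.\<close>
    define a' where "a' i j = (\<lambda>z. a i0 p z * a i j z - a i p z * a i0 j z)" for i j
    \<comment> \<open>Kernel vectors are given where \<open>Q\<close> does not vanish; the
      elimination at \<open>z\<close> needs a nonzero pivot as well.\<close>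
    define Q' where "Q' = (\<lambda>z. Q z * a i0 p z)"
    have "entire_nz Q'" unfolding Q'_def
      using Suc.prems ip piv hol by (intro entire_nz_mult) (auto simp: entire_nz_def)
    then have Q': "\<exists>z. Q' z \<noteq> 0" by (simp add: entire_nz_def)
    have split: "(\<Sum>j\<in>J. h j) = h p + (\<Sum>j\<in>?J. h j)" for h :: "'j \<Rightarrow> complex"
      by (rule sum.remove[OF Suc.prems(2) ip(2)])
    have ker: "\<exists>v. (\<exists>j\<in>?J. v j \<noteq> 0) \<and> (\<forall>i\<in>?I. (\<Sum>j\<in>?J. a' i j z * v j) = 0)" if z: "Q' z \<noteq> 0" for z
    proof -
      have pz: "a i0 p z \<noteq> 0" "Q z \<noteq> 0" using z by (auto simp: Q'_def)
      obtain v where v: "\<exists>j\<in>J. v j \<noteq> 0" "\<And>i. i \<in> I \<Longrightarrow> (\<Sum>j\<in>J. a i j z * v j) = 0"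
        using Suc.prems(7)[OF pz(2)] by blast
      have row: "(\<Sum>j\<in>?J. a i j z * v j) = - (a i p z * v p)" if "i \<in> I" for i
        using v(2)[OF that] unfolding split by (simp add: add_eq_0_iff)
      have "(\<Sum>j\<in>?J. a' i j z * v j) = 0" if "i \<in> ?I" for i
      proof -
        have "(\<Sum>j\<in>?J. a' i j z * v j) = a i0 p z * (\<Sum>j\<in>?J. a i j z * v j) - a i p z * (\<Sum>j\<in>?J. a i0 j z * v j)"
          unfolding a'_def sum_distrib_left sum_subtractf[symmetric] by (intro sum.cong) (auto simp: algebra_simps)
        then show ?thesis using row[of i] row[of i0] that ip by simp
      qed
      moreover have "\<exists>j\<in>?J. v j \<noteq> 0"
      proof (rule ccontr)
        assume "\<not> ?thesis"
        then have *: "\<And>j. j \<in> ?J \<Longrightarrow> v j = 0" by blast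
        then have "a i0 p z * v p = 0" using row[OF ip(1)] by simp
        then have "v p = 0" using pz by simp
        then show False using * v(1) by blast
      qed
      ultimately show ?thesis by blast
    qed
    have "\<exists>b. (\<forall>j\<in>?J. b j \<in> R) \<and> (\<exists>j\<in>?J. \<exists>z. b j z \<noteq> 0) \<and> (\<forall>i\<in>?I. \<forall>z. (\<Sum>j\<in>?J. a' i j z * b j z) = 0)"
    proof (rule Suc.hyps(1)[OF _ _ _ _ _ _ Q' ker])
      show "m = card ?I" "card ?I = card ?J" using Suc ip by auto
      show "a' i j \<in> R" if "i \<in> ?I" "j \<in> ?J" for i j
        unfolding a'_def using that ip Suc.prems by (intro diff mult) auto
      show "Q' \<in> R" unfolding Q'_def using ip Suc.prems by (intro mult) auto
    qed (use Suc.prems in auto)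
    then obtain b where b: "\<And>j. j \<in> ?J \<Longrightarrow> b j \<in> R" "\<exists>j\<in>?J. \<exists>z. b j z \<noteq> 0"
      "\<And>i z. i \<in> ?I \<Longrightarrow> (\<Sum>j\<in>?J. a' i j z * b j z) = 0" by blast
    \<comment> \<open>Back substitution with all unknowns multiplied by the pivot, again to avoid a
      division. The new vector is not zero because a product of nonzero entire functions is not
      zero.\<close>
    define b' where "b' j = (if j = p then (\<lambda>z. 0 - (\<Sum>j\<in>?J. a i0 j z * b j z)) else (\<lambda>z. a i0 p z * b j z))" for j
    have b'R: "b' j \<in> R" if "j \<in> J" for j
    proof (cases "j = p")
      case True
      have "(\<lambda>z. 0 - (\<Sum>j\<in>?J. a i0 j z * b j z)) \<in> R"
        using Suc.prems b ip by (intro diff zero sum mult) auto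
      then show ?thesis using True by (simp add: b'_def)
    next
      case False
      have "(\<lambda>z. a i0 p z * b j z) \<in> R" using Suc.prems b ip that False by (intro mult) auto
      then show ?thesis using False by (simp add: b'_def)
    qed
    obtain j z where jz: "j \<in> ?J" "b j z \<noteq> 0" using b(2) by blast
    have "entire_nz (\<lambda>z. a i0 p z * b j z)"
      using jz b ip Suc.prems piv hol by (intro entire_nz_mult) (auto simp: entire_nz_def)
    then have nz: "\<exists>z. b' j z \<noteq> 0" using jz by (auto simp: b'_def entire_nz_def)
    have rows: "(\<Sum>j\<in>J. a i j z * b' j z) = 0" if "i \<in> I" for i z
    proof -
      have "(\<Sum>j\<in>J. a i j z * b' j z) = - a i p z * (\<Sum>j\<in>?J. a i0 j z * b j z) + (\<Sum>j\<in>?J. a i j z * (a i0 p z * b j z))"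
        unfolding split by (auto simp: b'_def intro!: sum.cong)
      also have "\<dots> = (\<Sum>j\<in>?J. a' i j z * b j z)"
        unfolding a'_def sum_distrib_left sum.distrib[symmetric] by (intro sum.cong) (auto simp: algebra_simps)
      also have "\<dots> = 0"
      proof (cases "i = i0")
        case True
        then show ?thesis by (simp add: a'_def mult.commute)
      qed (use b(3) that in auto)
      finally show ?thesis .
    qed
    show ?thesis using b'R nz jz rows by (intro exI[of _ b']) auto
  qed
qed

section \<open>Determinants of explicit complex matrices\<close>

abbreviation dmat :: "nat \<Rightarrow> (nat \<Rightarrow> nat \<Rightarrow> complex) \<Rightarrow> complex" where
  "dmat m M \<equiv> Determinant.det (Matrix.mat m m (\<lambda>(i, j). M i j))"

lemma dmat_expand:
  "dmat m M = (\<Sum>p | p permutes {0..<m}. signof p * (\<Prod>i = 0..<m. M i (p i)))"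
proof -
  have "dmat m M = (\<Sum>p | p permutes {0..<m}. signof p * (\<Prod>i = 0..<m. Matrix.mat m m (\<lambda>(i, j). M i j) $$ (i, p i)))"
    by (rule det_def') simp
  also have "\<dots> = (\<Sum>p | p permutes {0..<m}. signof p * (\<Prod>i = 0..<m. M i (p i)))"
  proof (intro sum.cong refl arg_cong2[where f = "(*)"] prod.cong)
    fix p i assume "p \<in> {p. p permutes {0..<m}}" "i \<in> {0..<m}"
    then have "i < m" "p i < m" using permutes_in_image[of p "{0..<m}" i] by auto
    then show "Matrix.mat m m (\<lambda>(i, j). M i j) $$ (i, p i) = M i (p i)" by simp
  qed
  finally show ?thesis .
qed

text \<open>The Leibniz sum has \<open>fact m\<close> terms, each with one factor from every row;
  this is why a separate bound for each row is enough.\<close>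

lemma norm_dmat_le:
  assumes "\<And>i j. i < m \<Longrightarrow> j < m \<Longrightarrow> norm (M i j) \<le> R i"
  shows "norm (dmat m M) \<le> fact m * (\<Prod>i = 0..<m. R i)"
proof -
  have "norm (dmat m M) \<le> (\<Sum>p | p permutes {0..<m}. norm (signof p * (\<Prod>i = 0..<m. M i (p i))))"
    unfolding dmat_expand by (rule norm_sum)
  also have "\<dots> \<le> (\<Sum>p | p permutes {0..<m}. \<Prod>i = 0..<m. R i)"
  proof (rule sum_mono)
    fix p assume p: "p \<in> {p. p permutes {0..<m}}"
    have "norm (signof p * (\<Prod>i = 0..<m. M i (p i))) = (\<Prod>i = 0..<m. norm (M i (p i)))"
      by (simp add: norm_mult prod_norm sign_def)
    also have "\<dots> \<le> (\<Prod>i = 0..<m. R i)"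
    proof (rule prod_mono)
      fix i assume i: "i \<in> {0..<m}"
      then have "p i < m" using p permutes_in_image[of p "{0..<m}" i] by auto
      then show "0 \<le> norm (M i (p i)) \<and> norm (M i (p i)) \<le> R i" using assms i by auto
    qed
    finally show "norm (signof p * (\<Prod>i = 0..<m. M i (p i))) \<le> (\<Prod>i = 0..<m. R i)" .
  qed
  also have "\<dots> = fact m * (\<Prod>i = 0..<m. R i)"
    by (simp add: card_permutations)
  finally show ?thesis .
qed

lemma dmat_scale_columns: "dmat m (\<lambda>i j. M i j * d j) = dmat m M * (\<Prod>j = 0..<m. d j)"
proof -
  have "(\<Prod>i = 0..<m. M i (p i) * d (p i)) = (\<Prod>i = 0..<m. M i (p i)) * (\<Prod>j = 0..<m. d j)"
    if "p permutes {0..<m}" for p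
    using prod.permute[OF that, of d] by (simp add: prod.distrib comp_def)
  then show ?thesis unfolding dmat_expand sum_distrib_right by (intro sum.cong) auto
qed

lemma dmat_mult:
  "dmat m (\<lambda>i k. \<Sum>j<m. M i j * A j k) = dmat m M * dmat m A"
proof -
  have "Matrix.mat m m (\<lambda>(i, k). \<Sum>j<m. M i j * A j k) = Matrix.mat m m (\<lambda>(i, j). M i j) * Matrix.mat m m (\<lambda>(i, j). A i j)"
    by (rule eq_matI) (auto simp: scalar_prod_def lessThan_atLeast0)
  then show ?thesis by (simp add: det_mult[of _ m])
qed

lemma dmat_holomorphic:
  assumes "\<And>i j. i < m \<Longrightarrow> j < m \<Longrightarrow> (\<lambda>z. M z i j) holomorphic_on S"
  shows "(\<lambda>z. dmat m (M z)) holomorphic_on S"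
  unfolding dmat_expand
proof (intro holomorphic_intros)
  fix p i assume "p \<in> {p. p permutes {0..<m}}" "i \<in> {0..<m}"
  then have "i < m" "p i < m" using permutes_in_image[of p "{0..<m}" i] by auto
  then show "(\<lambda>z. M z i (p i)) holomorphic_on S" by (rule assms)
qed

lemma dmat_eq_0_iff:
  "dmat m M = 0 \<longleftrightarrow> (\<exists>v. (\<exists>j<m. v j \<noteq> 0) \<and> (\<forall>i<m. (\<Sum>j<m. M i j * v j) = 0))"
proof -
  let ?A = "Matrix.mat m m (\<lambda>(i, j). M i j)"
  have "dmat m M = 0 \<longleftrightarrow> (\<exists>v. v \<in> carrier_vec m \<and> v \<noteq> 0\<^sub>v m \<and> ?A *\<^sub>v v = 0\<^sub>v m)"
    by (rule det_0_iff_vec_prod_zero) simp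
  also have "\<dots> \<longleftrightarrow> (\<exists>v. (\<exists>j<m. v j \<noteq> 0) \<and> (\<forall>i<m. (\<Sum>j<m. M i j * v j) = 0))"
  proof
    assume "\<exists>v. v \<in> carrier_vec m \<and> v \<noteq> 0\<^sub>v m \<and> ?A *\<^sub>v v = 0\<^sub>v m"
    then obtain v where v: "v \<in> carrier_vec m" "v \<noteq> 0\<^sub>v m" "?A *\<^sub>v v = 0\<^sub>v m" by blast
    have "\<exists>j<m. vec_index v j \<noteq> 0" using v by (metis carrier_vecD eq_vecI index_zero_vec)
    moreover have "(\<Sum>j<m. M i j * vec_index v j) = 0" if "i < m" for i
    proof -
      have "vec_index (?A *\<^sub>v v) i = (\<Sum>j<m. M i j * vec_index v j)"
        using v(1) that by (auto simp: scalar_prod_def lessThan_atLeast0 intro!: sum.cong)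
      then show ?thesis using v(3) that by simp
    qed
    ultimately show "\<exists>v. (\<exists>j<m. v j \<noteq> 0) \<and> (\<forall>i<m. (\<Sum>j<m. M i j * v j) = 0)" by blast
  next
    assume "\<exists>v. (\<exists>j<m. v j \<noteq> 0) \<and> (\<forall>i<m. (\<Sum>j<m. M i j * v j) = 0)"
    then obtain v j where v: "j < m" "v j \<noteq> 0" "\<And>i. i < m \<Longrightarrow> (\<Sum>j<m. M i j * v j) = 0" by blast
    have "?A *\<^sub>v Matrix.vec m v = 0\<^sub>v m"
      using v(3) by (intro eq_vecI) (auto simp: scalar_prod_def lessThan_atLeast0)
    moreover have "Matrix.vec m v \<noteq> 0\<^sub>v m" using v by (metis index_vec index_zero_vec(1))
    ultimately show "\<exists>v. v \<in> carrier_vec m \<and> v \<noteq> 0\<^sub>v m \<and> ?A *\<^sub>v v = 0\<^sub>v m"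
      by (intro exI[of _ "Matrix.vec m v"]) auto
  qed
  finally show ?thesis .
qed

text \<open>The cofactor of the entry in row \<open>l\<close> and column \<open>k\<close>:
  \<open>insert_index l\<close> skips the index \<open>l\<close>. As it is built from a
  \<open>dmat\<close>, bounds and holomorphy carry over.\<close>

definition minor :: "nat \<Rightarrow> (nat \<Rightarrow> nat \<Rightarrow> complex) \<Rightarrow> nat \<Rightarrow> nat \<Rightarrow> complex" where
  "minor m M l k = (-1) ^ (l + k) * dmat m (\<lambda>i j. M (insert_index l i) (insert_index k j))"

text \<open>Laplace expansion along row \<open>l\<close>; for \<open>i \<noteq> l\<close> it expands
  a matrix with a repeated row. Both cases are read off from the product with the adjugate.\<close>

lemma minor_expansion:
  assumes "i < Suc m" "l < Suc m"
  shows "(\<Sum>k<Suc m. M i k * minor m M l k) = (if i = l then dmat (Suc m) M else 0)"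
proof -
  let ?A = "Matrix.mat (Suc m) (Suc m) (\<lambda>(i, j). M i j)"
  have A: "?A \<in> carrier_mat (Suc m) (Suc m)" by simp
  have cof: "cofactor ?A l k = minor m M l k" if "k < Suc m" for k
  proof -
    have "mat_delete ?A l k = Matrix.mat m m (\<lambda>(i, j). M (insert_index l i) (insert_index k j))"
      by (rule eq_matI) (use mat_delete_index[OF A, symmetric] assms that in \<open>auto simp: insert_index_def\<close>)
    then show ?thesis by (simp add: cofactor_def minor_def)
  qed
  have "(?A * adj_mat ?A) $$ (i, l) = (\<Sum>k<Suc m. M i k * minor m M l k)"
    using assms cof by (auto simp: scalar_prod_def adj_mat_def lessThan_atLeast0 intro!: sum.cong simp del: sum.lessThan_Suc)
  moreover have "(?A * adj_mat ?A) $$ (i, l) = (if i = l then dmat (Suc m) M else 0)"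
    unfolding adj_mat(2)[OF A] using assms by simp
  ultimately show ?thesis by simp
qed

text \<open>Cramer's rule: \<open>dmat (Suc m) A * x l\<close> is a combination of the known sums
  with cofactors as coefficients, each at most \<open>fact m * B ^ m\<close>. As
  \<open>1 \<le> B\<close>, the power may be raised to the one that bounds the determinant
  itself.\<close>

lemma dmat_solve_bound:
  assumes B: "\<And>i k. i < Suc m \<Longrightarrow> k < Suc m \<Longrightarrow> norm (A i k) \<le> B" "1 \<le> B"
    and f: "\<And>k. k < Suc m \<Longrightarrow> norm (\<Sum>i<Suc m. x i * A i k) \<le> \<phi>" and l: "l < Suc m"
  shows "norm (dmat (Suc m) A) * norm (x l) \<le> fact (Suc m) * B ^ Suc m * \<phi>"
proof -
  have \<phi>: "0 \<le> \<phi>" using f[OF l] norm_ge_zero order_trans by blast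
  have mb: "norm (minor m A l k) \<le> fact m * B ^ m" if "k < Suc m" for k
  proof -
    have "norm (dmat m (\<lambda>i j. A (insert_index l i) (insert_index k j))) \<le> fact m * (\<Prod>i = 0..<m. B)"
      by (rule norm_dmat_le) (use B(1) l that in \<open>auto simp: insert_index_def\<close>)
    then show ?thesis by (simp add: minor_def norm_mult norm_power)
  qed
  have "dmat (Suc m) A * x l = (\<Sum>i<Suc m. x i * (if i = l then dmat (Suc m) A else 0))"
    using l by (simp add: if_distrib cong: if_cong del: sum.lessThan_Suc)
  also have "\<dots> = (\<Sum>i<Suc m. x i * (\<Sum>k<Suc m. A i k * minor m A l k))"
    using l by (intro sum.cong refl) (simp add: minor_expansion del: sum.lessThan_Suc)
  also have "\<dots> = (\<Sum>k<Suc m. (\<Sum>i<Suc m. x i * A i k) * minor m A l k)"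
    unfolding sum_distrib_left sum_distrib_right by (subst sum.swap) (simp only: mult.assoc)
  finally have "norm (dmat (Suc m) A) * norm (x l) = norm (\<Sum>k<Suc m. (\<Sum>i<Suc m. x i * A i k) * minor m A l k)"
    by (simp only: norm_mult[symmetric])
  also have "\<dots> \<le> (\<Sum>k<Suc m. norm ((\<Sum>i<Suc m. x i * A i k) * minor m A l k))" by (rule norm_sum)
  also have "\<dots> \<le> (\<Sum>k<Suc m. \<phi> * (fact m * B ^ m))"
  proof (rule sum_mono)
    fix k assume "k \<in> {..<Suc m}"
    then show "norm ((\<Sum>i<Suc m. x i * A i k) * minor m A l k) \<le> \<phi> * (fact m * B ^ m)"
      unfolding norm_mult using f[of k] mb[of k] \<phi> by (intro mult_mono) (auto simp del: sum.lessThan_Suc)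
  qed
  also have "\<dots> = fact (Suc m) * B ^ m * \<phi>" by simp
  also have "\<dots> \<le> fact (Suc m) * B ^ Suc m * \<phi>"
    using B \<phi> by (intro mult_right_mono mult_left_mono power_increasing) auto
  finally show ?thesis .
qed

section \<open>The characteristic function of a quotient\<close>

lemma finite_circle_zeros:
  assumes "entire_nz Q" "r > 0"
  shows "finite {t \<in> {0..2*pi}. Q (of_real r * cis t) = 0}"
proof -
  \<comment> \<open>\<open>t = 2*pi\<close> gives the same point as \<open>t = 0\<close> but is no
    value of \<open>Arg2pi\<close>.\<close>
  have "{t \<in> {0..2*pi}. Q (of_real r * cis t) = 0} \<subseteq> insert (2*pi) (Arg2pi ` zeros_in Q r)"
  proof
    fix t assume t: "t \<in> {t \<in> {0..2*pi}. Q (of_real r * cis t) = 0}"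
    show "t \<in> insert (2*pi) (Arg2pi ` zeros_in Q r)"
    proof (cases "t = 2*pi")
      case False
      have "Arg2pi (of_real r * cis t) = t"
        using t False assms by (intro Arg2pi_unique[of r]) (auto simp: cis_conv_exp)
      moreover have "of_real r * cis t \<in> zeros_in Q r"
        using t assms by (auto simp: zeros_in_def norm_mult)
      ultimately show ?thesis by (metis imageI insertI2)
    qed simp
  qed
  then show ?thesis using finite_zeros_in[OF assms(1)] by (meson finite_imageI finite_insert finite_subset)
qed

text \<open>Finitely many parameters do not affect an integral. If \<open>log_plus\<close> of
  \<open>f\<close> is not integrable, its integral is 0 by default, and the bound holds since
  \<open>K\<close> is nonnegative off \<open>N\<close>.\<close>

lemma nevanlinna_m_le:
  assumes r: "r > 0" and K: "K integrable_on {0..2*pi}" and fin: "finite N"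
    and le: "\<And>t. t \<in> {0..2*pi} - N \<Longrightarrow> log_plus (norm (f (of_real r * cis t))) \<le> K t"
  shows "nevanlinna_m r f \<le> integral {0..2*pi} K / (2*pi)"
proof -
  define \<phi> where "\<phi> t = log_plus (norm (f (of_real r * cis t)))" for t
  have \<phi>: "0 \<le> \<phi> t" for t by (simp add: \<phi>_def log_plus_def)
  define K' where "K' t = (if t \<in> N then \<phi> t else K t)" for t
  have K': "(K' has_integral integral {0..2*pi} K) {0..2*pi}"
    using fin K by (intro has_integral_spike_finite[of N _ K' K]) (auto simp: K'_def)
  have le': "\<phi> t \<le> K' t" if "t \<in> {0..2*pi}" for t using le that by (auto simp: K'_def \<phi>_def)
  have "integral {0..2*pi} \<phi> \<le> integral {0..2*pi} K"
  proof (cases "\<phi> integrable_on {0..2*pi}")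
    case True
    then show ?thesis using has_integral_le[OF integrable_integral K'] le' by blast
  next
    case False
    then have "integral {0..2*pi} \<phi> = 0" by (rule not_integrable_integral)
    moreover have "0 \<le> integral {0..2*pi} K"
      using \<phi> le' by (intro has_integral_nonneg[OF K']) (meson order_trans)
    ultimately show ?thesis by simp
  qed
  then show ?thesis unfolding nevanlinna_m_def \<phi>_def by (simp add: divide_right_mono)
qed

text \<open>Zeros of \<open>Q\<close> on the circle must be admitted here: the hyper-order is a limit superior over all radii.\<close>

lemma nevanlinna_m_quotient_le:
  assumes P: "entire_nz P" and Q: "entire_nz Q" and V: "continuous_on UNIV V"
    and bd: "\<And>z. norm (P z) \<le> exp (V z)" "\<And>z. norm (Q z) \<le> exp (V z)"
    and r: "r > 0"
    and G: "entire_nz G" "\<And>z. norm z \<le> r + 1 \<Longrightarrow> G z \<noteq> 0"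
      "\<And>z. Q z = (\<Prod>a\<in>zeros_in Q (r + 1). (z - a) ^ zmult Q a) * G z"
  shows "nevanlinna_m r (remove_sings (\<lambda>z. P z / Q z))
     \<le> cmean 0 r V - ln (norm (G 0)) + (\<Sum>a\<in>zeros_in Q (r + 1). real (zmult Q a) * (circle_const (1/2) / pi - ln r))"
proof -
  let ?A = "zeros_in Q (r + 1)" and ?m = "zmult Q"
  have finA: "finite ?A" using finite_zeros_in[OF Q] .
  have hol: "P holomorphic_on UNIV" "Q holomorphic_on UNIV" "G holomorphic_on UNIV"
    using P Q G by (auto simp: entire_nz_def)
  \<comment> \<open>One integrable majorant for every possible zero; the exponent 1/2 stands for any
    number between 0 and 1.\<close>
  have "\<forall>a. \<exists>p. p integrable_on {0..2*pi} \<and> integral {0..2*pi} p \<le> circle_const (1/2) \<and>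
     (\<forall>t\<in>{0..2*pi}. 0 \<le> p t \<and>
       (of_real r * cis t \<noteq> a \<longrightarrow> norm (of_real r * cis t - a) powr (-(1/2)) \<le> r powr (-(1/2)) * p t))"
    using circle_singularity[of "1/2" r] r by auto
  from choice[OF this] obtain p where p0: "\<forall>a. p a integrable_on {0..2*pi} \<and> integral {0..2*pi} (p a) \<le> circle_const (1/2) \<and>
     (\<forall>t\<in>{0..2*pi}. 0 \<le> p a t \<and>
       (of_real r * cis t \<noteq> a \<longrightarrow> norm (of_real r * cis t - a) powr (-(1/2)) \<le> r powr (-(1/2)) * p a t))" ..
  have p: "\<And>a. p a integrable_on {0..2*pi}" "\<And>a. integral {0..2*pi} (p a) \<le> circle_const (1/2)"
     "\<And>a t. t \<in> {0..2*pi} \<Longrightarrow> of_real r * cis t \<noteq> a \<Longrightarrow> norm (of_real r * cis t - a) powr (-(1/2)) \<le> r powr (-(1/2)) * p a t"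
    using p0 by (blast, blast, simp)
  define K where "K t = (V (0 + of_real r * cis t) - ln (norm (G (0 + of_real r * cis t)))) + (\<Sum>a\<in>?A. real (?m a) * (2 * p a t - ln r))" for t
  have cV: "continuous_on (sphere 0 r) V" using V by (rule continuous_on_subset) simp
  have cG: "continuous_on (sphere 0 r) (\<lambda>z. ln (norm (G z)))"
    using G by (intro continuous_ln_norm hol) auto
  have int1: "(\<lambda>t. V (0 + of_real r * cis t) - ln (norm (G (0 + of_real r * cis t)))) integrable_on {0..2*pi}"
    by (rule circle_integrable[OF continuous_on_diff[OF cV cG]]) (use r in simp)
  have int2: "((\<lambda>t. real (?m a) * (2 * p a t - ln r)) has_integral (real (?m a) * (2 * integral {0..2*pi} (p a) - 2 * pi * ln r))) {0..2*pi}" for a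
    using has_integral_const_real[of "ln r" 0 "2*pi"]
    by (intro has_integral_mult_right has_integral_diff integrable_integral p) simp
  have intK: "(K has_integral (integral {0..2*pi} (\<lambda>t. V (0 + of_real r * cis t) - ln (norm (G (0 + of_real r * cis t))))
      + (\<Sum>a\<in>?A. real (?m a) * (2 * integral {0..2*pi} (p a) - 2 * pi * ln r)))) {0..2*pi}"
    unfolding K_def by (intro has_integral_add integrable_integral int1 has_integral_sum finA int2)
  have "nevanlinna_m r (remove_sings (\<lambda>z. P z / Q z)) \<le> integral {0..2*pi} K / (2*pi)"
  proof (rule nevanlinna_m_le[OF r _ finite_circle_zeros[OF Q r]])
    show "K integrable_on {0..2*pi}" using intK by blast
    fix t assume t: "t \<in> {0..2*pi} - {t \<in> {0..2*pi}. Q (of_real r * cis t) = 0}"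
    define z where "z = of_real r * cis t"
    have Qz: "Q z \<noteq> 0" using t by (auto simp: z_def)
    have "(\<lambda>z. P z / Q z) analytic_on {z}"
      using Qz hol by (intro analytic_intros) (auto simp: analytic_on_holomorphic)
    then have "remove_sings (\<lambda>z. P z / Q z) z = P z / Q z" by (rule remove_sings_at_analytic)
    then have "log_plus (norm (remove_sings (\<lambda>z. P z / Q z) z)) = ln (max 1 (norm (P z) / norm (Q z)))"
      by (simp add: log_plus_def norm_divide)
    \<comment> \<open>\<open>V\<close> dominates both \<open>P\<close> and \<open>Q\<close>, so it
      also takes care of the positive part of the logarithm.\<close>
    also have "max 1 (norm (P z) / norm (Q z)) \<le> exp (V z) / norm (Q z)"
    proof (rule max.boundedI)
      show "1 \<le> exp (V z) / norm (Q z)" using bd(2)[of z] Qz by simp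
      show "norm (P z) / norm (Q z) \<le> exp (V z) / norm (Q z)" by (rule divide_right_mono[OF bd(1)]) simp
    qed
    then have "ln (max 1 (norm (P z) / norm (Q z))) \<le> ln (exp (V z) / norm (Q z))"
      by (intro ln_mono) auto
    also have "\<dots> = V z - ln (norm (Q z))" using Qz by (simp add: ln_divide_pos)
    also have "ln (norm (Q z)) = (\<Sum>a\<in>?A. real (?m a) * ln (norm (z - a))) + ln (norm (G z))"
      using ln_norm_factor[where F = Q and G = G and m = ?m, OF G(3) Qz finA] .
    also have "V z - ((\<Sum>a\<in>?A. real (?m a) * ln (norm (z - a))) + ln (norm (G z))) \<le> K t"
    proof -
      have "- (\<Sum>a\<in>?A. real (?m a) * ln (norm (z - a))) \<le> (\<Sum>a\<in>?A. real (?m a) * (2 * p a t - ln r))"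
        unfolding sum_negf[symmetric]
      proof (rule sum_mono)
        fix a assume a: "a \<in> ?A"
        have za: "z \<noteq> a" using a Qz by (auto simp: zeros_in_def)
        have "ln r - ln (norm (z - a)) \<le> 2 * p a t"
        \<comment> \<open>Near the zero, \<open>ln x \<le> 2 * x powr (1/2)\<close> with
          \<open>x = r / norm (z - a)\<close> leads to the majorant; far from it the left side is
          not positive.\<close>
        proof (cases "norm (z - a) \<le> r")
          case True
          have "ln r - ln (norm (z - a)) = ln (r / norm (z - a))" using za r by (simp add: ln_divide_pos)
          also have "\<dots> \<le> (r / norm (z - a)) powr (1/2) / (1/2)"
            using True za by (intro ln_powr_bound) auto
          also have "(r / norm (z - a)) powr (1/2) = r powr (1/2) * norm (z - a) powr (-(1/2))"
            using r by (simp add: powr_divide powr_minus_divide)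
          also have "\<dots> \<le> r powr (1/2) * (r powr (-(1/2)) * p a t)"
            using p(3)[of t a] t za unfolding z_def by (intro mult_left_mono) auto
          also have "\<dots> = p a t" using r by (simp add: powr_minus)
          finally show ?thesis by simp
        next
          case False
          then have "ln r \<le> ln (norm (z - a))" using r by (intro ln_mono) auto
          moreover have "0 \<le> p a t" using p0 t by blast
          ultimately show ?thesis by simp
        qed
        then have "real (?m a) * (ln r - ln (norm (z - a))) \<le> real (?m a) * (2 * p a t)" by (intro mult_left_mono) auto
        then show "- (real (?m a) * ln (norm (z - a))) \<le> real (?m a) * (2 * p a t - ln r)"
          by (simp add: algebra_simps)
      qed
      then show ?thesis unfolding K_def z_def by simp
    qed
    finally show "log_plus (norm (remove_sings (\<lambda>z. P z / Q z) (of_real r * cis t))) \<le> K t"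
      unfolding z_def .
  qed
  also have "integral {0..2*pi} K / (2*pi) = cmean 0 r (\<lambda>z. V z - ln (norm (G z)))
      + (\<Sum>a\<in>?A. real (?m a) * (integral {0..2*pi} (p a) / pi - ln r))"
  proof -
    have "m * (2 * I - 2 * pi * l) / (2 * pi) = m * (I / pi - l)" for m I l :: real
      by (simp add: field_simps)
    then show ?thesis
      unfolding integral_unique[OF intK] cmean_def add_divide_distrib sum_divide_distrib by simp
  qed
  also have "cmean 0 r (\<lambda>z. V z - ln (norm (G z))) = cmean 0 r V - ln (norm (G 0))"
  proof -
    have "cmean 0 r (\<lambda>z. ln (norm (G z))) = ln (norm (G 0))"
      using r G by (intro mean_value_ln[where S = "r + 1"] holomorphic_on_subset[OF hol(3)]) auto
    then show ?thesis using r by (simp add: cmean_diff cV cG)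
  qed
  also have "(\<Sum>a\<in>?A. real (?m a) * (integral {0..2*pi} (p a) / pi - ln r))
     \<le> (\<Sum>a\<in>?A. real (?m a) * (circle_const (1/2) / pi - ln r))"
    by (intro sum_mono mult_left_mono diff_right_mono divide_right_mono p) auto
  finally show ?thesis by simp
qed

lemma nevanlinna_N_remove_sings:
  assumes "\<And>z. isolated_singularity_at f z"
  shows "nevanlinna_N r (remove_sings f) = nevanlinna_N r f"
proof -
  have e: "is_pole (remove_sings f) = is_pole f" "zorder (remove_sings f) = zorder f"
    using assms by (auto simp: fun_eq_iff)
  show ?thesis unfolding nevanlinna_N_def pole_count_def pole_mult_def e ..
qed

text \<open>When the bounds for \<open>m\<close> and \<open>N\<close> are added, the terms in
  \<open>ln r\<close> and \<open>ln (norm a)\<close> of each zero cancel up to a bounded amount by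
  \<open>jensen_const\<close>, so only the number of zeros in the disc of radius
  \<open>r + 1\<close> remains.\<close>

lemma nevanlinna_T_quotient_le:
  assumes P: "entire_nz P" and Q: "entire_nz Q" and V: "continuous_on UNIV V"
    and bd: "\<And>z. norm (P z) \<le> exp (V z)" "\<And>z. norm (Q z) \<le> exp (V z)"
  shows "\<exists>C. \<forall>r\<ge>1. nevanlinna_T r (remove_sings (\<lambda>z. P z / Q z)) \<le> cmean 0 r V + C * (zcount Q (r + 1) + 1)"
proof -
  from jensen_const[OF Q] obtain \<kappa> where \<kappa>: "\<forall>S G. 0 \<le> S \<longrightarrow> entire_nz G \<longrightarrow> (\<forall>z. norm z \<le> S \<longrightarrow> G z \<noteq> 0) \<longrightarrow>
     (\<forall>z. Q z = (\<Prod>a\<in>zeros_in Q S. (z - a) ^ zmult Q a) * G z) \<longrightarrow>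
     ln (norm (G 0)) + (\<Sum>a\<in>zeros_in Q S - {0}. real (zmult Q a) * ln (norm a)) = \<kappa>" ..
  define c where "c = circle_const (1/2) / pi + 1"
  have c0: "c \<ge> 0" unfolding c_def circle_const_def by simp
  define C where "C = max \<bar>\<kappa>\<bar> c"
  have "nevanlinna_T r (remove_sings (\<lambda>z. P z / Q z)) \<le> cmean 0 r V + C * (zcount Q (r + 1) + 1)" if r: "r \<ge> 1" for r
  proof -
    let ?A = "zeros_in Q (r + 1)" and ?m = "zmult Q"
    have finA: "finite ?A" using finite_zeros_in[OF Q] .
    obtain G where G: "entire_nz G" "\<And>z. norm z \<le> r + 1 \<Longrightarrow> G z \<noteq> 0"
      "\<And>z. Q z = (\<Prod>a\<in>?A. (z - a) ^ ?m a) * G z"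
      using entire_factor_zeros[OF Q] by blast
    have iso: "isolated_singularity_at (\<lambda>z. P z / Q z) z" for z
    proof -
      have "P analytic_on {z}" "Q analytic_on {z}" using P Q by (auto simp: entire_nz_def analytic_on_holomorphic)
      then have "(\<lambda>z. P z / Q z) meromorphic_on {z}"
        by (intro meromorphic_intros analytic_on_imp_meromorphic_on)
      then show ?thesis by (simp add: meromorphic_at_iff)
    qed
    have N: "nevanlinna_N r (remove_sings (\<lambda>z. P z / Q z)) \<le> (\<Sum>a\<in>?A. if norm a \<le> r then real (?m a) * log_ratio r a else 0)"
    proof -
      have "log_zcount r Q = (\<Sum>a\<in>?A. if norm a \<le> r then real (?m a) * log_ratio r a else 0)"
        unfolding log_zcount_def using finA by (intro sum.mono_neutral_cong_left) (auto simp: zeros_in_def)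
      then show ?thesis using nevanlinna_N_quotient_le[OF P Q r] nevanlinna_N_remove_sings[OF iso] by simp
    qed
    have k: "ln (norm (G 0)) = \<kappa> - (\<Sum>a\<in>?A. if a = 0 then 0 else real (?m a) * ln (norm a))"
    proof -
      have "(\<Sum>a\<in>?A. if a = 0 then 0 else real (?m a) * ln (norm a)) = (\<Sum>a\<in>?A - {0}. real (?m a) * ln (norm a))"
        using finA by (intro sum.mono_neutral_cong_right) auto
      moreover have "ln (norm (G 0)) + (\<Sum>a\<in>?A - {0}. real (?m a) * ln (norm a)) = \<kappa>"
        by (rule \<kappa>[rule_format]) (use r G in auto)
      ultimately show ?thesis by simp
    qed
    have "nevanlinna_T r (remove_sings (\<lambda>z. P z / Q z)) \<le> cmean 0 r V - \<kappa>
        + (\<Sum>a\<in>?A. (if a = 0 then 0 else real (?m a) * ln (norm a)) + real (?m a) * (circle_const (1/2) / pi - ln r)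
             + (if norm a \<le> r then real (?m a) * log_ratio r a else 0))"
      using nevanlinna_m_quotient_le[OF P Q V bd _ G] N r k unfolding nevanlinna_T_def sum.distrib by simp
    also have "(\<Sum>a\<in>?A. (if a = 0 then 0 else real (?m a) * ln (norm a)) + real (?m a) * (circle_const (1/2) / pi - ln r)
             + (if norm a \<le> r then real (?m a) * log_ratio r a else 0)) \<le> (\<Sum>a\<in>?A. c * real (?m a))"
    proof (rule sum_mono)
      fix a assume a: "a \<in> ?A"
      have "(if a = 0 then 0 else ln (norm a)) - ln r + (if norm a \<le> r then log_ratio r a else 0) \<le> 1"
      proof (cases "norm a \<le> r")
        case True
        then show ?thesis using r by (auto simp: log_ratio_def ln_divide_pos)
      next
        case False
        then have a0: "a \<noteq> 0" using r by auto
        \<comment> \<open>\<open>norm a \<le> r + 1 \<le> 2 * r\<close>, so a zero outside the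
          circle contributes at most \<open>ln 2\<close>.\<close>
        have "norm a \<le> 2 * r" using a r by (auto simp: zeros_in_def)
        then have "ln (norm a) \<le> ln (2 * r)" using a0 by (intro ln_mono) auto
        also have "\<dots> = ln 2 + ln r" using r by (simp add: ln_mult_pos)
        also have "ln 2 \<le> (1::real)" using ln_le_minus_one[of "2::real"] by simp
        finally show ?thesis using False a0 by simp
      qed
      then have "real (?m a) * ((if a = 0 then 0 else ln (norm a)) - ln r + (if norm a \<le> r then log_ratio r a else 0)) \<le> real (?m a) * 1"
        by (intro mult_left_mono) auto
      then show "(if a = 0 then 0 else real (?m a) * ln (norm a)) + real (?m a) * (circle_const (1/2) / pi - ln r)
             + (if norm a \<le> r then real (?m a) * log_ratio r a else 0) \<le> c * real (?m a)"
        unfolding c_def by (auto simp: algebra_simps split: if_splits)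
    qed
    also have "(\<Sum>a\<in>?A. c * real (?m a)) = c * zcount Q (r + 1)" unfolding zcount_def sum_distrib_left ..
    also have "c * zcount Q (r + 1) \<le> C * zcount Q (r + 1)"
      unfolding C_def by (intro mult_right_mono zcount_nonneg) auto
    also have "cmean 0 r V - \<kappa> + C * zcount Q (r + 1) \<le> cmean 0 r V + C * (zcount Q (r + 1) + 1)"
      unfolding C_def distrib_left by (simp add: abs_le_iff max_def split: if_splits) linarith
    finally show ?thesis by simp
  qed
  then show ?thesis by blast
qed

context curve
begin

text \<open>\<open>u\<close> has no sign, so the kernel in its Poisson integral cannot be replaced
  by an upper bound. The part \<open>u - ln (norm G)\<close> is nonnegative and admits the bound 3
  for the kernel; the part \<open>ln (norm G)\<close> is evaluated exactly at \<open>b\<close> by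
  Poisson--Jensen, with the zeros of \<open>G\<close> counted by \<open>zcount\<close>.\<close>

lemma cmean_u_crude:
  assumes top: "filterlim T at_top at_top"
  shows "\<exists>C>0. \<forall>\<^sub>F r in at_top. cmean b r u \<le> C * r * T (4 * r)"
proof -
  obtain \<mu> where \<mu>: "(\<Sum>k\<le>n. norm (\<mu> k)) \<le> 1" "lincomb \<mu> 0 \<noteq> 0" "lincomb \<mu> b \<noteq> 0"
    using lincomb_avoid[of "{0, b}"] by auto
  define G where "G = lincomb \<mu>"
  have hG: "G holomorphic_on UNIV" by (simp add: G_def lincomb_hol)
  have nz: "entire_nz G" "G 0 \<noteq> 0" "G b \<noteq> 0" using \<mu> hG by (auto simp: entire_nz_def G_def)
  have Gu: "norm (G z) \<le> exp (u z)" for z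
  proof -
    have "(\<Sum>k\<le>n. norm (\<mu> k)) * exp (u z) \<le> 1 * exp (u z)" using \<mu>(1) by (intro mult_right_mono) auto
    then show ?thesis using norm_lincomb[of \<mu> z] unfolding G_def by linarith
  qed
  have "isCont G b" using holomorphic_on_imp_continuous_on[OF hG] by (simp add: continuous_on_eq_continuous_at)
  \<comment> \<open>The zeros of \<open>G\<close> keep a distance \<open>\<delta>\<close> from
    \<open>b\<close>, which bounds Green's function at \<open>b\<close>.\<close>
  then obtain \<delta> where \<delta>: "\<delta> > 0" "\<And>a. dist b a < \<delta> \<Longrightarrow> G a \<noteq> 0"
    using nz(3) continuous_at_avoid[of b G 0] by blast
  define c1 where "c1 = \<bar>u 0 - ln (norm (G 0))\<bar>"
  define C where "C = 3 * (1 + c1) + \<bar>ln (norm (G b))\<bar> + (1 + c1) / ln 2 * (4 / \<delta>)"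
  have c1: "c1 \<ge> 0" by (simp add: c1_def)
  then have C: "C > 0" unfolding C_def using \<delta> by (intro add_pos_nonneg) auto
  have "filterlim (\<lambda>r::real. 4 * r) at_top at_top" by real_asymp
  from filterlim_compose[OF top this] have "\<forall>\<^sub>F r in at_top. 1 \<le> T (4 * r)"
    by (simp add: filterlim_at_top)
  moreover have "\<forall>\<^sub>F r in at_top. r \<ge> 2 * norm b + 4" by (rule eventually_ge_at_top)
  ultimately have "\<forall>\<^sub>F r in at_top. cmean b r u \<le> C * r * T (4 * r)"
  proof eventually_elim
    case (elim r)
    have r: "r \<ge> 4" using elim norm_ge_zero[of b] by linarith
    let ?H = "insert G G_nz"
    have H: "finite ?H" "\<And>F. F \<in> ?H \<Longrightarrow> entire_nz F" using G_nz nz by auto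
    have "r + norm b < 3/2 * r" using elim by linarith
    \<comment> \<open>\<open>R < 3/2 * r\<close> and, below, \<open>R' > 3 * r\<close> give
      \<open>R' \<ge> 2 * R\<close>, so Jensen's formula counts each zero with at least
      \<open>ln 2\<close>.\<close>
    then obtain R where R: "r + norm b < R" "R < 3/2 * r" "\<And>F z. F \<in> ?H \<Longrightarrow> norm z = R \<Longrightarrow> F z \<noteq> 0"
      using good_radius_exists[OF H, of "r + norm b" "3/2 * r" 0] unfolding mem_sphere_0 Ball_def by blast
    obtain R' where R': "3 * r < R'" "R' < 4 * r" "\<And>F z. F \<in> ?H \<Longrightarrow> norm z = R' \<Longrightarrow> F z \<noteq> 0"
    proof -
      have "3 * r < 4 * r" using r by simp
      from good_radius_exists[OF H this, of 0] show ?thesis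
        unfolding mem_sphere_0 Ball_def using that by blast
    qed
    have R0: "R > 0" "norm b < R" "R' > 0" "2 * R \<le> R'" using R R' r norm_ge_zero[of b] by linarith+
    have TR: "T R \<le> T (4 * r)" "T R' \<le> T (4 * r)" using R R' r R0 by (auto intro!: T_mono)
    have cl: "continuous_on (sphere 0 R) (\<lambda>z. ln (norm (G z)))"
      using R by (intro continuous_ln_norm hG) auto
    have cP: "continuous_on (sphere 0 R) (poisson b)" by (rule poisson_continuous[OF R0(2)])
    have mG: "ln (norm (G 0)) \<le> cmean 0 \<rho> (\<lambda>z. ln (norm (G z)))" if "\<rho> = R \<or> \<rho> = R'" for \<rho>
    proof -
      have \<rho>: "\<rho> > 0" "\<And>z. norm z = \<rho> \<Longrightarrow> G z \<noteq> 0" using that R R' R0 by auto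
      have "ln (norm (G 0)) \<le> cmean 0 \<rho> (\<lambda>z. poisson 0 z * ln (norm (G z)))"
        using \<rho> nz by (intro Poisson_ineq[OF nz(1)] continuous_ln_norm hG) auto
      also have "\<dots> = cmean 0 \<rho> (\<lambda>z. ln (norm (G z)))"
      proof (rule cmean_cong)
        fix z assume "z \<in> sphere (0::complex) \<rho>"
        then have "z \<noteq> 0" using \<rho> by auto
        then show "poisson 0 z * ln (norm (G z)) = ln (norm (G z))" by simp
      qed (use \<rho> in simp)
      finally show ?thesis .
    qed
    have w: "0 \<le> u z - ln (norm (G z))" if "norm z = R" for z
    proof -
      have "ln (norm (G z)) \<le> ln (exp (u z))" using Gu[of z] R(3)[of G z] that by (intro ln_mono) auto
      then show ?thesis by simp
    qed
    have "cmean b r u \<le> cmean 0 R (\<lambda>\<zeta>. poisson b \<zeta> * u \<zeta>)"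
      using R r by (intro cmean_u_poisson) auto
    also have "\<dots> = cmean 0 R (\<lambda>\<zeta>. poisson b \<zeta> * (u \<zeta> - ln (norm (G \<zeta>))) + poisson b \<zeta> * ln (norm (G \<zeta>)))"
      by (simp add: algebra_simps)
    also have "\<dots> = cmean 0 R (\<lambda>\<zeta>. poisson b \<zeta> * (u \<zeta> - ln (norm (G \<zeta>)))) + cmean 0 R (\<lambda>\<zeta>. poisson b \<zeta> * ln (norm (G \<zeta>)))"
      using R0 by (intro cmean_add continuous_on_mult continuous_on_diff cP cl u_continuous) auto
    also have "cmean 0 R (\<lambda>\<zeta>. poisson b \<zeta> * (u \<zeta> - ln (norm (G \<zeta>)))) \<le> cmean 0 R (\<lambda>\<zeta>. 3 * (u \<zeta> - ln (norm (G \<zeta>))))"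
    proof (rule cmean_mono)
      fix \<zeta> assume \<zeta>: "\<zeta> \<in> sphere (0::complex) R"
      have "poisson b \<zeta> \<le> (R + norm b) / (R - norm b)" using poisson_le[of b \<zeta>] \<zeta> R0 by simp
      also have "\<dots> \<le> 3"
      proof -
        have "2 * norm b \<le> R" using R(1) elim(2) norm_ge_zero[of b] by linarith
        then have "R - norm b > 0" "R + norm b \<le> 3 * (R - norm b)" using R0(2) by (simp_all add: algebra_simps)
        then show ?thesis by (simp add: pos_divide_le_eq)
      qed
      finally show "poisson b \<zeta> * (u \<zeta> - ln (norm (G \<zeta>))) \<le> 3 * (u \<zeta> - ln (norm (G \<zeta>)))"
        using w \<zeta> by (intro mult_right_mono) auto
    qed (use R0 in \<open>auto intro!: continuous_on_mult continuous_on_diff continuous_on_const cP cl u_continuous\<close>)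
    also have "\<dots> = 3 * (T R + u 0 - cmean 0 R (\<lambda>z. ln (norm (G z))))"
      unfolding cmean_cmult T_eq using R0 by (simp add: cmean_diff u_continuous cl)
    also have "\<dots> \<le> 3 * (T (4 * r) + c1)"
      using mG[of R] TR unfolding c1_def by (intro mult_left_mono) auto
    also have "3 * (T (4 * r) + c1) \<le> 3 * (1 + c1) * T (4 * r)"
      using c1 elim mult_left_mono[of 1 "T (4 * r)" c1] by (simp add: algebra_simps)
    also have "cmean 0 R (\<lambda>\<zeta>. poisson b \<zeta> * ln (norm (G \<zeta>))) = ln (norm (G b)) + (\<Sum>a\<in>zeros_in G R. real (zmult G a) * green R a b)"
      using Poisson_Jensen[OF nz(1) _ R0(2) nz(3)] R(3)[of G] by simp
    also have "(\<Sum>a\<in>zeros_in G R. real (zmult G a) * green R a b) \<le> (\<Sum>a\<in>zeros_in G R. real (zmult G a) * (2 * R / \<delta>))"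
    proof (intro sum_mono mult_left_mono)
      fix a assume a: "a \<in> zeros_in G R"
      then have Ga: "G a = 0" "norm a \<le> R" by (auto simp: zeros_in_def)
      then have d: "\<delta> \<le> norm (b - a)" using \<delta>(2)[of a] by (auto simp: dist_norm not_less[symmetric])
      have "norm ((of_real R)\<^sup>2 - cnj a * b) \<le> R\<^sup>2 + norm a * norm b"
        using norm_triangle_ineq4[of "(of_real R)\<^sup>2" "cnj a * b"] R0 by (simp add: norm_power norm_mult)
      also have "\<dots> \<le> R * R + R * R"
        using Ga R0 by (auto simp: power2_eq_square intro!: mult_mono)
      finally have "norm ((of_real R)\<^sup>2 - cnj a * b) / R \<le> 2 * R" using R0 by (simp add: field_simps)
      moreover have "norm a \<noteq> R" using R(3)[of G a] Ga by auto
      then have "(of_real R)\<^sup>2 - cnj a * b \<noteq> 0"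
      proof -
        have "norm a * norm b \<le> R * norm b" using Ga by (intro mult_right_mono) auto
        also have "\<dots> < R * R" using R0 by (intro mult_strict_left_mono) auto
        finally have "norm (cnj a * b) < norm ((of_real R :: complex)\<^sup>2)" using R0 by (simp add: norm_mult norm_power power2_eq_square)
        then show ?thesis by auto
      qed
      ultimately have "ln (norm ((of_real R)\<^sup>2 - cnj a * b) / R) \<le> ln (2 * R)" using R0 by (intro ln_mono) auto
      moreover have "ln \<delta> \<le> ln (norm (b - a))" using d \<delta> by (intro ln_mono) auto
      ultimately have "green R a b \<le> ln (2 * R) - ln \<delta>" unfolding green_def by simp
      also have "\<dots> = ln (2 * R / \<delta>)" using R0 \<delta> by (simp add: ln_divide_pos)
      \<comment> \<open>The crude \<open>ln x \<le> x\<close> is responsible for the factor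
        \<open>r\<close> in the conclusion.\<close>
      also have "\<dots> \<le> 2 * R / \<delta>" using R0 \<delta> ln_le_minus_one[of "2 * R / \<delta>"] by simp
      finally show "green R a b \<le> 2 * R / \<delta>" .
    qed auto
    also have "\<dots> = zcount G R * (2 * R / \<delta>)" unfolding zcount_def sum_distrib_right ..
    also have "zcount G R * (2 * R / \<delta>) \<le> ((1 + c1) / ln 2 * T (4 * r)) * (4 * r / \<delta>)"
    proof (rule mult_mono)
      have "zcount G R * ln 2 \<le> zcount G R * ln (R' / R)"
        using R0 by (intro mult_left_mono ln_mono zcount_nonneg) (auto simp: field_simps)
      also have "\<dots> \<le> cmean 0 R' (\<lambda>z. ln (norm (G z))) - cmean 0 R (\<lambda>z. ln (norm (G z)))"
        using R0 R(3)[of G] R'(3)[of G] by (intro zcount_ln_le[OF nz(1)]) auto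
      also have "cmean 0 R' (\<lambda>z. ln (norm (G z))) \<le> T R' + u 0 + cmean 0 R' (\<lambda>_. 0)"
        using R0 R'(3)[of G] Gu by (intro cmean_ln_le hG) auto
      also have "T R' + u 0 + cmean 0 R' (\<lambda>_. 0) - cmean 0 R (\<lambda>z. ln (norm (G z))) \<le> T (4 * r) + c1"
        using mG[of R] TR unfolding c1_def by (simp only: cmean_const) linarith
      also have "\<dots> \<le> (1 + c1) * T (4 * r)"
        using c1 elim mult_left_mono[of 1 "T (4 * r)" c1] by (simp add: algebra_simps)
      finally show "zcount G R \<le> (1 + c1) / ln 2 * T (4 * r)" by (simp add: field_simps)
      show "2 * R / \<delta> \<le> 4 * r / \<delta>" using R \<delta> r by (intro divide_right_mono) auto
    qed (use c1 elim R0 \<delta> in auto)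
    finally have "cmean b r u \<le> 3 * (1 + c1) * T (4 * r) + (ln (norm (G b)) + (1 + c1) / ln 2 * T (4 * r) * (4 * r / \<delta>))"
      by simp
    also have "\<dots> \<le> C * r * T (4 * r)"
    proof -
      have t: "T (4 * r) \<le> r * T (4 * r)" using elim r mult_right_mono[of 1 r "T (4 * r)"] by simp
      have "3 * (1 + c1) * T (4 * r) \<le> 3 * (1 + c1) * (r * T (4 * r))"
        using t c1 by (intro mult_left_mono) auto
      moreover have "ln (norm (G b)) \<le> \<bar>ln (norm (G b))\<bar> * (r * T (4 * r))"
      proof -
        have "1 \<le> r * T (4 * r)" using t elim by linarith
        then have "\<bar>ln (norm (G b))\<bar> * 1 \<le> \<bar>ln (norm (G b))\<bar> * (r * T (4 * r))" by (intro mult_left_mono) auto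
        then show ?thesis by linarith
      qed
      moreover have "(1 + c1) / ln 2 * T (4 * r) * (4 * r / \<delta>) = (1 + c1) / ln 2 * (4 / \<delta>) * (r * T (4 * r))"
        by (simp add: field_simps)
      moreover have "C * r * T (4 * r) = 3 * (1 + c1) * (r * T (4 * r)) + \<bar>ln (norm (G b))\<bar> * (r * T (4 * r)) + (1 + c1) / ln 2 * (4 / \<delta>) * (r * T (4 * r))"
        unfolding C_def by (simp only: distrib_right mult.assoc)
      ultimately show ?thesis by linarith
    qed
    finally show ?case .
  qed
  then show ?thesis using C by blast
qed

text \<open>\<open>nevanlinna_T_quotient_le\<close> needs the mean of \<open>V\<close>, which is
  given, and the zero count of \<open>Q\<close>, which Jensen's formula bounds by a mean of
  \<open>V\<close> over a circle of radius below \<open>3 * r\<close>. All large radii are covered,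
  as a limit superior demands; \<open>exp_powr_absorb\<close> removes the factors.\<close>

lemma hyper_order_quotient:
  assumes top: "filterlim T at_top at_top" and ho: "hyper_order T < 1"
    and P: "entire_nz P" and Q: "entire_nz Q" and V: "continuous_on UNIV V"
    and bd: "\<And>z. norm (P z) \<le> exp (V z)" "\<And>z. norm (Q z) \<le> exp (V z)"
    and VT: "C > 0" "\<forall>\<^sub>F r in at_top. cmean 0 r V \<le> C * r * T (4 * r)"
  shows "hyper_order (\<lambda>r. nevanlinna_T r (remove_sings (\<lambda>z. P z / Q z))) < 1"
proof -
  obtain \<sigma> where \<sigma>: "0 < \<sigma>" "\<sigma> < 1" "\<forall>\<^sub>F r in at_top. T r \<le> exp (r powr \<sigma>)"
    using hyper_order_less_1D[OF ho] by blast
  obtain C' where C': "\<And>r. r \<ge> 1 \<Longrightarrow> nevanlinna_T r (remove_sings (\<lambda>z. P z / Q z)) \<le> cmean 0 r V + C' * (zcount Q (r + 1) + 1)"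
    using nevanlinna_T_quotient_le[OF P Q V bd] by blast
  have hQ: "Q holomorphic_on UNIV" using Q by (simp add: entire_nz_def)
  obtain s0 where s0: "1 < s0" "s0 < 2" "\<And>z. norm z = s0 \<Longrightarrow> Q z \<noteq> 0"
    using good_radius_exists[of "{Q}" 1 2 0] Q by auto
  define c2 where "c2 = \<bar>cmean 0 s0 (\<lambda>z. ln (norm (Q z)))\<bar>"
  define D where "D = C + \<bar>C'\<bar> * ((3 * C + c2) / ln 2 + 1)"
  have D: "D > 0" unfolding D_def c2_def using VT by (intro add_pos_nonneg) auto
  obtain r0 where r0: "\<And>r. r \<ge> r0 \<Longrightarrow> cmean 0 r V \<le> C * r * T (4 * r)"
    using VT(2) unfolding eventually_at_top_linorder by blast
  \<comment> \<open>12 is 4 times 3: the hypothesis on \<open>V\<close> is applied at a radius below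
    \<open>3 * r\<close>.\<close>
  have "filterlim (\<lambda>r::real. 12 * r) at_top at_top" by real_asymp
  from filterlim_compose[OF top this] have "\<forall>\<^sub>F r in at_top. 1 \<le> T (12 * r)"
    by (simp add: filterlim_at_top)
  moreover have "\<forall>\<^sub>F r in at_top. T (12 * r) \<le> exp ((12 * r) powr \<sigma>)"
    by (rule eventually_compose_filterlim[OF \<sigma>(3)]) real_asymp
  moreover have "\<forall>\<^sub>F r in at_top. D * r * exp ((12 * r) powr \<sigma>) \<le> exp (r powr ((1 + \<sigma>) / 2))"
    using \<sigma> D by (intro exp_powr_absorb) auto
  ultimately have "\<forall>\<^sub>F r in at_top. nevanlinna_T r (remove_sings (\<lambda>z. P z / Q z)) \<le> exp (r powr ((1 + \<sigma>) / 2))"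
    using eventually_ge_at_top[of "max r0 5"]
  proof eventually_elim
    case (elim r)
    have r: "r \<ge> r0" "r \<ge> 5" using elim by auto
    obtain s where s: "r + 1 < s" "s < r + 2" "\<And>z. norm z = s \<Longrightarrow> Q z \<noteq> 0"
      using good_radius_exists[of "{Q}" "r + 1" "r + 2" 0] Q by auto
    obtain s' where s': "2 * r + 4 < s'" "s' < 3 * r" "\<And>z. norm z = s' \<Longrightarrow> Q z \<noteq> 0"
      using good_radius_exists[of "{Q}" "2 * r + 4" "3 * r" 0] Q r by auto
    have T12: "T (4 * \<rho>) \<le> T (12 * r)" if "0 < \<rho>" "\<rho> \<le> 3 * r" for \<rho>
      using that by (intro T_mono) auto
    have "zcount Q (r + 1) * ln 2 \<le> zcount Q s * ln (s' / s)"
      using s s' r by (intro mult_mono zcount_mono[OF Q] zcount_nonneg ln_mono) (auto simp: field_simps)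
    also have "\<dots> \<le> cmean 0 s' (\<lambda>z. ln (norm (Q z))) - cmean 0 s (\<lambda>z. ln (norm (Q z)))"
      using s s' r by (intro zcount_ln_le[OF Q]) auto
    also have "\<dots> \<le> cmean 0 s' V + c2"
    proof -
      have "cmean 0 s0 (\<lambda>z. ln (norm (Q z))) \<le> cmean 0 s (\<lambda>z. ln (norm (Q z)))"
        using s s0 r by (intro mean_ln_mono[OF Q]) auto
      moreover have "cmean 0 s' (\<lambda>z. ln (norm (Q z))) \<le> cmean 0 s' V"
      proof (rule cmean_mono)
        fix z assume "z \<in> sphere (0::complex) s'"
        then have "ln (norm (Q z)) \<le> ln (exp (V z))" using bd(2)[of z] s'(3)[of z] by (intro ln_mono) auto
        then show "ln (norm (Q z)) \<le> V z" by simp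
      qed (use s' r in \<open>auto intro!: continuous_ln_norm hQ continuous_on_subset[OF V]\<close>)
      ultimately show ?thesis unfolding c2_def by linarith
    qed
    also have "cmean 0 s' V \<le> C * s' * T (4 * s')" using s' r by (intro r0) auto
    also have "C * s' * T (4 * s') \<le> C * (3 * r) * T (12 * r)"
    proof -
      have "C * s' * T (4 * s') \<le> C * s' * T (12 * r)" using s' r VT by (intro mult_left_mono T12) auto
      also have "\<dots> \<le> C * (3 * r) * T (12 * r)" using s' r VT elim by (intro mult_right_mono mult_left_mono) auto
      finally show ?thesis .
    qed
    also have "C * (3 * r) * T (12 * r) + c2 \<le> (3 * C + c2) * (r * T (12 * r))"
    proof -
      have "1 * 1 \<le> r * T (12 * r)" using r elim by (intro mult_mono) auto
      then have "c2 * 1 \<le> c2 * (r * T (12 * r))" unfolding c2_def by (intro mult_left_mono) auto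
      then show ?thesis by (simp add: algebra_simps)
    qed
    finally have z: "zcount Q (r + 1) \<le> (3 * C + c2) / ln 2 * (r * T (12 * r))" by (simp add: field_simps)
    have rT: "1 \<le> r * T (12 * r)" using r elim mult_mono[of 1 r 1 "T (12 * r)"] by simp
    have "nevanlinna_T r (remove_sings (\<lambda>z. P z / Q z)) \<le> cmean 0 r V + C' * (zcount Q (r + 1) + 1)"
      using r by (intro C') auto
    also have "cmean 0 r V \<le> C * r * T (4 * r)" using r by (intro r0)
    also have "C * r * T (4 * r) \<le> C * r * T (12 * r)" using r VT by (intro mult_left_mono T12) auto
    also have "C' * (zcount Q (r + 1) + 1) \<le> \<bar>C'\<bar> * (zcount Q (r + 1) + 1)"
      using zcount_nonneg[of Q "r + 1"] by (intro mult_right_mono) auto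
    also have "\<dots> \<le> \<bar>C'\<bar> * ((3 * C + c2) / ln 2 * (r * T (12 * r)) + r * T (12 * r))"
      by (intro mult_left_mono add_mono z rT) auto
    also have "C * r * T (12 * r) + \<bar>C'\<bar> * ((3 * C + c2) / ln 2 * (r * T (12 * r)) + r * T (12 * r)) = D * r * T (12 * r)"
      unfolding D_def by (simp add: algebra_simps)
    also have "\<dots> \<le> D * r * exp ((12 * r) powr \<sigma>)" using elim D r by (intro mult_left_mono) auto
    also have "\<dots> \<le> exp (r powr ((1 + \<sigma>) / 2))" using elim by simp
    finally show ?case by simp
  qed
  then show ?thesis using \<sigma> by (intro hyper_order_less_1I[of "(1 + \<sigma>) / 2"]) auto
qed

section \<open>The Casorati determinant does not vanish identically\<close>

lemma constant_in_periodic_field: "(\<lambda>_. k) \<in> periodic_field c"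
proof -
  have "nevanlinna_T r (\<lambda>_. k) = log_plus (norm k)" for r
  proof -
    have "\<not> is_pole (\<lambda>_::complex. k) z" for z
      by (rule not_is_pole_holomorphic[of UNIV]) auto
    then show ?thesis by (simp add: nevanlinna_T_def nevanlinna_m_def nevanlinna_N_def pole_count_def)
  qed
  moreover have "\<forall>\<^sub>F r::real in at_top. log_plus (norm k) \<le> exp (r powr (1/2))"
    by real_asymp
  ultimately have "hyper_order (\<lambda>r. nevanlinna_T r (\<lambda>_. k)) < 1"
    by (intro hyper_order_less_1I[of "1/2"]) auto
  then show ?thesis by (auto simp: periodic_field_def)
qed

text \<open>Constants lie in the periodic field, so independence over it contains the independence
  over the complex numbers that \<open>T_at_top\<close> requires.\<close>

lemma lincomb_independent:
  assumes "lin_indep_over (periodic_field c) {0..n} g" "\<forall>z. lincomb \<mu> z = 0"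
  shows "\<forall>k\<le>n. \<mu> k = 0"
proof -
  have "\<forall>j\<in>{0..n}. (\<lambda>_. \<mu> j) \<in> periodic_field c" using constant_in_periodic_field by blast
  moreover have "\<forall>\<^sub>\<approx>z\<in>UNIV. (\<Sum>j\<in>{0..n}. \<mu> j * g j z) = 0"
    using assms(2) unfolding lincomb_def atMost_atLeast0 by (intro always_eventually) simp
  ultimately have "\<forall>j\<in>{0..n}. \<forall>z::complex. \<mu> j = 0"
    using assms(1)[unfolded lin_indep_over_def, rule_format, of "\<lambda>j _. \<mu> j"] by blast
  then show ?thesis by auto
qed

text \<open>If the leading minor of size \<open>k + 1\<close> is the first one that vanishes identically, then the minors
  \<open>b\<^sub>j\<close> of its last row satisfy the same relations, up to a common factor, at \<open>z\<close> and at \<open>z + c\<close>. Hence the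
  quotients \<open>b\<^sub>j / b\<^sub>k\<close> are periodic, and they are the coefficients of a forbidden relation.\<close>

lemma casorati_nonzero:
  assumes n: "n \<ge> 1" and ho: "hyper_order T < 1"
    and indep: "lin_indep_over (periodic_field c) {0..n} g"
  shows "entire_nz (casorati c n g)"
proof -
  have top: "filterlim T at_top at_top"
    using T_at_top[OF n] lincomb_independent[OF indep] by blast
  define M where "M z = (\<lambda>i j. g j (z + of_nat i * c))" for z
  have gh: "(\<lambda>z. g j (z + b)) holomorphic_on UNIV" if "j \<le> n" for j b
    by (rule holomorphic_on_compose_gen[of "\<lambda>z. z + b" UNIV "g j" UNIV, unfolded o_def])
       (use g_hol[OF that] in \<open>auto intro!: holomorphic_intros\<close>)
  have Wh: "(\<lambda>z. dmat k (M z)) holomorphic_on UNIV" if "k \<le> Suc n" for k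
    unfolding M_def using that by (intro dmat_holomorphic gh) auto
  have cas: "casorati c n g = (\<lambda>z. dmat (Suc n) (M z))"
    by (simp add: casorati_def M_def fun_eq_iff)
  show ?thesis
  proof (rule ccontr)
    assume "\<not> ?thesis"
    then have "\<forall>z. dmat (Suc n) (M z) = 0" using Wh[of "Suc n"] unfolding cas entire_nz_def by auto
    then have ex: "\<exists>k. k \<le> n \<and> (\<forall>z. dmat (Suc k) (M z) = 0)" by blast
    define k where "k = (LEAST k. k \<le> n \<and> (\<forall>z. dmat (Suc k) (M z) = 0))"
    have k: "k \<le> n" "\<And>z. dmat (Suc k) (M z) = 0" using LeastI_ex[OF ex] unfolding k_def by blast+
    have Wk: "entire_nz (\<lambda>z. dmat k (M z))"
    proof (cases k)
      \<comment> \<open>The empty determinant is 1.\<close>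
      case 0
      then show ?thesis by (auto simp: entire_nz_def dmat_expand)
    next
      case (Suc k')
      then have "k' < k" by simp
      from not_less_Least[OF this[unfolded k_def]]
      have "\<not> (k' \<le> n \<and> (\<forall>z. dmat (Suc k') (M z) = 0))" .
      then show ?thesis using Suc k Wh[of k] by (auto simp: entire_nz_def)
    qed
    define b where "b j z = minor k (M z) k j" for j z
    have ii: "insert_index k i = i" if "i < k" for i using that by (simp add: insert_index_def)
    have bk: "b k z = dmat k (M z)" for z
    proof -
      have "Matrix.mat k k (\<lambda>(i, j). M z (insert_index k i) (insert_index k j)) = Matrix.mat k k (\<lambda>(i, j). M z i j)"
        by (rule eq_matI) (auto simp: ii)
      then show ?thesis by (simp add: b_def minor_def power_add[symmetric] mult_2[symmetric])
    qed
    have bnz: "entire_nz (b k)" using Wk by (simp add: bk[abs_def])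
    have bh: "b j holomorphic_on UNIV" if "j \<le> k" for j
      unfolding b_def minor_def M_def
      by (intro holomorphic_intros dmat_holomorphic gh) (use that k in \<open>auto simp: insert_index_def\<close>)
    \<comment> \<open>For \<open>i < k\<close> this expands a determinant with a repeated row, for
      \<open>i = k\<close> the vanishing minor of size \<open>k + 1\<close>.\<close>
    have rel: "(\<Sum>j<Suc k. g j (z + of_nat i * c) * b j z) = 0" if "i < Suc k" for i z
      using minor_expansion[OF that lessI, of "M z"] k(2)[of z] by (simp add: b_def M_def del: sum.lessThan_Suc split: if_splits)
    \<comment> \<open>A common logarithmic bound for all minors; its mean is, up to a constant, a
      sum of means of \<open>u\<close> about the points \<open>i c\<close>, which
      \<open>cmean_u_crude\<close> controls.\<close>
    define V where "V z = ln (fact k) + (\<Sum>i = 0..<k. u (z + of_nat i * c))" for z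
    have bV: "norm (b j z) \<le> exp (V z)" if "j \<le> k" for j z
    proof -
      have "norm (dmat k (\<lambda>i j'. M z (insert_index k i) (insert_index j j'))) \<le> fact k * (\<Prod>i = 0..<k. exp (u (z + of_nat i * c)))"
        by (rule norm_dmat_le) (use that k in \<open>auto simp: M_def insert_index_def intro!: norm_g_le\<close>)
      also have "\<dots> = exp (V z)" by (simp add: V_def exp_add exp_sum)
      finally show ?thesis by (simp add: b_def minor_def norm_mult norm_power)
    qed
    have cV: "continuous_on UNIV V"
      unfolding V_def by (intro continuous_intros continuous_on_compose2[OF u_continuous[of UNIV]]) auto
    have VT: "\<exists>C>0. \<forall>\<^sub>F r in at_top. cmean 0 r V \<le> C * r * T (4 * r)"
    proof -
      have "\<forall>i. \<exists>C>0. \<forall>\<^sub>F r in at_top. cmean (of_nat i * c) r u \<le> C * r * T (4 * r)"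
        using cmean_u_crude[OF top] by blast
      from choice[OF this] obtain C where "\<forall>i. C i > 0 \<and> (\<forall>\<^sub>F r in at_top. cmean (of_nat i * c) r u \<le> C i * r * T (4 * r))" ..
      then have C: "\<And>i. C i > 0" "\<And>i. \<forall>\<^sub>F r in at_top. cmean (of_nat i * c) r u \<le> C i * r * T (4 * r)"
        by blast+
      define C' where "C' = 1 + ln (fact k) + (\<Sum>i = 0..<k. C i)"
      have lf: "0 \<le> ln (fact k :: real)" by (simp add: fact_ge_1)
      have C'0: "C' > 0" unfolding C'_def using lf C(1) by (intro add_pos_nonneg sum_nonneg) (auto intro: less_imp_le)
      have "\<forall>\<^sub>F r in at_top. \<forall>i\<in>{0..<k}. cmean (of_nat i * c) r u \<le> C i * r * T (4 * r)"
        by (rule eventually_ball_finite) (use C in auto)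
      moreover have "filterlim (\<lambda>r::real. 4 * r) at_top at_top" by real_asymp
      from filterlim_compose[OF top this] have "\<forall>\<^sub>F r in at_top. 1 \<le> T (4 * r)"
        by (simp add: filterlim_at_top)
      ultimately have "\<forall>\<^sub>F r in at_top. cmean 0 r V \<le> C' * r * T (4 * r)"
        using eventually_ge_at_top[of 1]
      proof eventually_elim
        case (elim r)
        have cu: "continuous_on (sphere 0 r) (\<lambda>z. u (z + of_nat i * c))" for i
          by (intro continuous_on_compose2[OF u_continuous[of UNIV]] continuous_intros) auto
        have "cmean 0 r V = ln (fact k) + cmean 0 r (\<lambda>z. \<Sum>i = 0..<k. u (z + of_nat i * c))"
          unfolding V_def using elim by (subst cmean_add) (auto intro!: continuous_on_sum cu)
        also have "cmean 0 r (\<lambda>z. \<Sum>i = 0..<k. u (z + of_nat i * c)) = (\<Sum>i = 0..<k. cmean (of_nat i * c) r u)"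
          using elim by (subst cmean_sum) (auto intro!: cu sum.cong simp: cmean_shift[symmetric])
        also have "\<dots> \<le> (\<Sum>i = 0..<k. C i * r * T (4 * r))" using elim by (intro sum_mono) auto
        also have "\<dots> = (\<Sum>i = 0..<k. C i) * (r * T (4 * r))" by (simp add: sum_distrib_right mult.assoc)
        also have "ln (fact k) \<le> (1 + ln (fact k)) * (r * T (4 * r))"
        proof -
          have "1 * 1 \<le> r * T (4 * r)" using elim by (intro mult_mono) auto
          then have "(1 + ln (fact k)) * 1 \<le> (1 + ln (fact k)) * (r * T (4 * r))" using lf by (intro mult_left_mono) auto
          then show ?thesis by simp
        qed
        finally show ?case by (simp add: C'_def algebra_simps)
      qed
      then show ?thesis using C'0 by blast
    qed
    \<comment> \<open>\<open>hyper_order_quotient\<close> asks for a numerator that is not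
      identically zero, so vanishing minors get the coefficient 0 directly.
      \<open>remove_sings\<close> supplies the representative that \<open>periodic_field\<close>
      requires.\<close>
    define \<beta> where "\<beta> j = (if j \<le> k \<and> entire_nz (b j) then remove_sings (\<lambda>z. b j z / b k z) else (\<lambda>_. 0))" for j
    have per: "b j (z + c) * b k z = b j z * b k (z + c)" if j: "j \<le> k" for j z
    proof -
      have eq: "b i w * b k (w + c) - b i (w + c) * b k w = 0" if w: "b k (w + c) \<noteq> 0" and i: "i < k" for i w
      proof (rule ccontr)
        assume ne: "b i w * b k (w + c) - b i (w + c) * b k w \<noteq> 0"
        \<comment> \<open>The relations for rows 1 to \<open>k\<close> at \<open>w\<close> and for
          rows 0 to \<open>k - 1\<close> at \<open>w + c\<close> have the same coefficients. This
          combination of the two solutions eliminates the unknown with index \<open>k\<close> and so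
          lies in the kernel of the minor of size \<open>k\<close> at \<open>w + c\<close>.\<close>
        define d where "d i = b i w * b k (w + c) - b i (w + c) * b k w" for i
        have "(\<Sum>j<k. M (w + c) l j * d j) = 0" if l: "l < k" for l
        proof -
          have r1: "(\<Sum>j<Suc k. g j (w + c + of_nat l * c) * b j w) = 0"
            using rel[of "Suc l" w] l by (simp add: algebra_simps del: sum.lessThan_Suc)
          have r2: "(\<Sum>j<Suc k. g j (w + c + of_nat l * c) * b j (w + c)) = 0"
            using rel[of l "w + c"] l by (simp del: sum.lessThan_Suc)
          have "(\<Sum>j<k. M (w + c) l j * d j) = (\<Sum>j<Suc k. M (w + c) l j * d j)" by (simp add: d_def)
          also have "\<dots> = b k (w + c) * (\<Sum>j<Suc k. g j (w + c + of_nat l * c) * b j w)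
               - b k w * (\<Sum>j<Suc k. g j (w + c + of_nat l * c) * b j (w + c))"
            unfolding d_def M_def sum_distrib_left sum_subtractf[symmetric] by (intro sum.cong) (auto simp: algebra_simps)
          also have "\<dots> = 0" unfolding r1 r2 by simp
          finally show ?thesis .
        qed
        then have "dmat k (M (w + c)) = 0"
          unfolding dmat_eq_0_iff using ne i by (intro exI[of _ d]) (auto simp: d_def)
        then show False using w by (simp add: bk)
      qed
      show ?thesis
      proof (cases "j = k")
        case False
        \<comment> \<open>The identity is known only where \<open>b k (z + c) \<noteq> 0\<close>;
          the product with this factor vanishes everywhere, and entire functions have no zero
          divisors.\<close>
        define D where "D z = b j z * b k (z + c) - b j (z + c) * b k z" for z
        have sh: "(\<lambda>z. b i (z + c)) holomorphic_on UNIV" if "i \<le> k" for i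
          by (rule holomorphic_on_compose_gen[of "\<lambda>z. z + c" UNIV "b i" UNIV, unfolded o_def])
             (use bh[OF that] in \<open>auto intro!: holomorphic_intros\<close>)
        have Dh: "D holomorphic_on UNIV" unfolding D_def using j by (intro holomorphic_intros bh sh) auto
        have "b k (z + c) * D z = 0" for z using eq[of z j] j False by (cases "b k (z + c) = 0") (auto simp: D_def)
        then have "\<not> entire_nz D" using entire_nz_mult[OF entire_nz_shift[OF bnz], of D c] by (auto simp: entire_nz_def)
        then show ?thesis using Dh by (auto simp: entire_nz_def D_def mult.commute)
      qed simp
    qed
    have ev: "\<forall>\<^sub>F z in at w. b k z \<noteq> 0 \<and> b k (z + c) \<noteq> 0" for w
      using entire_nz_frequently[OF bnz] entire_nz_frequently[OF entire_nz_shift[OF bnz]] by (intro eventually_conj)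
    have \<beta>val: "\<beta> j z = b j z / b k z" if "j \<le> k" "b k z \<noteq> 0" for j z
    proof (cases "entire_nz (b j)")
      case True
      have "(\<lambda>z. b j z / b k z) analytic_on {z}"
        using that bh[of j] bh[of k] by (intro analytic_intros) (auto simp: analytic_on_holomorphic)
      then show ?thesis using True that by (simp add: \<beta>_def)
    next
      case False
      then show ?thesis using that bh[of j] by (auto simp: \<beta>_def entire_nz_def)
    qed
    have \<beta>per: "\<beta> j (z + c) = \<beta> j z" for j z
    proof (cases "j \<le> k \<and> entire_nz (b j)")
      case True
      \<comment> \<open>Both values of \<open>remove_sings\<close> are moved to the origin, where
        the two germs are compared off the zeros of the denominators.\<close>
      have "remove_sings (\<lambda>z. b j z / b k z) (z + c) = remove_sings (\<lambda>w. b j (z + c + w) / b k (z + c + w)) 0"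
        by (rule remove_sings_shift_0)
      also have "\<dots> = remove_sings (\<lambda>w. b j (z + w) / b k (z + w)) 0"
      proof (rule remove_sings_cong[OF _ refl])
        have "\<forall>\<^sub>F w in at 0. b k (w + z) \<noteq> 0 \<and> b k (w + z + c) \<noteq> 0"
          using ev[of z] by (subst (asm) at_to_0) (simp add: eventually_filtermap)
        then show "\<forall>\<^sub>F w in at 0. b j (z + c + w) / b k (z + c + w) = b j (z + w) / b k (z + w)"
        proof eventually_elim
          case (elim w)
          then show ?case using per[of j "w + z"] True by (simp add: field_simps add_ac)
        qed
      qed
      also have "\<dots> = remove_sings (\<lambda>z. b j z / b k z) z" by (rule remove_sings_shift_0[symmetric])
      finally show ?thesis using True by (simp add: \<beta>_def)
    qed (auto simp: \<beta>_def)
    have \<beta>K: "\<beta> j \<in> periodic_field c" for j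
    proof (cases "j \<le> k \<and> entire_nz (b j)")
      case True
      obtain C where C: "C > 0" "\<forall>\<^sub>F r in at_top. cmean 0 r V \<le> C * r * T (4 * r)" using VT by blast
      have "hyper_order (\<lambda>r. nevanlinna_T r (remove_sings (\<lambda>z. b j z / b k z))) < 1"
        using True by (intro hyper_order_quotient[OF top ho _ bnz cV _ _ C] bV) auto
      moreover have "(\<lambda>z. b j z / b k z) meromorphic_on UNIV"
        using True bh by (intro meromorphic_intros analytic_on_imp_meromorphic_on) (auto simp: analytic_on_open)
      then have "remove_sings (\<lambda>z. b j z / b k z) nicely_meromorphic_on UNIV" by (rule remove_sings_nicely_meromorphic)
      ultimately show ?thesis using True \<beta>per[of j] by (simp add: periodic_field_def \<beta>_def)
    next
      case False
      then have "\<beta> j = (\<lambda>_. 0)" by (auto simp: \<beta>_def)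
      then show ?thesis using constant_in_periodic_field by simp
    qed
    have "\<forall>\<^sub>\<approx>z\<in>UNIV. (\<Sum>j\<in>{0..n}. \<beta> j z * g j z) = 0"
      unfolding eventually_cosparse_open_eq[OF open_UNIV]
    proof
      fix w
      show "\<forall>\<^sub>F z in at w. (\<Sum>j\<in>{0..n}. \<beta> j z * g j z) = 0"
        using ev[of w]
      proof eventually_elim
        case (elim z)
        have "(\<Sum>j\<in>{0..n}. \<beta> j z * g j z) = (\<Sum>j<Suc k. \<beta> j z * g j z)"
          using k by (intro sum.mono_neutral_right) (auto simp: \<beta>_def)
        also have "\<dots> = (\<Sum>j<Suc k. g j (z + of_nat 0 * c) * b j z) / b k z"
          unfolding sum_divide_distrib using elim by (intro sum.cong) (auto simp: \<beta>val)
        also have "\<dots> = 0" using rel[of 0 z] by (simp del: sum.lessThan_Suc)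
        finally show ?case .
      qed
    qed
    \<comment> \<open>The coefficient with index \<open>k\<close> is 1 wherever \<open>b k\<close>
      does not vanish, so the relation is nontrivial.\<close>
    then have "\<forall>z. \<beta> k z = 0" using indep \<beta>K k unfolding lin_indep_over_def by auto
    moreover obtain z where "b k z \<noteq> 0" using bnz by (auto simp: entire_nz_def)
    ultimately show False using \<beta>val[of k z] by simp
  qed
qed

end

section \<open>Estimates outside an exceptional set\<close>

text \<open>Means of \<open>ln (norm F)\<close> increase with the radius, so the value at one good
  radius between 1 and 2 bounds all later ones from below.\<close>

lemma mean_ln_lower:
  assumes F: "entire_nz F"
  shows "\<exists>C\<ge>0. \<forall>\<rho>\<ge>2. (\<forall>z. norm z = \<rho> \<longrightarrow> F z \<noteq> 0) \<longrightarrow> - C \<le> cmean 0 \<rho> (\<lambda>z. ln (norm (F z)))"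
proof -
  obtain s where s: "1 < s" "s < 2" "\<And>z. norm z = s \<Longrightarrow> F z \<noteq> 0"
    using good_radius_exists[of "{F}" 1 2 0] F by auto
  have "- \<bar>cmean 0 s (\<lambda>z. ln (norm (F z)))\<bar> \<le> cmean 0 \<rho> (\<lambda>z. ln (norm (F z)))"
    if \<rho>: "\<rho> \<ge> 2" "\<And>z. norm z = \<rho> \<Longrightarrow> F z \<noteq> 0" for \<rho>
  proof -
    have "cmean 0 s (\<lambda>z. ln (norm (F z))) \<le> cmean 0 \<rho> (\<lambda>z. ln (norm (F z)))"
      by (rule mean_ln_mono[OF F _ _ s(3) \<rho>(2)]) (use s \<rho>(1) in auto)
    then show ?thesis by linarith
  qed
  then show ?thesis using abs_ge_zero by blast
qed

lemma ln_quotient_ge: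
  fixes s s' :: real
  assumes "0 < s" "s < s'"
  shows "(s' - s) / s' \<le> ln (s' / s)"
proof -
  have "ln (s / s') \<le> s / s' - 1" using assms by (intro ln_le_minus_one) auto
  then show ?thesis using assms by (simp add: ln_divide_pos diff_divide_distrib)
qed

context curve
begin

lemma eventually_le_T:
  assumes top: "filterlim T at_top at_top" and "\<epsilon> > 0"
  shows "\<forall>\<^sub>F r in at_top. C \<le> \<epsilon> * T r"
proof -
  have "\<forall>\<^sub>F r in at_top. C / \<epsilon> \<le> T r" using top by (simp add: filterlim_at_top)
  then show ?thesis by eventually_elim (use assms in \<open>simp add: pos_divide_le_eq mult.commute\<close>)
qed

text \<open>Jensen's formula between good circles \<open>s < s'\<close>. With
  \<open>d = r powr (1 - \<tau>)\<close> the quotient \<open>(s' - s) / s'\<close> is at least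
  \<open>(d / 4) / (2 * r) = r powr (- \<tau>) / 8\<close>, and the mean on \<open>s'\<close> is at
  most \<open>3 * T s' \<le> 6 * T r\<close>; with one more \<open>T r\<close> for the constant this
  gives \<open>56 = 8 * 7\<close>. In the second bound the gap is a quarter of \<open>r\<close>,
  whence \<open>16 = 4 * 4\<close>.\<close>

lemma zcount_growth:
  assumes top: "filterlim T at_top at_top" and \<tau>: "0 < \<tau>" "\<tau> < 1" and F: "entire_nz F"
    and upper: "\<forall>\<^sub>F \<rho> in at_top. (\<forall>z. norm z = \<rho> \<longrightarrow> F z \<noteq> 0) \<longrightarrow> cmean 0 \<rho> (\<lambda>z. ln (norm (F z))) \<le> 3 * T \<rho>"
  shows "\<forall>\<^sub>F r in at_top. T (r + r powr (1 - \<tau>)) \<le> 2 * T r \<longrightarrow> zcount F (r + r powr (1 - \<tau>) / 2) \<le> 56 * r powr \<tau> * T r"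
    and "\<forall>\<^sub>F r in at_top. (\<forall>z. norm z = r \<longrightarrow> F z \<noteq> 0) \<longrightarrow> zcount F (r / 2) \<le> 16 * T r"
proof -
  obtain C where C: "C \<ge> 0" "\<And>\<rho>. \<rho> \<ge> 2 \<Longrightarrow> (\<And>z. norm z = \<rho> \<Longrightarrow> F z \<noteq> 0) \<Longrightarrow> - C \<le> cmean 0 \<rho> (\<lambda>z. ln (norm (F z)))"
    using mean_ln_lower[OF F] by blast
  obtain r0 where r0: "\<And>\<rho>. \<rho> \<ge> r0 \<Longrightarrow> (\<And>z. norm z = \<rho> \<Longrightarrow> F z \<noteq> 0) \<Longrightarrow> cmean 0 \<rho> (\<lambda>z. ln (norm (F z))) \<le> 3 * T \<rho>"
    using upper unfolding eventually_at_top_linorder by blast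
  have CT: "\<forall>\<^sub>F r in at_top. C \<le> 1 * T r" by (rule eventually_le_T[OF top]) simp
  show "\<forall>\<^sub>F r in at_top. T (r + r powr (1 - \<tau>)) \<le> 2 * T r \<longrightarrow> zcount F (r + r powr (1 - \<tau>) / 2) \<le> 56 * r powr \<tau> * T r"
    using CT eventually_ge_at_top[of "max r0 2"]
  proof eventually_elim
    case (elim r)
    show ?case
    proof
      assume T2: "T (r + r powr (1 - \<tau>)) \<le> 2 * T r"
      define d where "d = r powr (1 - \<tau>)"
      have r: "r \<ge> 2" "r \<ge> r0" using elim by auto
      have d: "d > 0" using r by (simp add: d_def)
      have "d \<le> r powr 1" unfolding d_def using r \<tau> by (intro powr_mono) auto
      then have dr: "d \<le> r" using r by simp
      obtain s where s: "r + d / 2 < s" "s < r + 5/8 * d" "\<And>z. norm z = s \<Longrightarrow> F z \<noteq> 0"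
        using good_radius_exists[of "{F}" "r + d / 2" "r + 5/8 * d" 0] F d by auto
      obtain s' where s': "r + 7/8 * d < s'" "s' < r + d" "\<And>z. norm z = s' \<Longrightarrow> F z \<noteq> 0"
        using good_radius_exists[of "{F}" "r + 7/8 * d" "r + d" 0] F d by auto
      have "r powr (-\<tau>) / 8 = (d / 4) / (2 * r)"
        using r by (simp add: d_def powr_diff powr_minus field_simps)
      also have "\<dots> \<le> (s' - s) / s'"
        using s s' d dr r by (intro frac_le) auto
      also have "\<dots> \<le> ln (s' / s)" using s s' r d by (intro ln_quotient_ge) auto
      finally have l: "r powr (-\<tau>) / 8 \<le> ln (s' / s)" .
      have "zcount F (r + d / 2) * (r powr (-\<tau>) / 8) \<le> zcount F s * ln (s' / s)"
        using s d r by (intro mult_mono zcount_mono[OF F] l zcount_nonneg) auto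
      also have "\<dots> \<le> cmean 0 s' (\<lambda>z. ln (norm (F z))) - cmean 0 s (\<lambda>z. ln (norm (F z)))"
        using s s' r d by (intro zcount_ln_le[OF F]) auto
      also have "\<dots> \<le> 3 * T s' + C"
        using r0[of s'] C(2)[of s] s s' r d by fastforce
      also have "T s' \<le> 2 * T r"
        using T2 s' r d T_mono[of s' "r + d"] by (simp add: d_def)
      also have "3 * (2 * T r) + C \<le> 7 * T r" using elim by simp
      finally have "zcount F (r + d / 2) * (r powr (-\<tau>) / 8) * (8 * r powr \<tau>) \<le> 7 * T r * (8 * r powr \<tau>)"
        using r by (intro mult_right_mono) auto
      then show "zcount F (r + r powr (1 - \<tau>) / 2) \<le> 56 * r powr \<tau> * T r"
        using r by (simp add: d_def powr_minus field_simps)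
    qed
  qed
  show "\<forall>\<^sub>F r in at_top. (\<forall>z. norm z = r \<longrightarrow> F z \<noteq> 0) \<longrightarrow> zcount F (r / 2) \<le> 16 * T r"
    using CT eventually_ge_at_top[of "max r0 4"]
  proof eventually_elim
    case (elim r)
    show ?case
    proof
      assume good: "\<forall>z. norm z = r \<longrightarrow> F z \<noteq> 0"
      have r: "r \<ge> 4" "r \<ge> r0" using elim by auto
      obtain s where s: "r / 2 < s" "s < 3/4 * r" "\<And>z. norm z = s \<Longrightarrow> F z \<noteq> 0"
        using good_radius_exists[of "{F}" "r / 2" "3/4 * r" 0] F r by auto
      have "1 / 4 \<le> (r - s) / r" using s r by (simp add: field_simps)
      also have "\<dots> \<le> ln (r / s)" using s r by (intro ln_quotient_ge) auto
      finally have "zcount F (r / 2) * (1 / 4) \<le> zcount F s * ln (r / s)"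
        using s r by (intro mult_mono zcount_mono[OF F] zcount_nonneg) auto
      also have "\<dots> \<le> cmean 0 r (\<lambda>z. ln (norm (F z))) - cmean 0 s (\<lambda>z. ln (norm (F z)))"
        using s r good by (intro zcount_ln_le[OF F]) auto
      also have "\<dots> \<le> 3 * T r + C"
        using r0[of r] C(2)[of s] s r good by fastforce
      also have "\<dots> \<le> 4 * T r" using elim by simp
      finally show "zcount F (r / 2) \<le> 16 * T r" by simp
    qed
  qed
qed

text \<open>Both terms of \<open>mean_shift_quotient\<close> become small: the kernel term has order
  \<open>r powr (\<tau> - 1) * T r\<close>, and each zero contributes order
  \<open>r powr (- \<delta>)\<close>, with at most order \<open>r powr \<tau> * T r\<close> of
  them.\<close>

lemma mean_shift_quotient_small:
  assumes top: "filterlim T at_top at_top" and \<tau>: "0 < \<tau>" "\<tau> < 1"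
    and F: "entire_nz F" and G: "entire_nz G"
    and upperF: "\<forall>\<^sub>F \<rho> in at_top. (\<forall>z. norm z = \<rho> \<longrightarrow> F z \<noteq> 0) \<longrightarrow> cmean 0 \<rho> (\<lambda>z. ln (norm (F z))) \<le> 3 * T \<rho>"
    and upperG: "\<forall>\<^sub>F \<rho> in at_top. (\<forall>z. norm z = \<rho> \<longrightarrow> G z \<noteq> 0) \<longrightarrow> cmean 0 \<rho> (\<lambda>z. ln (norm (G z))) \<le> 3 * T \<rho>"
    and upper: "\<forall>\<^sub>F \<rho> in at_top. (\<forall>z. norm z = \<rho> \<longrightarrow> F z \<noteq> 0 \<and> G z \<noteq> 0) \<longrightarrow>
        cmean 0 \<rho> (\<lambda>z. \<bar>ln (norm (F z)) - ln (norm (G z))\<bar>) \<le> 3 * T \<rho>"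
    and \<epsilon>: "\<epsilon> > 0"
  shows "\<forall>\<^sub>F r in at_top. T (r + r powr (1 - \<tau>)) \<le> 2 * T r \<longrightarrow>
      (\<forall>z. norm z = r \<longrightarrow> F z \<noteq> 0 \<and> G z \<noteq> 0 \<and> F (z + b) \<noteq> 0 \<and> G (z + b) \<noteq> 0) \<longrightarrow>
      cmean 0 r (\<lambda>z. \<bar>(ln (norm (F (z + b))) - ln (norm (G (z + b)))) - (ln (norm (F z)) - ln (norm (G z)))\<bar>) \<le> \<epsilon> * T r"
proof -
  \<comment> \<open>The midpoint stands for any exponent strictly between \<open>\<tau>\<close> and
    1.\<close>
  define \<delta> where "\<delta> = (1 + \<tau>) / 2"
  have \<delta>: "0 < \<delta>" "\<delta> < 1" "\<tau> < \<delta>" using \<tau> by (auto simp: \<delta>_def)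
  define K where "K = 8 * norm b powr \<delta> / \<delta> * (circle_const \<delta> / (2*pi))"
  have K: "K \<ge> 0" unfolding K_def circle_const_def using \<delta> by (intro mult_nonneg_nonneg divide_nonneg_nonneg) auto
  obtain r0 where r0: "\<And>\<rho>. \<rho> \<ge> r0 \<Longrightarrow> (\<And>z. norm z = \<rho> \<Longrightarrow> F z \<noteq> 0 \<and> G z \<noteq> 0) \<Longrightarrow>
      cmean 0 \<rho> (\<lambda>z. \<bar>ln (norm (F z)) - ln (norm (G z))\<bar>) \<le> 3 * T \<rho>"
    using upper unfolding eventually_at_top_linorder by blast
  have "((\<lambda>r. 96 * norm b * r powr (\<tau> - 1) + K * 112 * r powr (\<tau> - \<delta>)) \<longlongrightarrow> 0 + 0) at_top"
    using \<tau> \<delta> by (intro tendsto_add tendsto_mult_right_zero tendsto_neg_powr filterlim_ident) auto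
  then have "\<forall>\<^sub>F r in at_top. 96 * norm b * r powr (\<tau> - 1) + K * 112 * r powr (\<tau> - \<delta>) < \<epsilon>"
    using \<epsilon> by (intro order_tendstoD) auto
  moreover have "\<forall>\<^sub>F r in at_top. 8 * norm b + 4 \<le> r powr (1 - \<tau>)"
  proof -
    have "filterlim (\<lambda>r. r powr (1 - \<tau>)) at_top at_top" using \<tau> by real_asymp
    then show ?thesis unfolding filterlim_at_top by blast
  qed
  moreover have "\<forall>\<^sub>F r in at_top. 0 \<le> 1 * T r" by (rule eventually_le_T[OF top]) simp
  ultimately show ?thesis
    using zcount_growth(1)[OF top \<tau> F upperF] zcount_growth(1)[OF top \<tau> G upperG] eventually_ge_at_top[of "max r0 1"]
  proof eventually_elim
    case (elim r)
    show ?case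
    proof (intro impI)
      assume T2: "T (r + r powr (1 - \<tau>)) \<le> 2 * T r"
        and good: "\<forall>z. norm z = r \<longrightarrow> F z \<noteq> 0 \<and> G z \<noteq> 0 \<and> F (z + b) \<noteq> 0 \<and> G (z + b) \<noteq> 0"
      define d where "d = r powr (1 - \<tau>)"
      have r: "r \<ge> 1" "r \<ge> r0" using elim by auto
      have b: "8 * norm b + 4 \<le> d" using elim by (simp add: d_def)
      have d: "d > 0" using b norm_ge_zero[of b] by linarith
      \<comment> \<open>\<open>s\<close> stays below \<open>r + d / 2\<close>, the radius at which
        the zeros are counted, and above \<open>r + d / 4\<close>, which leaves room for the
        shift.\<close>
      have "\<exists>s. r + d / 4 < s \<and> s < r + d / 2 \<and> (\<forall>H\<in>{F, G}. \<forall>z\<in>sphere 0 s. H z \<noteq> 0)"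
        using F G d by (intro good_radius_exists) auto
      then obtain s where s: "r + d / 4 < s" "s < r + d / 2" "\<And>z. norm z = s \<Longrightarrow> F z \<noteq> 0 \<and> G z \<noteq> 0"
        by auto
      have sr: "r < s" "r + norm b < s" "2 * norm b \<le> s - r" using s b d norm_ge_zero[of b] by linarith+
      have Ts: "T s \<le> 2 * T r" using T2 s r d T_mono[of s "r + d"] by (simp add: d_def)
      have zc: "zcount F s \<le> 56 * r powr \<tau> * T r" "zcount G s \<le> 56 * r powr \<tau> * T r"
        using zcount_mono[OF F, of s "r + d / 2"] zcount_mono[OF G, of s "r + d / 2"] s elim(4,5) T2
        unfolding d_def by linarith+
      have "4 * s * norm b / (s\<^sup>2 - r\<^sup>2) = 4 * norm b * (s / (s + r)) / (s - r)"
      proof -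
        have "s\<^sup>2 - r\<^sup>2 = (s + r) * (s - r)" by (simp add: power2_eq_square algebra_simps)
        then show ?thesis by (simp add: mult_ac)
      qed
      also have "\<dots> \<le> 4 * norm b * 1 / (d / 4)"
        using s sr d r by (intro frac_le mult_left_mono) auto
      also have "\<dots> = 16 * norm b * r powr (\<tau> - 1)"
        using r by (simp add: d_def powr_diff field_simps)
      finally have \<kappa>: "4 * s * norm b / (s\<^sup>2 - r\<^sup>2) \<le> 16 * norm b * r powr (\<tau> - 1)" .
      have c0: "0 \<le> cmean 0 s (\<lambda>\<zeta>. \<bar>ln (norm (F \<zeta>)) - ln (norm (G \<zeta>))\<bar>)"
        using s r sr F G by (intro cmean_nonneg continuous_on_rabs continuous_on_diff continuous_ln_norm) (auto simp: entire_nz_def)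
      have "cmean 0 r (\<lambda>z. \<bar>(ln (norm (F (z + b))) - ln (norm (G (z + b)))) - (ln (norm (F z)) - ln (norm (G z)))\<bar>)
        \<le> 4 * s * norm b / (s\<^sup>2 - r\<^sup>2) * cmean 0 s (\<lambda>\<zeta>. \<bar>ln (norm (F \<zeta>)) - ln (norm (G \<zeta>))\<bar>)
          + K * r powr (-\<delta>) * (zcount F s + zcount G s)"
        unfolding K_def using mean_shift_quotient(1)[OF F G \<delta>(1,2) _ sr] good s(3) r by auto
      also have "4 * s * norm b / (s\<^sup>2 - r\<^sup>2) * cmean 0 s (\<lambda>\<zeta>. \<bar>ln (norm (F \<zeta>)) - ln (norm (G \<zeta>))\<bar>)
        \<le> 16 * norm b * r powr (\<tau> - 1) * (3 * (2 * T r))"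
        using \<kappa> r0[of s] s sr r Ts c0 by (intro mult_mono) auto
      also have "K * r powr (-\<delta>) * (zcount F s + zcount G s) \<le> K * r powr (-\<delta>) * (112 * r powr \<tau> * T r)"
        using zc K by (intro mult_left_mono) auto
      also have "16 * norm b * r powr (\<tau> - 1) * (3 * (2 * T r)) + K * r powr (-\<delta>) * (112 * r powr \<tau> * T r)
         = (96 * norm b * r powr (\<tau> - 1) + K * 112 * r powr (\<tau> - \<delta>)) * T r"
        using r by (simp add: powr_diff powr_minus field_simps)
      also have "\<dots> \<le> \<epsilon> * T r" using elim by (intro mult_right_mono) auto
      finally show "cmean 0 r (\<lambda>z. \<bar>(ln (norm (F (z + b))) - ln (norm (G (z + b)))) - (ln (norm (F z)) - ln (norm (G z)))\<bar>) \<le> \<epsilon> * T r"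
        by simp
    qed
  qed
qed

lemma mean_shift_center_small:
  assumes top: "filterlim T at_top at_top" and \<tau>: "0 < \<tau>" "\<tau> < 1"
    and G: "entire_nz G" "G 0 \<noteq> 0" "G b \<noteq> 0"
    and upperG: "\<forall>\<^sub>F \<rho> in at_top. (\<forall>z. norm z = \<rho> \<longrightarrow> G z \<noteq> 0) \<longrightarrow> cmean 0 \<rho> (\<lambda>z. ln (norm (G z))) \<le> 3 * T \<rho>"
    and \<epsilon>: "\<epsilon> > 0"
  shows "\<forall>\<^sub>F r in at_top. T (r + r powr (1 - \<tau>)) \<le> 2 * T r \<longrightarrow>
      (\<forall>z. norm z = r \<longrightarrow> G z \<noteq> 0 \<and> G (z + b) \<noteq> 0) \<longrightarrow>
      cmean b r (\<lambda>z. ln (norm (G z))) - cmean 0 r (\<lambda>z. ln (norm (G z))) \<le> \<epsilon> * T r"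
proof -
  \<comment> \<open>\<open>K\<close> is so large that the middle zeros, at most
    \<open>16 * T r\<close> of them with weight \<open>2 * norm b / K\<close>, contribute at most a
    third of \<open>\<epsilon> * T r\<close>; 96 is 3 times 32. The constant \<open>C\<close> and
    the outer zeros get the other two thirds.\<close>
  define K where "K = 2 * norm b + 1 + 96 * norm b / \<epsilon>"
  have "0 \<le> 96 * norm b / \<epsilon>" using \<epsilon> by simp
  then have Kp: "2 * norm b \<le> K" "0 < K" using norm_ge_zero[of b] unfolding K_def by linarith+
  have K32: "32 * norm b / K \<le> \<epsilon> / 3"
  proof -
    have "96 * norm b / \<epsilon> \<le> K" unfolding K_def by simp
    then show ?thesis using Kp \<epsilon> by (simp add: field_simps)
  qed
  define C where "C = ln (norm (G b)) - ln (norm (G 0)) + (\<Sum>a\<in>zeros_in G K. real (zmult G a) * (norm b / norm (a - b)))"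
  have "((\<lambda>r. 224 * norm b * r powr (\<tau> - 1)) \<longlongrightarrow> 0) at_top"
    using \<tau> by (intro tendsto_mult_right_zero tendsto_neg_powr filterlim_ident) auto
  then have "\<forall>\<^sub>F r in at_top. 224 * norm b * r powr (\<tau> - 1) < \<epsilon> / 3"
    using \<epsilon> by (intro order_tendstoD) auto
  moreover have "\<forall>\<^sub>F r in at_top. 2 * norm b + 2 \<le> r powr (1 - \<tau>)"
  proof -
    have "filterlim (\<lambda>r. r powr (1 - \<tau>)) at_top at_top" using \<tau> by real_asymp
    then show ?thesis unfolding filterlim_at_top by blast
  qed
  moreover have "\<forall>\<^sub>F r in at_top. 0 \<le> 1 * T r" by (rule eventually_le_T[OF top]) simp
  moreover have "\<forall>\<^sub>F r in at_top. C \<le> \<epsilon> / 3 * T r" using \<epsilon> by (intro eventually_le_T[OF top]) simp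
  ultimately show ?thesis
    using zcount_growth[OF top \<tau> G(1) upperG] eventually_ge_at_top[of "max 1 (2 * K)"]
  proof eventually_elim
    case (elim r)
    show ?case
    proof (intro impI)
      assume T2: "T (r + r powr (1 - \<tau>)) \<le> 2 * T r"
        and good: "\<forall>z. norm z = r \<longrightarrow> G z \<noteq> 0 \<and> G (z + b) \<noteq> 0"
      have r: "r \<ge> 1" "2 * K \<le> r" using elim by auto
      have z1: "zcount G (r / 2) \<le> 16 * T r" using elim(6) good by blast
      have "zcount G (r + norm b + 1) \<le> zcount G (r + r powr (1 - \<tau>) / 2)"
        using elim(2) by (intro zcount_mono G) simp
      then have z2: "zcount G (r + norm b + 1) \<le> 56 * r powr \<tau> * T r" using elim(5) T2 by linarith
      have "cmean b r (\<lambda>z. ln (norm (G z))) - cmean 0 r (\<lambda>z. ln (norm (G z)))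
        \<le> C + 2 * norm b / K * zcount G (r / 2) + 4 * norm b / r * zcount G (r + norm b + 1)"
        unfolding C_def using good r Kp by (intro mean_shift_center G) auto
      also have "2 * norm b / K * zcount G (r / 2) \<le> 2 * norm b / K * (16 * T r)"
        using z1 Kp by (intro mult_left_mono) auto
      also have "\<dots> = 32 * norm b / K * T r" by simp
      also have "\<dots> \<le> \<epsilon> / 3 * T r" using elim by (intro mult_right_mono K32) auto
      also have "4 * norm b / r * zcount G (r + norm b + 1) \<le> 4 * norm b / r * (56 * r powr \<tau> * T r)"
        using z2 r by (intro mult_left_mono) auto
      also have "\<dots> = 224 * norm b * r powr (\<tau> - 1) * T r" using r by (simp add: powr_diff field_simps)
      also have "\<dots> \<le> \<epsilon> / 3 * T r" using elim by (intro mult_right_mono) auto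
      finally show "cmean b r (\<lambda>z. ln (norm (G z))) - cmean 0 r (\<lambda>z. ln (norm (G z))) \<le> \<epsilon> * T r"
        using elim(4) by simp
    qed
  qed
qed

end

lemma smallest_subset:
  fixes \<phi> :: "'a \<Rightarrow> real"
  assumes "finite A" "m \<le> card A"
  shows "\<exists>s. s \<subseteq> A \<and> card s = m \<and> (\<forall>k\<in>s. \<forall>j\<in>A - s. \<phi> k \<le> \<phi> j)"
  using assms(2)
proof (induction m)
  case 0
  then show ?case by (intro exI[of _ "{}"]) auto
next
  case (Suc m)
  then obtain s where s: "s \<subseteq> A" "card s = m" "\<And>k j. k \<in> s \<Longrightarrow> j \<in> A - s \<Longrightarrow> \<phi> k \<le> \<phi> j" by auto
  have fin: "finite (A - s)" "finite s" using assms s finite_subset by auto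
  have "A - s \<noteq> {}"
  proof
    assume "A - s = {}"
    then have "A = s" using s(1) by blast
    then show False using s(2) Suc.prems by simp
  qed
  then have "Min (\<phi> ` (A - s)) \<in> \<phi> ` (A - s)" using fin by (intro Min_in) auto
  then obtain k where k0: "k \<in> A - s" "\<phi> k = Min (\<phi> ` (A - s))" by auto
  have k: "k \<in> A - s" "\<And>j. j \<in> A - s \<Longrightarrow> \<phi> k \<le> \<phi> j"
    using k0 fin by (auto intro: Min_le)
  show ?case using s k fin by (intro exI[of _ "insert k s"]) auto
qed

section \<open>The second main theorem\<close>

lemma log_plus_nonneg [simp]: "0 \<le> log_plus x"
  by (simp add: log_plus_def)

lemma le_exp_log_plus: "x \<le> exp (log_plus x)"
  by (simp add: log_plus_def)

lemma log_plus_le: "0 \<le> y \<Longrightarrow> x \<le> exp y \<Longrightarrow> log_plus x \<le> y"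
proof -
  assume "0 \<le> y" "x \<le> exp y"
  then have "max 1 x \<le> exp y" by simp
  then have "ln (max 1 x) \<le> ln (exp y)" by (intro ln_mono) auto
  then show ?thesis by (simp add: log_plus_def)
qed

lemma continuous_log_plus_norm:
  assumes "h holomorphic_on UNIV"
  shows "continuous_on A (\<lambda>z. log_plus (norm (h z)))"
proof -
  have "continuous_on A h" using assms holomorphic_on_imp_continuous_on continuous_on_subset by blast
  then show ?thesis unfolding log_plus_def
    by (intro continuous_on_ln continuous_on_max continuous_on_norm continuous_on_const) auto
qed

lemma nevanlinna_T_entire:
  assumes "h holomorphic_on UNIV"
  shows "nevanlinna_T r h = cmean 0 r (\<lambda>z. log_plus (norm (h z)))"
proof -
  have "\<not> is_pole h z" for z
    by (rule not_is_pole_holomorphic[OF _ _ assms]) auto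
  then show ?thesis
    by (simp add: nevanlinna_T_def nevanlinna_N_def nevanlinna_m_def pole_count_def cmean_def)
qed

locale moving_targets = curve n g for n g +
  fixes c :: complex and q :: nat and f :: "nat \<Rightarrow> complex \<Rightarrow> complex"
    and a :: "nat \<Rightarrow> nat \<Rightarrow> complex \<Rightarrow> complex" and L :: "complex \<Rightarrow> complex"
  assumes n1: "n \<ge> 1" and qn: "q > n"
    and ho: "hyper_order (cartan_T n g) < 1"
    and indep: "lin_indep_over (periodic_field c) {0..n} g"
    and a_hol: "\<And>i j. i \<le> n \<Longrightarrow> j \<le> q \<Longrightarrow> a i j holomorphic_on UNIV"
    and a_per: "\<And>i j z. i \<le> n \<Longrightarrow> j \<le> q \<Longrightarrow> a i j (z + c) = a i j z"
    and a_small: "\<And>i j. i \<le> n \<Longrightarrow> j \<le> q \<Longrightarrow> (\<lambda>r. nevanlinna_T r (a i j)) \<in> o[at_top](cartan_T n g)"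
    and f_def: "\<And>j z. j \<le> q \<Longrightarrow> f j z = (\<Sum>i=0..n. a i j z * g i z)"
    and f_indep: "\<And>J. J \<subseteq> {0..q} \<Longrightarrow> card J = n + 1 \<Longrightarrow> lin_indep_over (periodic_field c) J f"
    and L_def: "\<And>z. L z = (\<Prod>j=0..q. f j z) / casorati c n g z"
begin

lemma top: "filterlim T at_top at_top"
  using T_at_top[OF n1] lincomb_independent[OF indep] by blast

text \<open>One function that dominates all coefficients. Its circle mean is the sum of the
  characteristics of the \<open>a i j\<close>, since entire functions have no counting term; so it
  is small compared with \<open>T\<close>.\<close>

definition coeff_log :: "complex \<Rightarrow> real" where
  "coeff_log z = (\<Sum>i\<le>n. \<Sum>j\<le>q. log_plus (norm (a i j z)))"

lemma coeff_log_nonneg: "0 \<le> coeff_log z"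
  unfolding coeff_log_def by (intro sum_nonneg) auto

lemma coeff_log_continuous: "continuous_on A coeff_log"
  unfolding coeff_log_def by (intro continuous_on_sum continuous_log_plus_norm a_hol) auto

lemma norm_a_le:
  assumes "i \<le> n" "j \<le> q"
  shows "norm (a i j z) \<le> exp (coeff_log z)"
proof -
  have "log_plus (norm (a i j z)) \<le> (\<Sum>j\<le>q. log_plus (norm (a i j z)))"
    using assms by (intro member_le_sum) auto
  also have "\<dots> \<le> coeff_log z"
    unfolding coeff_log_def using assms by (intro member_le_sum[of i "{..n}" "\<lambda>i. \<Sum>j\<le>q. log_plus (norm (a i j z))"] sum_nonneg) auto
  finally have "exp (log_plus (norm (a i j z))) \<le> exp (coeff_log z)" by simp
  then show ?thesis using le_exp_log_plus order_trans by blast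
qed

lemma mean_coeff_log_small:
  assumes "\<epsilon> > 0"
  shows "\<forall>\<^sub>F r in at_top. cmean 0 r coeff_log \<le> \<epsilon> * T r"
proof -
  have "(\<lambda>r. \<Sum>i\<le>n. \<Sum>j\<le>q. nevanlinna_T r (a i j)) \<in> o[at_top](T)"
    by (intro big_sum_in_smallo a_small) auto
  from landau_o.smallD[OF this assms]
  have "\<forall>\<^sub>F r in at_top. norm (\<Sum>i\<le>n. \<Sum>j\<le>q. nevanlinna_T r (a i j)) \<le> \<epsilon> * norm (T r)" .
  moreover have "\<forall>\<^sub>F r in at_top. 0 \<le> 1 * T r" by (rule eventually_le_T[OF top]) simp
  ultimately show ?thesis using eventually_gt_at_top[of 0]
  proof eventually_elim
    case (elim r)
    have "cmean 0 r coeff_log = (\<Sum>i\<le>n. \<Sum>j\<le>q. nevanlinna_T r (a i j))"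
    proof -
      have ca: "continuous_on (sphere 0 r) (\<lambda>z. log_plus (norm (a i j z)))" if "i \<le> n" "j \<le> q" for i j
        using a_hol[OF that] by (rule continuous_log_plus_norm)
      have "cmean 0 r coeff_log = (\<Sum>i\<le>n. cmean 0 r (\<lambda>z. \<Sum>j\<le>q. log_plus (norm (a i j z))))"
        unfolding coeff_log_def using elim by (intro cmean_sum continuous_on_sum ca) auto
      also have "\<dots> = (\<Sum>i\<le>n. \<Sum>j\<le>q. cmean 0 r (\<lambda>z. log_plus (norm (a i j z))))"
        using elim by (intro sum.cong refl cmean_sum ca) auto
      also have "\<dots> = (\<Sum>i\<le>n. \<Sum>j\<le>q. nevanlinna_T r (a i j))"
        by (intro sum.cong refl) (simp add: nevanlinna_T_entire a_hol)
      finally show ?thesis .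
    qed
    then show ?case using elim by simp
  qed
qed

lemma f_hol: "j \<le> q \<Longrightarrow> f j holomorphic_on UNIV"
proof -
  assume j: "j \<le> q"
  then have "f j = (\<lambda>z. \<Sum>i=0..n. a i j z * g i z)" using f_def by auto
  moreover have "(\<lambda>z. \<Sum>i=0..n. a i j z * g i z) holomorphic_on UNIV"
    by (intro holomorphic_intros a_hol g_hol) (use j in auto)
  ultimately show ?thesis by simp
qed

lemma norm_f_le:
  assumes "j \<le> q"
  shows "norm (f j z) \<le> exp (u z + (coeff_log z + ln (real (n + 1))))"
proof -
  have "norm (f j z) \<le> (\<Sum>i=0..n. norm (a i j z * g i z))" unfolding f_def[OF assms] by (rule norm_sum)
  also have "\<dots> \<le> (\<Sum>i=0..n. exp (coeff_log z) * exp (u z))"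
    unfolding norm_mult using assms by (intro sum_mono mult_mono norm_a_le norm_g_le) auto
  also have "\<dots> = exp (u z + (coeff_log z + ln (real (n + 1))))" by (simp add: exp_add)
  finally show ?thesis .
qed

text \<open>Complete \<open>j\<close> to a set of \<open>n + 1\<close> indices; if
  \<open>f j\<close> vanished identically, the coefficients 1 at \<open>j\<close> and 0 elsewhere
  would be a relation.\<close>

lemma f_nz:
  assumes j: "j \<le> q"
  shows "entire_nz (f j)"
proof -
  have "\<exists>J. {j} \<subseteq> J \<and> J \<subseteq> {0..q} \<and> card J = n + 1"
    by (rule exists_subset_between) (use j qn in auto)
  then obtain J where J: "j \<in> J" "J \<subseteq> {0..q}" "card J = n + 1" by auto
  have "\<exists>z. f j z \<noteq> 0"
  proof (rule ccontr)
    assume *: "\<not> ?thesis"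
    define \<beta> :: "nat \<Rightarrow> complex \<Rightarrow> complex" where "\<beta> k = (if k = j then (\<lambda>_. 1) else (\<lambda>_. 0))" for k
    have "(\<Sum>k\<in>J. \<beta> k z * f k z) = 0" for z
      using * by (intro sum.neutral) (auto simp: \<beta>_def)
    then have "\<forall>\<^sub>\<approx>z\<in>UNIV. (\<Sum>k\<in>J. \<beta> k z * f k z) = 0" by (intro always_eventually) simp
    moreover have "\<forall>k\<in>J. \<beta> k \<in> periodic_field c" by (auto simp: \<beta>_def constant_in_periodic_field)
    ultimately have "\<forall>k\<in>J. \<forall>z. \<beta> k z = 0"
      using f_indep[OF J(2,3)] unfolding lin_indep_over_def by blast
    then show False using J(1) by (auto simp: \<beta>_def)
  qed
  then show ?thesis using f_hol[OF j] by (simp add: entire_nz_def)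
qed

section \<open>Selections of \<open>n + 1\<close> forms and their coefficient determinants\<close>

definition selections :: "nat set set" where
  "selections = {s. s \<subseteq> {0..q} \<and> card s = Suc n}"

text \<open>An arbitrary enumeration: another one changes the determinants only by a sign, and only
  moduli and vanishing matter.\<close>

definition selected :: "nat set \<Rightarrow> nat \<Rightarrow> nat" where
  "selected s = (SOME h. bij_betw h {..<Suc n} s)"

lemma finite_selections: "finite selections"
  unfolding selections_def by (rule finite_subset[of _ "Pow {0..q}"]) auto

lemma selected_bij:
  assumes "s \<in> selections"
  shows "bij_betw (selected s) {..<Suc n} s"
proof -
  have "finite s" "card {..<Suc n} = card s" using assms finite_subset by (auto simp: selections_def)
  then have "\<exists>h. bij_betw h {..<Suc n} s" by (intro finite_same_card_bij) auto
  then show ?thesis unfolding selected_def by (rule someI_ex)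
qed

lemma selected_mem: "s \<in> selections \<Longrightarrow> k < Suc n \<Longrightarrow> selected s k \<in> s"
  using selected_bij bij_betwE by blast

lemma selected_le: "s \<in> selections \<Longrightarrow> k < Suc n \<Longrightarrow> selected s k \<le> q"
  using selected_mem[of s k] by (auto simp: selections_def)

definition coeff_det :: "nat set \<Rightarrow> complex \<Rightarrow> complex" where
  "coeff_det s z = dmat (Suc n) (\<lambda>i k. a i (selected s k) z)"

lemma coeff_det_hol: "s \<in> selections \<Longrightarrow> coeff_det s holomorphic_on UNIV"
  unfolding coeff_det_def by (intro dmat_holomorphic a_hol selected_le) auto

lemma norm_coeff_det_le:
  assumes "s \<in> selections"
  shows "norm (coeff_det s z) \<le> fact (Suc n) * exp (coeff_log z) ^ Suc n"
proof -
  have "norm (coeff_det s z) \<le> fact (Suc n) * (\<Prod>i = 0..<Suc n. exp (coeff_log z))"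
    unfolding coeff_det_def by (intro norm_dmat_le norm_a_le selected_le assms) auto
  then show ?thesis by simp
qed

text \<open>Growth bounded by the coefficients forces \<open>T(r, h) \<le> 2 * C * T r\<close>
  eventually, hence hyper-order below 1. Membership is thus reduced to a pointwise bound, which is
  easy to keep under differences and products.\<close>

lemma periodic_entire_in_field:
  assumes h: "h holomorphic_on UNIV" "\<And>z. h (z + c) = h z"
    and C: "\<And>z. norm (h z) \<le> exp (C * (coeff_log z + 1))" "C \<ge> 0"
  shows "h \<in> periodic_field c"
proof -
  obtain \<sigma> where \<sigma>: "0 < \<sigma>" "\<sigma> < 1" "\<forall>\<^sub>F r in at_top. T r \<le> exp (r powr \<sigma>)"
    using hyper_order_less_1D[OF ho] by blast
  have "\<forall>\<^sub>F r in at_top. cmean 0 r coeff_log \<le> 1 * T r" by (rule mean_coeff_log_small) simp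
  moreover have "\<forall>\<^sub>F r in at_top. 1 \<le> 1 * T r" by (rule eventually_le_T[OF top]) simp
  moreover have "\<forall>\<^sub>F r in at_top. (2 * C + 1) * r * exp ((1 * r) powr \<sigma>) \<le> exp (r powr ((1 + \<sigma>) / 2))"
    using \<sigma> C by (intro exp_powr_absorb) auto
  ultimately have "\<forall>\<^sub>F r in at_top. nevanlinna_T r h \<le> exp (r powr ((1 + \<sigma>) / 2))"
    using \<sigma>(3) eventually_ge_at_top[of 1]
  proof eventually_elim
    case (elim r)
    have "nevanlinna_T r h = cmean 0 r (\<lambda>z. log_plus (norm (h z)))" by (rule nevanlinna_T_entire[OF h(1)])
    also have "\<dots> \<le> cmean 0 r (\<lambda>z. C * (coeff_log z + 1))"
      using elim C coeff_log_nonneg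
      by (intro cmean_mono continuous_log_plus_norm h log_plus_le mult_nonneg_nonneg add_nonneg_nonneg
           continuous_on_mult continuous_on_add continuous_on_const coeff_log_continuous) auto
    also have "\<dots> = C * (cmean 0 r coeff_log + 1)"
      using elim by (simp add: cmean_cmult cmean_add coeff_log_continuous)
    also have "\<dots> \<le> C * (T r + T r)" using elim C by (intro mult_left_mono) auto
    also have "\<dots> \<le> (2 * C + 1) * (T r * r)"
    proof -
      have t0: "0 \<le> T r * r" using elim by simp
      have "T r * 1 \<le> T r * r" using elim by (intro mult_left_mono) auto
      then have "2 * C * T r \<le> 2 * C * (T r * r)" using C by (intro mult_left_mono) auto
      then show ?thesis using t0 by (simp add: algebra_simps)
    qed
    also have "\<dots> \<le> (2 * C + 1) * (exp ((1 * r) powr \<sigma>) * r)"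
      using elim C by (intro mult_left_mono mult_right_mono) auto
    also have "\<dots> \<le> exp (r powr ((1 + \<sigma>) / 2))" using elim by (simp add: mult_ac)
    finally show ?case .
  qed
  then have "hyper_order (\<lambda>r. nevanlinna_T r h) < 1"
    using \<sigma> by (intro hyper_order_less_1I[of "(1 + \<sigma>) / 2"]) auto
  moreover have "h nicely_meromorphic_on UNIV"
    using h(1) by (intro analytic_on_imp_nicely_meromorphic_on) (simp add: analytic_on_open)
  ultimately show ?thesis using h(2) by (simp add: periodic_field_def)
qed

text \<open>If the determinant vanished identically, \<open>singular_system_solution\<close> would
  give coefficients that annihilate the selected forms. They must lie in the periodic field, hence
  the ring \<open>R\<close>, which is closed under the operations of the elimination.\<close>

lemma coeff_det_nz:
  assumes s: "s \<in> selections"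
  shows "entire_nz (coeff_det s)"
proof (rule ccontr)
  assume "\<not> ?thesis"
  then have D0: "coeff_det s z = 0" for z using coeff_det_hol[OF s] by (auto simp: entire_nz_def)
  define R where "R = {h. h holomorphic_on UNIV \<and> (\<forall>z. h (z + c) = h z) \<and>
      (\<exists>C\<ge>0. \<forall>z. norm (h z) \<le> exp (C * (coeff_log z + 1)))}"
  have "\<exists>b. (\<forall>k\<in>{..<Suc n}. b k \<in> R) \<and> (\<exists>k\<in>{..<Suc n}. \<exists>z. b k z \<noteq> 0) \<and>
     (\<forall>i\<in>{..<Suc n}. \<forall>z. (\<Sum>k\<in>{..<Suc n}. a i (selected s k) z * b k z) = 0)"
  proof (rule singular_system_solution[where R = R and Q = "\<lambda>_. 1"])
    show "(\<lambda>z. p z * h z) \<in> R" if p: "p \<in> R" and h: "h \<in> R" for p h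
    proof -
      obtain C1 C2 where C: "C1 \<ge> 0" "C2 \<ge> 0" "\<And>z. norm (p z) \<le> exp (C1 * (coeff_log z + 1))" "\<And>z. norm (h z) \<le> exp (C2 * (coeff_log z + 1))"
        using p h by (auto simp: R_def)
      have "norm (p z * h z) \<le> exp ((C1 + C2) * (coeff_log z + 1))" for z
        unfolding norm_mult distrib_right exp_add by (intro mult_mono C) auto
      then show ?thesis using p h C by (auto simp: R_def intro!: holomorphic_intros exI[of _ "C1 + C2"])
    qed
    show "(\<lambda>z. p z - h z) \<in> R" if p: "p \<in> R" and h: "h \<in> R" for p h
    proof -
      obtain C1 C2 where C: "C1 \<ge> 0" "C2 \<ge> 0" "\<And>z. norm (p z) \<le> exp (C1 * (coeff_log z + 1))" "\<And>z. norm (h z) \<le> exp (C2 * (coeff_log z + 1))"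
        using p h by (auto simp: R_def)
      \<comment> \<open>The additional 1 absorbs a factor 2, by
        \<open>2 \<le> exp (coeff_log z + 1)\<close>; this is the purpose of the \<open>+ 1\<close>
        in \<open>R\<close>.\<close>
      have "norm (p z - h z) \<le> exp ((C1 + C2 + 1) * (coeff_log z + 1))" for z
      proof -
        define m where "m = exp ((C1 + C2) * (coeff_log z + 1))"
        have "C1 * (coeff_log z + 1) \<le> (C1 + C2) * (coeff_log z + 1)" "C2 * (coeff_log z + 1) \<le> (C1 + C2) * (coeff_log z + 1)"
          using C coeff_log_nonneg[of z] by (intro mult_right_mono; simp)+
        then have "norm (p z) \<le> m" "norm (h z) \<le> m"
          unfolding m_def using C(3)[of z] C(4)[of z] by (meson exp_le_cancel_iff order_trans)+
        then have "norm (p z - h z) \<le> m * 2" using norm_triangle_ineq4[of "p z" "h z"] by linarith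
        also have "2 \<le> exp (coeff_log z + 1)" using exp_ge_add_one_self[of "coeff_log z + 1"] coeff_log_nonneg[of z] by linarith
        then have "m * 2 \<le> m * exp (coeff_log z + 1)" by (intro mult_left_mono) (auto simp: m_def)
        also have "\<dots> = exp ((C1 + C2 + 1) * (coeff_log z + 1))" by (simp add: m_def exp_add[symmetric] algebra_simps)
        finally show ?thesis .
      qed
      then show ?thesis using p h C by (auto simp: R_def intro!: holomorphic_intros exI[of _ "C1 + C2 + 1"])
    qed
    show one: "(\<lambda>_. 1) \<in> R" by (auto simp: R_def)
    show "a i (selected s k) \<in> R" if "i \<in> {..<Suc n}" "k \<in> {..<Suc n}" for i k
    proof -
      have ik: "i \<le> n" "selected s k \<le> q" using that selected_le[OF s] by auto
      have "norm (a i (selected s k) z) \<le> exp (1 * (coeff_log z + 1))" for z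
        using norm_a_le[OF ik, of z] by (rule order_trans) simp
      then show ?thesis using a_hol[OF ik] a_per[OF ik] unfolding R_def by (auto intro!: exI[of _ 1])
    qed
    show "\<exists>v. (\<exists>k\<in>{..<Suc n}. v k \<noteq> 0) \<and> (\<forall>i\<in>{..<Suc n}. (\<Sum>k\<in>{..<Suc n}. a i (selected s k) z * v k) = 0)" for z
      using D0[of z] unfolding coeff_det_def dmat_eq_0_iff by (simp only: Ball_def Bex_def lessThan_iff)
    show "(\<lambda>_. 1) \<in> R" by (rule one)
  qed (auto simp: R_def)
  then obtain b where b: "\<And>k. k < Suc n \<Longrightarrow> b k \<in> R" "\<exists>k<Suc n. \<exists>z. b k z \<noteq> 0"
    "\<And>i z. i < Suc n \<Longrightarrow> (\<Sum>k<Suc n. a i (selected s k) z * b k z) = 0" by (auto simp del: sum.lessThan_Suc)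
  define \<beta> where "\<beta> j = b (the_inv_into {..<Suc n} (selected s) j)" for j
  have \<beta>e: "\<beta> (selected s k) = b k" if "k < Suc n" for k
    unfolding \<beta>_def using selected_bij[OF s] that by (simp add: bij_betw_def the_inv_into_f_f)
  have img: "selected s ` {..<Suc n} = s" using selected_bij[OF s] by (simp add: bij_betw_def)
  have "(\<Sum>j\<in>s. \<beta> j z * f j z) = 0" for z
  proof -
    have "(\<Sum>j\<in>s. \<beta> j z * f j z) = (\<Sum>k<Suc n. \<beta> (selected s k) z * f (selected s k) z)"
      by (rule sum.reindex_bij_betw[OF selected_bij[OF s], symmetric])
    also have "\<dots> = (\<Sum>k<Suc n. b k z * (\<Sum>i<Suc n. a i (selected s k) z * g i z))"
      by (intro sum.cong refl) (simp add: \<beta>e f_def selected_le[OF s] atLeast0AtMost lessThan_Suc_atMost del: sum.lessThan_Suc)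
    \<comment> \<open>After exchanging the sums, the coefficient of each \<open>g i\<close> is one
      equation of the system.\<close>
    also have "\<dots> = (\<Sum>i<Suc n. g i z * (\<Sum>k<Suc n. a i (selected s k) z * b k z))"
      unfolding sum_distrib_left by (subst sum.swap) (simp only: mult_ac)
    also have "\<dots> = 0" using b(3) by (intro sum.neutral) (simp del: sum.lessThan_Suc)
    finally show ?thesis .
  qed
  then have "\<forall>\<^sub>\<approx>z\<in>UNIV. (\<Sum>j\<in>s. \<beta> j z * f j z) = 0" by (intro always_eventually) simp
  moreover have "\<forall>j\<in>s. \<beta> j \<in> periodic_field c"
  proof
    fix j assume "j \<in> s"
    then obtain k where k: "k < Suc n" "j = selected s k" using img by blast
    then have "\<beta> j \<in> R" using b(1) \<beta>e by simp
    then show "\<beta> j \<in> periodic_field c" unfolding R_def using periodic_entire_in_field by blast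
  qed
  moreover have "s \<subseteq> {0..q}" "card s = n + 1" using s by (auto simp: selections_def)
  ultimately have "\<forall>j\<in>s. \<forall>z. \<beta> j z = 0" using f_indep[of s] unfolding lin_indep_over_def by blast
  then have "b k z = 0" if "k < Suc n" for k z using \<beta>e[OF that] selected_mem[OF s that] by metis
  then show False using b(2) by blast
qed

text \<open>The loss in Cramer's rule: the logarithm of the factor in
  \<open>dmat_solve_bound\<close> divided by the modulus of the determinant. The same factor
  dominates the determinant, whence \<open>det_defect_nonneg\<close>.\<close>

definition det_defect :: "nat set \<Rightarrow> complex \<Rightarrow> real" where
  "det_defect s z = ln (fact (Suc n)) + real (Suc n) * coeff_log z - ln (norm (coeff_det s z))"

lemma det_defect_nonneg:
  assumes "s \<in> selections" "coeff_det s z \<noteq> 0"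
  shows "0 \<le> det_defect s z"
proof -
  have "ln (norm (coeff_det s z)) \<le> ln (fact (Suc n) * exp (coeff_log z) ^ Suc n)"
    using norm_coeff_det_le[OF assms(1), of z] assms(2) by (intro ln_mono) auto
  also have "\<dots> = ln (fact (Suc n)) + real (Suc n) * coeff_log z"
    by (subst ln_mult_pos) (auto simp del: fact_Suc power_Suc simp: exp_of_nat_mult[symmetric])
  finally show ?thesis by (simp add: det_defect_def)
qed

text \<open>The \<open>g i\<close> solve the linear system given by the selected forms, all of which
  are at most \<open>norm (f j z)\<close>. Cramer's rule bounds the component that attains
  \<open>u z\<close>.\<close>

lemma ln_f_ge:
  assumes s: "s \<in> selections" and Ds: "coeff_det s z \<noteq> 0" and j: "\<And>k. k \<in> s \<Longrightarrow> norm (f k z) \<le> norm (f j z)"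
    and fj: "f j z \<noteq> 0"
  shows "u z - det_defect s z \<le> ln (norm (f j z))"
proof -
  obtain l where l: "l \<le> n" "g l z \<noteq> 0" "u z = ln (norm (g l z))" using u_attained by blast
  have "norm (\<Sum>i<Suc n. g i z * a i (selected s k) z) \<le> norm (f j z)" if "k < Suc n" for k
  proof -
    have "(\<Sum>i<Suc n. g i z * a i (selected s k) z) = f (selected s k) z"
      using selected_le[OF s that] by (simp add: f_def atLeast0AtMost lessThan_Suc_atMost mult.commute del: sum.lessThan_Suc)
    then show ?thesis using j[OF selected_mem[OF s that]] by simp
  qed
  then have "norm (coeff_det s z) * norm (g l z) \<le> fact (Suc n) * exp (coeff_log z) ^ Suc n * norm (f j z)"
    unfolding coeff_det_def using l coeff_log_nonneg[of z]
    by (intro dmat_solve_bound norm_a_le selected_le s) (auto simp del: sum.lessThan_Suc)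
  then have "ln (norm (coeff_det s z) * norm (g l z)) \<le> ln (fact (Suc n) * exp (coeff_log z) ^ Suc n * norm (f j z))"
    using Ds l by (intro ln_mono) auto
  moreover have "ln (norm (coeff_det s z) * norm (g l z)) = ln (norm (coeff_det s z)) + u z"
    using Ds l by (simp add: ln_mult_pos)
  moreover have "ln (fact (Suc n) * exp (coeff_log z) ^ Suc n * norm (f j z)) = ln (fact (Suc n)) + real (Suc n) * coeff_log z + ln (norm (f j z))"
    using fj by (simp add: ln_mult_pos exp_of_nat_mult[symmetric] del: fact_Suc power_Suc)
  ultimately show ?thesis by (simp add: det_defect_def)
qed

section \<open>The Casorati determinant against the selected forms\<close>

abbreviation W :: "complex \<Rightarrow> complex" where "W \<equiv> casorati c n g"

lemma a_per_iter: "i \<le> n \<Longrightarrow> j \<le> q \<Longrightarrow> a i j (z + of_nat m * c) = a i j z"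
proof (induction m)
  case (Suc m)
  then show ?case using a_per[of i j "z + of_nat m * c"] by (simp add: algebra_simps)
qed simp

text \<open>The coefficients do not change under shifts by multiples of \<open>c\<close>, so every
  row of shifted forms is the row of equally shifted \<open>g j\<close> times one and the same
  coefficient matrix.\<close>

lemma casorati_times_coeff_det:
  assumes s: "s \<in> selections"
  shows "W z * coeff_det s z = dmat (Suc n) (\<lambda>i k. f (selected s k) (z + of_nat i * c))"
proof -
  have e: "Matrix.mat (Suc n) (Suc n) (\<lambda>(i, k). \<Sum>j<Suc n. g j (z + of_nat i * c) * a j (selected s k) z)
     = Matrix.mat (Suc n) (Suc n) (\<lambda>(i, k). f (selected s k) (z + of_nat i * c))"
  proof (rule eq_matI)
    fix i k assume "i < dim_row (Matrix.mat (Suc n) (Suc n) (\<lambda>(i, k). f (selected s k) (z + of_nat i * c)))"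
      "k < dim_col (Matrix.mat (Suc n) (Suc n) (\<lambda>(i, k). f (selected s k) (z + of_nat i * c)))"
    then have ik: "i < Suc n" "k < Suc n" by auto
    have "(\<Sum>j<Suc n. g j (z + of_nat i * c) * a j (selected s k) z) = f (selected s k) (z + of_nat i * c)"
      unfolding f_def[OF selected_le[OF s ik(2)]] atLeast0AtMost lessThan_Suc_atMost
      by (intro sum.cong refl) (simp add: a_per_iter selected_le[OF s ik(2)])
    then show "Matrix.mat (Suc n) (Suc n) (\<lambda>(i, k). \<Sum>j<Suc n. g j (z + of_nat i * c) * a j (selected s k) z) $$ (i, k)
      = Matrix.mat (Suc n) (Suc n) (\<lambda>(i, k). f (selected s k) (z + of_nat i * c)) $$ (i, k)"
      using ik by (simp del: sum.lessThan_Suc)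
  qed auto
  have "W z = dmat (Suc n) (\<lambda>i j. g j (z + of_nat i * c))" by (simp add: casorati_def)
  then show ?thesis
    unfolding coeff_det_def using dmat_mult[of "Suc n" "\<lambda>i j. g j (z + of_nat i * c)" "\<lambda>j k. a j (selected s k) z"] e by simp
qed

text \<open>Dividing each column by its form at \<open>z\<close> leaves the shift quotients. In row
  \<open>i\<close> they are bounded by \<open>exp (R i)\<close> for all forms at once, so
  \<open>norm_dmat_le\<close> applies.\<close>

lemma ln_casorati_coeff_det_le:
  assumes s: "s \<in> selections" and W: "W z \<noteq> 0" and Ds: "coeff_det s z \<noteq> 0"
    and fz: "\<And>j. j \<le> q \<Longrightarrow> f j z \<noteq> 0"
    and fs: "\<And>i j. i \<le> n \<Longrightarrow> j \<le> q \<Longrightarrow> f j (z + of_nat i * c) \<noteq> 0"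
    and R: "\<And>i j. i \<le> n \<Longrightarrow> j \<le> q \<Longrightarrow> ln (norm (f j (z + of_nat i * c))) - ln (norm (f j z)) \<le> R i"
  shows "ln (norm (W z)) + ln (norm (coeff_det s z)) \<le> (\<Sum>j\<in>s. ln (norm (f j z))) + ln (fact (Suc n)) + (\<Sum>i\<le>n. R i)"
proof -
  define P where "P = (\<Prod>k = 0..<Suc n. f (selected s k) z)"
  have en: "selected s k \<le> q" if "k < Suc n" for k using selected_le[OF s that] .
  have Pnz: "P \<noteq> 0" unfolding P_def using en fz by (subst prod_zero_iff) auto
  have eq: "Matrix.mat (Suc n) (Suc n) (\<lambda>(i, k). f (selected s k) (z + of_nat i * c) / f (selected s k) z * f (selected s k) z)
    = Matrix.mat (Suc n) (Suc n) (\<lambda>(i, k). f (selected s k) (z + of_nat i * c))"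
    by (rule eq_matI) (use en fz in auto)
  have "W z * coeff_det s z = dmat (Suc n) (\<lambda>i k. f (selected s k) (z + of_nat i * c) / f (selected s k) z) * P"
    unfolding casorati_times_coeff_det[OF s] eq[symmetric] P_def by (rule dmat_scale_columns)
  moreover have "norm (dmat (Suc n) (\<lambda>i k. f (selected s k) (z + of_nat i * c) / f (selected s k) z)) \<le> fact (Suc n) * (\<Prod>i = 0..<Suc n. exp (R i))"
  proof (rule norm_dmat_le)
    fix i k assume ik: "i < Suc n" "k < Suc n"
    then have le: "i \<le> n" "selected s k \<le> q" using en by auto
    have "norm (f (selected s k) (z + of_nat i * c) / f (selected s k) z)
      = exp (ln (norm (f (selected s k) (z + of_nat i * c))) - ln (norm (f (selected s k) z)))"
      using fz[OF le(2)] fs[OF le] by (simp add: exp_diff norm_divide)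
    also have "\<dots> \<le> exp (R i)" using R[OF le] by simp
    finally show "norm (f (selected s k) (z + of_nat i * c) / f (selected s k) z) \<le> exp (R i)" .
  qed
  ultimately have "norm (W z) * norm (coeff_det s z) \<le> fact (Suc n) * (\<Prod>i = 0..<Suc n. exp (R i)) * norm P"
    unfolding norm_mult[symmetric] by (simp add: norm_mult mult_right_mono del: fact_Suc prod.op_ivl_Suc)
  also have "\<dots> = fact (Suc n) * exp (\<Sum>i\<le>n. R i) * norm P"
    by (simp add: exp_sum atLeast0LessThan lessThan_Suc_atMost del: fact_Suc prod.op_ivl_Suc prod.lessThan_Suc)
  finally have "ln (norm (W z) * norm (coeff_det s z)) \<le> ln (fact (Suc n) * exp (\<Sum>i\<le>n. R i) * norm P)"
    using W Ds by (intro ln_mono) auto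
  moreover have "ln (norm P) = (\<Sum>j\<in>s. ln (norm (f j z)))"
  proof -
    have "norm P = (\<Prod>j\<in>s. norm (f j z))"
      unfolding P_def prod_norm[symmetric] atLeast0LessThan
      by (rule prod.reindex_bij_betw[OF selected_bij[OF s]])
    moreover have "ln (\<Prod>j\<in>s. norm (f j z)) = (\<Sum>j\<in>s. ln (norm (f j z)))"
      using s fz by (intro ln_prod) (auto simp: selections_def intro: finite_subset)
    ultimately show ?thesis by simp
  qed
  ultimately show ?thesis using W Ds Pnz by (simp add: ln_mult_pos del: fact_Suc)
qed

text \<open>Take the \<open>n + 1\<close> smallest forms at \<open>z\<close> as selection. The
  \<open>q - n\<close> others are bounded below by \<open>ln_f_ge\<close>, the selected ones by
  \<open>ln_casorati_coeff_det_le\<close>.\<close>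

lemma pointwise_inequality:
  assumes W: "W z \<noteq> 0" and Ds: "\<And>s. s \<in> selections \<Longrightarrow> coeff_det s z \<noteq> 0"
    and fz: "\<And>j. j \<le> q \<Longrightarrow> f j z \<noteq> 0"
    and fs: "\<And>i j. i \<le> n \<Longrightarrow> j \<le> q \<Longrightarrow> f j (z + of_nat i * c) \<noteq> 0"
    and R: "\<And>i j. i \<le> n \<Longrightarrow> j \<le> q \<Longrightarrow> ln (norm (f j (z + of_nat i * c))) - ln (norm (f j z)) \<le> R i"
  shows "(real q - real n) * u z \<le> (\<Sum>j\<le>q. ln (norm (f j z))) - ln (norm (W z))
     + (real q - real n + 1) * (\<Sum>s\<in>selections. det_defect s z) + ln (fact (Suc n)) + (\<Sum>i\<le>n. R i)"
proof -
  obtain s where s0: "s \<subseteq> {0..q}" "card s = Suc n" "\<And>k j. k \<in> s \<Longrightarrow> j \<in> {0..q} - s \<Longrightarrow> norm (f k z) \<le> norm (f j z)"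
    using smallest_subset[of "{0..q}" "Suc n" "\<lambda>j. norm (f j z)"] qn by auto
  then have s: "s \<in> selections" by (simp add: selections_def)
  have fin: "finite s" using s0 finite_subset by blast
  have "real (card ({0..q} - s)) * (u z - det_defect s z) \<le> (\<Sum>j\<in>{0..q} - s. ln (norm (f j z)))"
  proof (rule sum_bounded_below)
    fix j assume j: "j \<in> {0..q} - s"
    then show "u z - det_defect s z \<le> ln (norm (f j z))"
      using fz s0(3) by (intro ln_f_ge s Ds) auto
  qed
  moreover have "real (card ({0..q} - s)) = real q - real n"
    using s0 fin qn by (simp add: card_Diff_subset)
  moreover have "(\<Sum>j\<le>q. ln (norm (f j z))) = (\<Sum>j\<in>s. ln (norm (f j z))) + (\<Sum>j\<in>{0..q} - s. ln (norm (f j z)))"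
    unfolding atMost_atLeast0 using sum.subset_diff[OF s0(1), of "\<lambda>j. ln (norm (f j z))"] by simp
  moreover have "ln (norm (W z)) + ln (norm (coeff_det s z)) \<le> (\<Sum>j\<in>s. ln (norm (f j z))) + ln (fact (Suc n)) + (\<Sum>i\<le>n. R i)"
    by (rule ln_casorati_coeff_det_le[OF s W Ds[OF s] fz fs R])
  moreover have "- det_defect s z \<le> ln (norm (coeff_det s z))"
  proof -
    have "0 \<le> ln (fact (Suc n) :: real)" using fact_ge_1[of "Suc n", where 'a = real] by (simp del: fact_Suc)
    moreover have "0 \<le> real (Suc n) * coeff_log z" using coeff_log_nonneg by simp
    ultimately show ?thesis unfolding det_defect_def by linarith
  qed
  \<comment> \<open>The selection depends on \<open>z\<close>; as defects are nonnegative, summing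
    over all selections gives an error that is continuous on good circles. The factor consists of
    \<open>q - n\<close> lower bounds and one coefficient determinant.\<close>
  moreover have "(real q - real n + 1) * det_defect s z \<le> (real q - real n + 1) * (\<Sum>s\<in>selections. det_defect s z)"
    using s qn det_defect_nonneg Ds finite_selections by (intro mult_left_mono member_le_sum) auto
  ultimately show ?thesis by (simp add: algebra_simps del: fact_Suc)
qed

lemma second_main_theorem:
  "\<exists>X S. finite_log_measure X \<and> S \<in> o[inf at_top (principal (- X))](T) \<and>
     (\<forall>\<^sub>F r in inf at_top (principal (- X)).
        (real q - real n) * T r \<le> nevanlinna_N r (\<lambda>z. 1 / L z) - nevanlinna_N r L + S r)"
proof -
  have Wnz: "entire_nz W" by (rule casorati_nonzero[OF n1 ho indep])
  define P where "P = (\<lambda>z. \<Prod>j\<in>{0..q}. f j z)"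
  have Pnz: "entire_nz P" unfolding P_def by (intro entire_nz_prod f_nz) auto
  obtain \<mu> where \<mu>: "(\<Sum>k\<le>n. norm (\<mu> k)) \<le> 1" "\<And>b. b \<in> (\<lambda>i. of_nat i * c) ` {..n} \<Longrightarrow> lincomb \<mu> b \<noteq> 0"
    using lincomb_avoid[of "(\<lambda>i. of_nat i * c) ` {..n}"] by auto
  define G where "G = lincomb \<mu>"
  have Gb: "G (of_nat i * c) \<noteq> 0" if "i \<le> n" for i using \<mu>(2) that by (auto simp: G_def)
  have G0: "G 0 \<noteq> 0" using Gb[of 0] by simp
  have hG: "G holomorphic_on UNIV" by (simp add: G_def lincomb_hol)
  have Gnz: "entire_nz G" using hG G0 by (auto simp: entire_nz_def)
  have Gu: "norm (G z) \<le> exp (u z + 0)" for z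
  proof -
    have "(\<Sum>k\<le>n. norm (\<mu> k)) * exp (u z) \<le> 1 * exp (u z)" using \<mu>(1) by (intro mult_right_mono) auto
    then show ?thesis using norm_lincomb[of \<mu> z] unfolding G_def add_0_right by linarith
  qed
  obtain \<sigma> where \<sigma>: "0 < \<sigma>" "\<sigma> < 1" "\<forall>\<^sub>F r in at_top. T r \<le> exp (r powr \<sigma>)"
    using hyper_order_less_1D[OF ho] by blast
  define \<tau> where "\<tau> = (1 + \<sigma>) / 2"
  have \<tau>: "\<sigma> < \<tau>" "0 < \<tau>" "\<tau> < 1" using \<sigma> by (auto simp: \<tau>_def)
  have T1: "\<forall>\<^sub>F r in at_top. 1 \<le> T r" using eventually_le_T[OF top, of 1 1] by simp
  obtain X1 where X1: "finite_log_measure X1" "\<forall>\<^sub>F r in at_top. r \<notin> X1 \<longrightarrow> T (r + r powr (1 - \<tau>)) \<le> 2 * T r"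
    using growth_lemma[OF \<sigma>(1) \<tau>(1,3) T_mono \<sigma>(3) T1] by blast
  \<comment> \<open>All functions whose logarithms are integrated over circles about
    \<open>0\<close>, the shifts by \<open>i c\<close> included; radii with a zero of one of them
    join the exceptional set.\<close>
  define \<H> where "\<H> = f ` {..q} \<union> {G, W} \<union> coeff_det ` selections \<union> (\<lambda>(i, j). \<lambda>z. f j (z + of_nat i * c)) ` ({..n} \<times> {..q})
     \<union> (\<lambda>i z. G (z + of_nat i * c)) ` {..n}"
  have \<H>: "finite \<H>" "\<And>F. F \<in> \<H> \<Longrightarrow> entire_nz F"
    unfolding \<H>_def using finite_selections Gnz Wnz by (auto intro!: f_nz coeff_det_nz entire_nz_shift)
  define Z where "Z = (\<Union>F\<in>\<H>. {r. \<exists>z\<in>sphere 0 r. F z = 0})"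
  have "countable Z" unfolding Z_def
    by (rule countable_UN[OF countable_finite[OF \<H>(1)] countable_bad_radii[OF \<H>(2)]])
  define X where "X = X1 \<union> (Z \<inter> {0<..})"
  have X: "finite_log_measure X"
    unfolding X_def by (rule finite_log_measure_union_countable[OF X1(1) \<open>countable Z\<close>])
  have good: "F z \<noteq> 0" if "r \<notin> X" "r > 0" "F \<in> \<H>" "norm z = r" for F z r
    using that by (auto simp: X_def Z_def)
  define \<Lambda> where "\<Lambda> j z = ln (norm (f j z)) - ln (norm (G z))" for j z
  have pos: "0 < (1::real)" "0 < (1/2::real)" "0 < (1/4::real)" by simp_all
  have upperG: "\<forall>\<^sub>F \<rho> in at_top. (\<forall>z. norm z = \<rho> \<longrightarrow> G z \<noteq> 0) \<longrightarrow> cmean 0 \<rho> (\<lambda>z. ln (norm (G z))) \<le> 3 * T \<rho>"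
    using eventually_le_T[OF top pos(1), of "u 0"] T1 eventually_gt_at_top[of 0]
  proof eventually_elim
    case (elim \<rho>)
    show ?case
    proof
      assume "\<forall>z. norm z = \<rho> \<longrightarrow> G z \<noteq> 0"
      then have "cmean 0 \<rho> (\<lambda>z. ln (norm (G z))) \<le> T \<rho> + u 0 + cmean 0 \<rho> (\<lambda>_. 0)"
        using elim Gu by (intro cmean_ln_le hG) auto
      then show "cmean 0 \<rho> (\<lambda>z. ln (norm (G z))) \<le> 3 * T \<rho>" using elim by simp
    qed
  qed
  have cB: "continuous_on A (\<lambda>z. coeff_log z + ln (real (n + 1)))" for A
    by (intro continuous_on_add coeff_log_continuous continuous_on_const)
  have mB: "cmean 0 \<rho> (\<lambda>z. coeff_log z + ln (real (n + 1))) = cmean 0 \<rho> coeff_log + ln (real (n + 1))" if "\<rho> > 0" for \<rho>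
    using that by (subst cmean_add) (auto intro: coeff_log_continuous)
  have upperF: "\<forall>\<^sub>F \<rho> in at_top. (\<forall>z. norm z = \<rho> \<longrightarrow> f j z \<noteq> 0) \<longrightarrow> cmean 0 \<rho> (\<lambda>z. ln (norm (f j z))) \<le> 3 * T \<rho>"
    if j: "j \<le> q" for j
    using eventually_le_T[OF top pos(1), of "u 0 + ln (real (n + 1))"] mean_coeff_log_small[OF pos(1)] eventually_gt_at_top[of 0]
  proof eventually_elim
    case (elim \<rho>)
    show ?case
    proof
      assume "\<forall>z. norm z = \<rho> \<longrightarrow> f j z \<noteq> 0"
      then have "cmean 0 \<rho> (\<lambda>z. ln (norm (f j z))) \<le> T \<rho> + u 0 + cmean 0 \<rho> (\<lambda>z. coeff_log z + ln (real (n + 1)))"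
        using elim by (intro cmean_ln_le f_hol cB norm_f_le j) auto
      then show "cmean 0 \<rho> (\<lambda>z. ln (norm (f j z))) \<le> 3 * T \<rho>"
        using elim mB[of \<rho>] by simp
    qed
  qed
  have upper: "\<forall>\<^sub>F \<rho> in at_top. (\<forall>z. norm z = \<rho> \<longrightarrow> f j z \<noteq> 0 \<and> G z \<noteq> 0) \<longrightarrow>
        cmean 0 \<rho> (\<lambda>z. \<bar>ln (norm (f j z)) - ln (norm (G z))\<bar>) \<le> 3 * T \<rho>"
    if j: "j \<le> q" for j
  proof -
    obtain C1 where C1: "\<And>\<rho>. \<rho> \<ge> 2 \<Longrightarrow> (\<And>z. norm z = \<rho> \<Longrightarrow> f j z \<noteq> 0) \<Longrightarrow> - C1 \<le> cmean 0 \<rho> (\<lambda>z. ln (norm (f j z)))"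
      using mean_ln_lower[OF f_nz[OF j]] by blast
    obtain C2 where C2: "\<And>\<rho>. \<rho> \<ge> 2 \<Longrightarrow> (\<And>z. norm z = \<rho> \<Longrightarrow> G z \<noteq> 0) \<Longrightarrow> - C2 \<le> cmean 0 \<rho> (\<lambda>z. ln (norm (G z)))"
      using mean_ln_lower[OF Gnz] by blast
    \<comment> \<open>The bound 3 is made up of 2 from \<open>u\<close>, a half from twice the
      quarter allowed to the coefficients, and a half from the constants.\<close>
    show ?thesis
      using eventually_le_T[OF top pos(2), of "2 * u 0 + 2 * ln (real (n + 1)) + C1 + C2"] mean_coeff_log_small[OF pos(3)]
        eventually_ge_at_top[of 2]
    proof eventually_elim
      case (elim \<rho>)
      show ?case
      proof
        assume gd: "\<forall>z. norm z = \<rho> \<longrightarrow> f j z \<noteq> 0 \<and> G z \<noteq> 0"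
        have cf: "continuous_on (sphere 0 \<rho>) (\<lambda>z. ln (norm (f j z)))" and cG: "continuous_on (sphere 0 \<rho>) (\<lambda>z. ln (norm (G z)))"
          using gd by (auto intro!: continuous_ln_norm f_hol hG j)
        have cub: "continuous_on (sphere 0 \<rho>) (\<lambda>z. u z + (coeff_log z + ln (real (n + 1))))"
          by (intro continuous_on_add u_continuous cB)
        \<comment> \<open>\<open>\<bar>x - y\<bar> = 2 * max x y - x - y\<close>: an absolute mean
          is reduced to signed means, which are bounded below by
          \<open>mean_ln_lower\<close>.\<close>
        have gen: "\<bar>x - y\<bar> \<le> 2 * (v + \<beta>) - (y + x)" if "x \<le> v + \<beta>" "y \<le> v + 0" "0 \<le> \<beta>" for x y v \<beta> :: real
          using that by (simp add: abs_le_iff)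
        have "cmean 0 \<rho> (\<lambda>z. \<bar>ln (norm (f j z)) - ln (norm (G z))\<bar>)
          \<le> cmean 0 \<rho> (\<lambda>z. 2 * (u z + (coeff_log z + ln (real (n + 1)))) - (ln (norm (G z)) + ln (norm (f j z))))"
        proof (rule cmean_mono)
          fix z assume "z \<in> sphere (0::complex) \<rho>"
          then have nz: "f j z \<noteq> 0" "G z \<noteq> 0" using gd by auto
          have "ln (norm (f j z)) \<le> ln (exp (u z + (coeff_log z + ln (real (n + 1)))))"
            using nz norm_f_le[OF j, of z] by (intro ln_mono) auto
          moreover have "ln (norm (G z)) \<le> ln (exp (u z + 0))"
            using nz Gu[of z] by (intro ln_mono) auto
          moreover have "0 \<le> coeff_log z + ln (real (n + 1))" using coeff_log_nonneg[of z] by simp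
          ultimately show "\<bar>ln (norm (f j z)) - ln (norm (G z))\<bar>
            \<le> 2 * (u z + (coeff_log z + ln (real (n + 1)))) - (ln (norm (G z)) + ln (norm (f j z)))"
            unfolding ln_exp by (rule gen)
        qed (use elim in \<open>auto intro!: continuous_on_rabs continuous_on_diff continuous_on_mult continuous_on_const
               continuous_on_add cf cG u_continuous coeff_log_continuous\<close>)
        also have "\<dots> = 2 * (cmean 0 \<rho> u + (cmean 0 \<rho> coeff_log + ln (real (n + 1)))) - (cmean 0 \<rho> (\<lambda>z. ln (norm (G z))) + cmean 0 \<rho> (\<lambda>z. ln (norm (f j z))))"
        proof -
          have "cmean 0 \<rho> (\<lambda>z. 2 * (u z + (coeff_log z + ln (real (n + 1)))) - (ln (norm (G z)) + ln (norm (f j z))))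
            = cmean 0 \<rho> (\<lambda>z. 2 * (u z + (coeff_log z + ln (real (n + 1))))) - cmean 0 \<rho> (\<lambda>z. ln (norm (G z)) + ln (norm (f j z)))"
            using elim by (intro cmean_diff continuous_on_mult continuous_on_const continuous_on_add[OF cG cf] cub) auto
          also have "cmean 0 \<rho> (\<lambda>z. ln (norm (G z)) + ln (norm (f j z))) = cmean 0 \<rho> (\<lambda>z. ln (norm (G z))) + cmean 0 \<rho> (\<lambda>z. ln (norm (f j z)))"
            using elim by (intro cmean_add cf cG) auto
          also have "cmean 0 \<rho> (\<lambda>z. 2 * (u z + (coeff_log z + ln (real (n + 1))))) = 2 * (cmean 0 \<rho> u + cmean 0 \<rho> (\<lambda>z. coeff_log z + ln (real (n + 1))))"
            using elim by (subst cmean_cmult, subst cmean_add[OF u_continuous cB]) simp_all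
          finally show ?thesis using elim mB[of \<rho>] by simp
        qed
        also have "\<dots> \<le> 3 * T \<rho>"
          using C1[of \<rho>] C2[of \<rho>] gd elim unfolding T_eq by simp
        finally show "cmean 0 \<rho> (\<lambda>z. \<bar>ln (norm (f j z)) - ln (norm (G z))\<bar>) \<le> 3 * T \<rho>" .
      qed
    qed
  qed
  obtain \<kappa>P where \<kappa>P: "\<And>r. r > 0 \<Longrightarrow> (\<And>z. norm z = r \<Longrightarrow> P z \<noteq> 0) \<Longrightarrow> cmean 0 r (\<lambda>z. ln (norm (P z))) = log_zcount r P + \<kappa>P"
    using Jensen[OF Pnz] by blast
  obtain \<kappa>W where \<kappa>W: "\<And>r. r > 0 \<Longrightarrow> (\<And>z. norm z = r \<Longrightarrow> W z \<noteq> 0) \<Longrightarrow> cmean 0 r (\<lambda>z. ln (norm (W z))) = log_zcount r W + \<kappa>W"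
    using Jensen[OF Wnz] by blast
  have "\<forall>s\<in>selections. \<exists>C. \<forall>\<rho>\<ge>2. (\<forall>z. norm z = \<rho> \<longrightarrow> coeff_det s z \<noteq> 0) \<longrightarrow> - C \<le> cmean 0 \<rho> (\<lambda>z. ln (norm (coeff_det s z)))"
    using mean_ln_lower[OF coeff_det_nz] by blast
  from bchoice[OF this] obtain CD where CD: "\<forall>s\<in>selections. \<forall>\<rho>\<ge>2. (\<forall>z. norm z = \<rho> \<longrightarrow> coeff_det s z \<noteq> 0) \<longrightarrow> - CD s \<le> cmean 0 \<rho> (\<lambda>z. ln (norm (coeff_det s z)))" ..
  define \<Delta> where "\<Delta> r = nevanlinna_N r (\<lambda>z. 1 / L z) - nevanlinna_N r L" for r
  have L_eq: "L = (\<lambda>z. P z / W z)" "(\<lambda>z. 1 / L z) = (\<lambda>z. W z / P z)"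
    using L_def by (auto simp: P_def fun_eq_iff)
  define q' where "q' = real q - real n"
  have q': "q' > 0" using qn by (simp add: q'_def)
  have main: "\<forall>\<^sub>F r in at_top. r \<notin> X \<longrightarrow> q' * T r - \<Delta> r \<le> \<epsilon> * T r" if \<epsilon>: "\<epsilon> > 0" for \<epsilon>
  proof -
    \<comment> \<open>Counts the errors \<open>e * T r\<close>: one for the constants,
      \<open>n + 2\<close> for each defect with weight \<open>q' + 1\<close>, and
      \<open>q + 2\<close> for each of the \<open>n + 1\<close> rows.\<close>
    define M where "M = 1 + (q' + 1) * real (card selections) * real (n + 2) + real (n + 1) * real (q + 2)"
    have M: "M > 0" unfolding M_def using q' by (intro add_pos_nonneg) auto
    define e where "e = \<epsilon> / M"
    have e: "e > 0" "e * M = \<epsilon>" using \<epsilon> M by (auto simp: e_def)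
    have evE: "\<forall>\<^sub>F r in at_top. \<forall>s\<in>selections. ln (fact (Suc n)) + CD s \<le> e * T r"
      by (rule eventually_ball_finite[OF finite_selections]) (use eventually_le_T[OF top e(1)] in blast)
    have evQ: "\<forall>\<^sub>F r in at_top. \<forall>i\<in>{..n}. \<forall>j\<in>{..q}. T (r + r powr (1 - \<tau>)) \<le> 2 * T r \<longrightarrow>
      (\<forall>z. norm z = r \<longrightarrow> f j z \<noteq> 0 \<and> G z \<noteq> 0 \<and> f j (z + of_nat i * c) \<noteq> 0 \<and> G (z + of_nat i * c) \<noteq> 0) \<longrightarrow>
      cmean 0 r (\<lambda>z. \<bar>(ln (norm (f j (z + of_nat i * c))) - ln (norm (G (z + of_nat i * c)))) - (ln (norm (f j z)) - ln (norm (G z)))\<bar>) \<le> e * T r"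
      by (intro eventually_ball_finite ballI mean_shift_quotient_small[OF top \<tau>(2,3)] f_nz Gnz upperF upperG upper e) auto
    have evC: "\<forall>\<^sub>F r in at_top. \<forall>i\<in>{..n}. T (r + r powr (1 - \<tau>)) \<le> 2 * T r \<longrightarrow>
      (\<forall>z. norm z = r \<longrightarrow> G z \<noteq> 0 \<and> G (z + of_nat i * c) \<noteq> 0) \<longrightarrow>
      cmean (of_nat i * c) r (\<lambda>z. ln (norm (G z))) - cmean 0 r (\<lambda>z. ln (norm (G z))) \<le> e * T r"
      by (intro eventually_ball_finite ballI mean_shift_center_small[OF top \<tau>(2,3)] Gnz G0 Gb upperG e) auto
    show ?thesis
      using evE evQ evC X1(2) mean_coeff_log_small[OF e(1)] eventually_ge_at_top[of 2]
        eventually_le_T[OF top e(1), of "\<kappa>P - \<kappa>W + ln (fact (Suc n)) - q' * u 0"]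
    proof eventually_elim
      case (elim r)
      show ?case
      proof
        assume rX: "r \<notin> X"
        have r: "r \<ge> 2" "r > 0" "r \<ge> 0" using elim by auto
        have T2: "T (r + r powr (1 - \<tau>)) \<le> 2 * T r" using elim rX by (auto simp: X_def)
        have gf: "f j z \<noteq> 0" if "j \<le> q" "norm z = r" for j z
          using good[OF rX r(2) _ that(2), of "f j"] that by (auto simp: \<H>_def)
        have gG: "G z \<noteq> 0" and gW: "W z \<noteq> 0" if "norm z = r" for z
          using good[OF rX r(2) _ that] by (auto simp: \<H>_def)
        have gD: "coeff_det s z \<noteq> 0" if "s \<in> selections" "norm z = r" for s z
          using good[OF rX r(2) _ that(2), of "coeff_det s"] that by (auto simp: \<H>_def)
        have gfs: "f j (z + of_nat i * c) \<noteq> 0" if "i \<le> n" "j \<le> q" "norm z = r" for i j z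
        proof -
          have "(\<lambda>z. f j (z + of_nat i * c)) \<in> (\<lambda>(i, j). \<lambda>z. f j (z + of_nat i * c)) ` ({..n} \<times> {..q})"
            using that by (intro image_eqI[of _ _ "(i, j)"]) auto
          then have "(\<lambda>z. f j (z + of_nat i * c)) \<in> \<H>" unfolding \<H>_def by blast
          from good[OF rX r(2) this that(3)] show ?thesis .
        qed
        have gGs: "G (z + of_nat i * c) \<noteq> 0" if "i \<le> n" "norm z = r" for i z
        proof -
          have "(\<lambda>z. G (z + of_nat i * c)) \<in> (\<lambda>i z. G (z + of_nat i * c)) ` {..n}"
            using that by (intro image_eqI[of _ _ i]) auto
          then have "(\<lambda>z. G (z + of_nat i * c)) \<in> \<H>" unfolding \<H>_def by blast
          from good[OF rX r(2) this that(2)] show ?thesis .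
        qed
        let ?S = "sphere (0::complex) r"
        have cf: "continuous_on ?S (\<lambda>z. ln (norm (f j z)))" if "j \<le> q" for j
          using gf that by (intro continuous_ln_norm f_hol) auto
        have cW: "continuous_on ?S (\<lambda>z. ln (norm (W z)))"
          using gW Wnz by (intro continuous_ln_norm) (auto simp: entire_nz_def)
        have cG: "continuous_on ?S (\<lambda>z. ln (norm (G z)))"
          using gG by (intro continuous_ln_norm hG) auto
        have cD: "continuous_on ?S (\<lambda>z. ln (norm (coeff_det s z)))" if "s \<in> selections" for s
          using gD that by (intro continuous_ln_norm coeff_det_hol) auto
        have cfs: "continuous_on ?S (\<lambda>z. ln (norm (f j (z + of_nat i * c))))" if "i \<le> n" "j \<le> q" for i j
          using gfs that entire_nz_shift[OF f_nz, of j] by (intro continuous_ln_norm) (auto simp: entire_nz_def)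
        have cGs: "continuous_on ?S (\<lambda>z. ln (norm (G (z + of_nat i * c))))" if "i \<le> n" for i
          using gGs that entire_nz_shift[OF Gnz] by (intro continuous_ln_norm) (auto simp: entire_nz_def)
        have cE: "continuous_on ?S (det_defect s)" if "s \<in> selections" for s
          unfolding det_defect_def using that
          by (intro continuous_on_diff continuous_on_add continuous_on_mult continuous_on_const coeff_log_continuous cD)
        define \<Phi> where "\<Phi> i j z = \<bar>(ln (norm (f j (z + of_nat i * c))) - ln (norm (G (z + of_nat i * c)))) - (ln (norm (f j z)) - ln (norm (G z)))\<bar>" for i j z
        have c\<Phi>: "continuous_on ?S (\<Phi> i j)" if "i \<le> n" "j \<le> q" for i j
          unfolding \<Phi>_def using that by (intro continuous_on_rabs continuous_on_diff cf cG cfs cGs)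
        \<comment> \<open>The part from \<open>G\<close> keeps its sign; the sum over all
          \<open>j\<close> makes the bound the same for all forms, as the row bound demands.\<close>
        define R where "R i z = (ln (norm (G (z + of_nat i * c))) - ln (norm (G z))) + (\<Sum>j\<le>q. \<Phi> i j z)" for i z
        have cR: "continuous_on ?S (R i)" if "i \<le> n" for i
          unfolding R_def using that by (intro continuous_on_add continuous_on_diff continuous_on_sum cG cGs c\<Phi>) auto
        have point: "q' * u z \<le> (\<Sum>j\<le>q. ln (norm (f j z))) - ln (norm (W z)) + (q' + 1) * (\<Sum>s\<in>selections. det_defect s z)
            + ln (fact (Suc n)) + (\<Sum>i\<le>n. R i z)" if z: "norm z = r" for z
          unfolding q'_def
        proof (rule pointwise_inequality)
          fix i j assume ij: "i \<le> n" "j \<le> q"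
          have "\<Phi> i j z \<le> (\<Sum>j\<le>q. \<Phi> i j z)" using ij by (intro member_le_sum) (auto simp: \<Phi>_def)
          then show "ln (norm (f j (z + of_nat i * c))) - ln (norm (f j z)) \<le> R i z"
            unfolding R_def \<Phi>_def by linarith
        qed (use z gf gW gD gfs in auto)
        have mf: "cmean 0 r (\<lambda>z. \<Sum>j\<le>q. ln (norm (f j z))) = cmean 0 r (\<lambda>z. ln (norm (P z)))"
        proof (rule cmean_cong)
          fix z assume "z \<in> sphere (0::complex) r"
          then have "f j z \<noteq> 0" if "j \<le> q" for j using gf that by auto
          then show "(\<Sum>j\<le>q. ln (norm (f j z))) = ln (norm (P z))"
            unfolding P_def atMost_atLeast0 prod_norm[symmetric] by (subst ln_prod) auto
        qed (rule r)
        have gP: "P z \<noteq> 0" if "norm z = r" for z using gf that by (auto simp: P_def)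
        \<comment> \<open>The mean of \<open>ln (norm L)\<close>: Jensen's formula is applied to
          numerator and denominator separately, and \<open>nevanlinna_N_quotient\<close> allows them
          to have common zeros.\<close>
        have mL: "cmean 0 r (\<lambda>z. ln (norm (P z))) - cmean 0 r (\<lambda>z. ln (norm (W z))) = \<Delta> r + (\<kappa>P - \<kappa>W)"
          unfolding \<Delta>_def L_eq(2) using \<kappa>P[OF r(2) gP] \<kappa>W[OF r(2) gW] nevanlinna_N_quotient[OF Wnz Pnz r(2)]
          unfolding L_eq(1) by simp
        have mE: "cmean 0 r (det_defect s) \<le> real (n + 2) * (e * T r)" if s: "s \<in> selections" for s
        proof -
          have "cmean 0 r (det_defect s) = cmean 0 r (\<lambda>z. ln (fact (Suc n)) + real (Suc n) * coeff_log z) - cmean 0 r (\<lambda>z. ln (norm (coeff_det s z)))"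
            unfolding det_defect_def using r s by (intro cmean_diff continuous_on_add continuous_on_mult continuous_on_const coeff_log_continuous cD)
          also have "cmean 0 r (\<lambda>z. ln (fact (Suc n)) + real (Suc n) * coeff_log z) = ln (fact (Suc n)) + real (Suc n) * cmean 0 r coeff_log"
            using r by (subst cmean_add) (auto intro!: continuous_on_mult continuous_on_const coeff_log_continuous simp: cmean_cmult simp del: fact_Suc of_nat_Suc)
          also have "- CD s \<le> cmean 0 r (\<lambda>z. ln (norm (coeff_det s z)))" using CD s r gD[OF s] by blast
          then have "ln (fact (Suc n)) + real (Suc n) * cmean 0 r coeff_log - cmean 0 r (\<lambda>z. ln (norm (coeff_det s z)))
            \<le> (ln (fact (Suc n)) + CD s) + real (Suc n) * cmean 0 r coeff_log" by linarith
          also have "\<dots> \<le> e * T r + real (Suc n) * (e * T r)"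
            using elim(1,5) s by (intro add_mono mult_left_mono) auto
          finally show ?thesis by (simp add: algebra_simps)
        qed
        have mR: "cmean 0 r (R i) \<le> real (q + 2) * (e * T r)" if i: "i \<le> n" for i
        proof -
          have "cmean 0 r (R i) = cmean 0 r (\<lambda>z. ln (norm (G (z + of_nat i * c))) - ln (norm (G z))) + cmean 0 r (\<lambda>z. \<Sum>j\<le>q. \<Phi> i j z)"
            unfolding R_def using r i by (intro cmean_add continuous_on_diff continuous_on_sum cG cGs c\<Phi>) auto
          also have "cmean 0 r (\<lambda>z. ln (norm (G (z + of_nat i * c))) - ln (norm (G z)))
             = cmean (of_nat i * c) r (\<lambda>z. ln (norm (G z))) - cmean 0 r (\<lambda>z. ln (norm (G z)))"
            using r i by (subst cmean_shift[of "of_nat i * c"]) (intro cmean_diff cG cGs; simp)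
          also have "\<dots> \<le> e * T r" using elim(3) i T2 gG gGs by auto
          also have "cmean 0 r (\<lambda>z. \<Sum>j\<le>q. \<Phi> i j z) = (\<Sum>j\<le>q. cmean 0 r (\<Phi> i j))"
            using r i by (intro cmean_sum c\<Phi>) auto
          also have "\<dots> \<le> (\<Sum>j\<le>q. e * T r)"
          proof (rule sum_mono)
            fix j assume "j \<in> {..q}"
            then show "cmean 0 r (\<Phi> i j) \<le> e * T r"
              using elim(2) i T2 gf gG gfs gGs unfolding \<Phi>_def by auto
          qed
          finally show ?thesis by (simp add: algebra_simps)
        qed
        have "q' * cmean 0 r u \<le> cmean 0 r (\<lambda>z. (\<Sum>j\<le>q. ln (norm (f j z))) - ln (norm (W z)) + (q' + 1) * (\<Sum>s\<in>selections. det_defect s z)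
            + ln (fact (Suc n)) + (\<Sum>i\<le>n. R i z))"
          unfolding cmean_cmult[symmetric]
          using r by (intro cmean_mono point continuous_on_add continuous_on_diff continuous_on_sum continuous_on_mult
             continuous_on_const u_continuous cf cW cE cR) auto
        also have "\<dots> = (cmean 0 r (\<lambda>z. \<Sum>j\<le>q. ln (norm (f j z))) - cmean 0 r (\<lambda>z. ln (norm (W z)))
            + (q' + 1) * (\<Sum>s\<in>selections. cmean 0 r (det_defect s)) + ln (fact (Suc n))) + (\<Sum>i\<le>n. cmean 0 r (R i))"
        proof -
          have c1: "continuous_on ?S (\<lambda>z. \<Sum>j\<le>q. ln (norm (f j z)))" by (intro continuous_on_sum cf) auto
          have c2: "continuous_on ?S (\<lambda>z. (q' + 1) * (\<Sum>s\<in>selections. det_defect s z))"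
            by (intro continuous_on_mult continuous_on_const continuous_on_sum cE)
          have c3: "continuous_on ?S (\<lambda>z. \<Sum>i\<le>n. R i z)" by (intro continuous_on_sum cR) auto
          note c4 = continuous_on_diff[OF c1 cW]
          note c5 = continuous_on_add[OF c4 c2]
          note c6 = continuous_on_add[OF c5 continuous_on_const[of _ "ln (fact (Suc n))"]]
          have s1: "cmean 0 r (\<lambda>z. \<Sum>s\<in>selections. det_defect s z) = (\<Sum>s\<in>selections. cmean 0 r (det_defect s))"
            by (intro cmean_sum finite_selections cE r)
          have s2: "cmean 0 r (\<lambda>z. \<Sum>i\<le>n. R i z) = (\<Sum>i\<le>n. cmean 0 r (R i))"
            by (intro cmean_sum cR r) auto
          show ?thesis
            unfolding cmean_add[OF c6 c3 r(3)] cmean_add[OF c5 continuous_on_const r(3)] cmean_add[OF c4 c2 r(3)]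
              cmean_diff[OF c1 cW r(3)] cmean_cmult s1 s2 cmean_const ..
        qed
        also have "\<dots> \<le> (\<Delta> r + (\<kappa>P - \<kappa>W) + (q' + 1) * (\<Sum>s\<in>selections. real (n + 2) * (e * T r)) + ln (fact (Suc n)))
            + (\<Sum>i\<le>n. real (q + 2) * (e * T r))"
          unfolding mf mL using q' mE mR by (intro add_mono mult_left_mono sum_mono) auto
        also have "\<dots> = \<Delta> r + (\<kappa>P - \<kappa>W + ln (fact (Suc n))) + (M - 1) * (e * T r)"
          by (simp add: M_def algebra_simps del: fact_Suc)
        finally have "q' * (T r + u 0) \<le> \<Delta> r + (\<kappa>P - \<kappa>W + ln (fact (Suc n))) + (M - 1) * (e * T r)"
          unfolding T_eq by simp
        then have "q' * T r - \<Delta> r \<le> M * (e * T r)"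
          using elim(7) by (simp add: algebra_simps del: fact_Suc)
        also have "M * (e * T r) = \<epsilon> * T r" unfolding e(2)[symmetric] by (simp only: mult_ac)
        finally show "q' * T r - \<Delta> r \<le> \<epsilon> * T r" .
      qed
    qed
  qed
  \<comment> \<open>\<open>main\<close> bounds the difference from above only; the maximum with 0
    makes it small in absolute value.\<close>
  define S where "S r = max 0 (q' * T r - \<Delta> r)" for r
  have "S \<in> o[inf at_top (principal (- X))](T)"
  proof (rule landau_o.smallI)
    fix \<epsilon> :: real assume \<epsilon>: "\<epsilon> > 0"
    have "\<forall>\<^sub>F r in at_top. r \<in> - X \<longrightarrow> norm (S r) \<le> \<epsilon> * norm (T r)"
      using main[OF \<epsilon>] T1
    proof eventually_elim
      case (elim r)
      then show ?case using \<epsilon> by (auto simp: S_def)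
    qed
    then show "\<forall>\<^sub>F r in inf at_top (principal (- X)). norm (S r) \<le> \<epsilon> * norm (T r)"
      by (simp add: eventually_inf_principal)
  qed
  moreover have "\<forall>\<^sub>F r in inf at_top (principal (- X)).
      (real q - real n) * T r \<le> nevanlinna_N r (\<lambda>z. 1 / L z) - nevanlinna_N r L + S r"
    by (intro always_eventually) (auto simp: S_def \<Delta>_def q'_def)
  ultimately show ?thesis using X by blast
qed

end

theorem theorem1p2:
  fixes c :: complex and n q :: nat
    and g f :: "nat \<Rightarrow> complex \<Rightarrow> complex"
    and a :: "nat \<Rightarrow> nat \<Rightarrow> complex \<Rightarrow> complex"
    and L :: "complex \<Rightarrow> complex"
  assumes "n \<ge> 1" and "q > n"
    and "reduced_representation n g"
    and "hyper_order (cartan_T n g) < 1"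
    and "lin_indep_over (periodic_field c) {0..n} g"
    and "\<And>i j. i \<le> n \<Longrightarrow> j \<le> q \<Longrightarrow> a i j holomorphic_on UNIV"
    and "\<And>i j z. i \<le> n \<Longrightarrow> j \<le> q \<Longrightarrow> a i j (z + c) = a i j z"
    and "\<And>i j. i \<le> n \<Longrightarrow> j \<le> q \<Longrightarrow>
           (\<lambda>r. nevanlinna_T r (a i j)) \<in> o[at_top](cartan_T n g)"
    and "\<And>j z. j \<le> q \<Longrightarrow> f j z = (\<Sum>i=0..n. a i j z * g i z)"
    and "\<And>J. J \<subseteq> {0..q} \<Longrightarrow> card J = n + 1 \<Longrightarrow> lin_indep_over (periodic_field c) J f"
    and "\<And>z. L z = (\<Prod>j=0..q. f j z) / casorati c n g z"
  shows "\<exists>E S. finite_log_measure E \<and>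
           S \<in> o[inf at_top (principal (- E))](cartan_T n g) \<and>
           (\<forall>\<^sub>F r in inf at_top (principal (- E)).
              (real q - real n) * cartan_T n g r
                \<le> nevanlinna_N r (\<lambda>z. 1 / L z) - nevanlinna_N r L + S r)"
proof -
  interpret moving_targets n g c q f a L
    by unfold_locales (fact assms)+
  show ?thesis by (rule second_main_theorem)
qed

end
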